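(* Fix $y\in\mathbb{R}^d$, an integer $k\ge 0$, and a measurable $g:\mathbb{R}^d\to\mathbb{R}$. Let $X,V$ be independent $\mathbb{R}^d$-valued random vectors, $Y=X+V$, where $P_V$ has a Lebesgue density $f_V\in C_0^k(\mathbb{R}^d;\mathbb{R})$ and $\varphi_V(\omega)\ne 0$ for Lebesgue-a.e. $\omega$. Let $\lambda_{g,V,y}(x)=g(x)f_V(y-x)$ and assume $\lambda_{g,V,y}\in\Xi^0(\mathbb{R}^d;\mathbb{C})$ and $\widetilde{\lambda}_{g,V,y}\in L^1(\mathbb{R}^d;\mathbb{C})$. Define $\mathcal{Q}_{g,V,y}(\omega)=\widetilde{\lambda}_{g,V,y}(\omega)/\varphi_V(-\omega)$ if $\varphi_V(-\omega)\neq 0$ and $\mathcal{Q}_{g,V,y}(\omega)=0$ otherwise. Assume further: (i) there exists $N\in\mathbb{N}_0$ with $\int_{\mathbb{R}^d}|\mathcal{Q}_{g,V,y}(\omega)|(1+\|\omega\|_2)^{-N}\,d\omega<\infty$ (so that $\mathcal{I}_{\mathcal{Q}_{g,V,y}}[\psi]=\int\mathcal{Q}_{g,V,y}\psi\,d\omega$ defines a tempered distribution); (ii) there exists $C>0$ such that $|\mathcal{F}^{-1}\{\mathcal{I}_{\mathcal{Q}_{g,V,y}}\}[\psi]|\le C\|\psi\|_{\Xi^k}$ for every $\psi\in\mathscr{S}(\mathbb{R}^d)$. Then $\mathcal{F}^{-1}\{\mathcal{I}_{\mathcal{Q}_{g,V,y}}\}$ extends uniquely to a continuous linear functional on $\Xi^k(\mathbb{R}^d;\mathbb{C})$,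 and its restriction to $\mathcal{A}_V(\mathbb{R}^d)$ equals the Tweedie functional $\mathcal{T}_{g,V,y}$. Equivalently, for every $f\in\mathcal{A}_V(\mathbb{R}^d)$ and every sequence $(f_n)\subset\mathscr{S}(\mathbb{R}^d)$ with $\|f_n-f\|_{\Xi^k}\to 0$, \[ \mathcal{T}_{g,V,y}[f]=\lim_{n\to\infty}\mathcal{F}^{-1}\{\mathcal{I}_{\mathcal{Q}_{g,V,y}}\}[f_n], \] and the limit does not depend on the approximating sequence.
   Context: Fourier conventions: $\widetilde\psi(\omega)=\int e^{i\omega^\top x}\psi(x)\,dx$ and $\psi^\sharp(x)=(2\pi)^{-d}\int e^{-i\omega^\top x}\psi(\omega)\,d\omega$; $\varphi_V(\omega)=\mathbb{E}[e^{i\omega^\top V}]$. $C_0^k(\mathbb{R}^d;\mathbb{C})$ is the space of $C^k$ functions all of whose partial derivatives of order $\le k$ vanish at infinity; $\Xi^k=C_0^k\cap L^1$ with norm $\|\psi\|_{\Xi^k}=\max_{|\alpha|\le k}\|\partial^\alpha\psi\|_\infty+\|\psi\|_1$. $\mathscr{S}(\mathbb{R}^d)$ is the Schwartz space; a tempered distribution is a continuous linear functional on it, and for a tempered distribution $T$, $\mathcal{F}^{-1}\{T\}[\psi]=T[\psi^\sharp]$. $\mathcal{M}(\mathbb{R}^d)$ is the space of finite signed Radon measures with total variation norm; $\mathcal{A}_V(\mathbb{R}^d)=\{f_V*\mu:\mu\in\mathcal{M}(\mathbb{R}^d)\}$ with norm $\|f_V*\mu\|_{\mathcal{A}_V}=\|\mu\|_{TV}$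 (the representing $\mu$ is unique). The Tweedie functional $\mathcal{T}_{g,V,y}$ is the unique continuous linear functional on $\mathcal{A}_V$ with $\mathcal{T}_{g,V,y}[f_V*\mu]=\int\lambda_{g,V,y}\,d\mu$ for all $\mu\in\mathcal{M}(\mathbb{R}^d)$. *)

theory Defs
  imports "HOL-Analysis.Analysis" "HOL-Probability.Probability"
begin

fun pds :: "'a::euclidean_space list \<Rightarrow> ('a \<Rightarrow> 'b::real_normed_vector) \<Rightarrow> 'a \<Rightarrow> 'b" where
  "pds [] f = f"
| "pds (b # bs) f = (\<lambda>x. frechet_derivative (pds bs f) (at x) b)"

definition multi_idx :: "nat \<Rightarrow> 'a::euclidean_space list set" where
  "multi_idx k = {bs. set bs \<subseteq> Basis \<and> length bs \<le> k}"

definition Ck :: "nat \<Rightarrow> ('a::euclidean_space \<Rightarrow> 'b::real_normed_vector) \<Rightarrow> bool" where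
  "Ck k f \<longleftrightarrow>
     (\<forall>bs. set bs \<subseteq> Basis \<and> length bs < k \<longrightarrow> (\<forall>x. pds bs f differentiable at x)) \<and>
     (\<forall>bs\<in>multi_idx k. continuous_on UNIV (pds bs f))"

definition C0k :: "nat \<Rightarrow> ('a::euclidean_space \<Rightarrow> 'b::real_normed_vector) \<Rightarrow> bool" where
  "C0k k f \<longleftrightarrow> Ck k f \<and> (\<forall>bs\<in>multi_idx k. (pds bs f \<longlongrightarrow> 0) at_infinity)"

definition Xi :: "nat \<Rightarrow> ('a::euclidean_space \<Rightarrow> complex) set" where
  "Xi k = {f. C0k k f \<and> integrable lborel f}"

definition xi_norm :: "nat \<Rightarrow> ('a::euclidean_space \<Rightarrow> complex) \<Rightarrow> real" where
  "xi_norm k f = (SUP bs\<in>multi_idx k. SUP x. norm (pds bs f x)) + (\<integral>x. norm (f x) \<partial>lborel)"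

definition schwartz :: "('a::euclidean_space \<Rightarrow> complex) \<Rightarrow> bool" where
  "schwartz f \<longleftrightarrow> (\<forall>k. Ck k f) \<and>
     (\<forall>bs (N::nat). set bs \<subseteq> Basis \<longrightarrow>
        bounded (range (\<lambda>x. (1 + norm x) ^ N *\<^sub>R pds bs f x)))"

definition ft :: "('a::euclidean_space \<Rightarrow> complex) \<Rightarrow> 'a \<Rightarrow> complex" where
  "ft f \<omega> = (\<integral>x. cis (\<omega> \<bullet> x) * f x \<partial>lborel)"

definition ift :: "('a::euclidean_space \<Rightarrow> complex) \<Rightarrow> 'a \<Rightarrow> complex" where
  "ift f x = complex_of_real (1 / (2 * pi) ^ DIM('a)) * (\<integral>\<omega>. cis (- (\<omega> \<bullet> x)) * f \<omega> \<partial>lborel)"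

definition char_fn :: "'s measure \<Rightarrow> ('s \<Rightarrow> 'a::euclidean_space) \<Rightarrow> 'a \<Rightarrow> complex" where
  "char_fn M V \<omega> = (\<integral>s. cis (\<omega> \<bullet> V s) \<partial>M)"

text \<open>F^{-1}{I_Q}[psi] = I_Q[psi^sharp] = \<integral> Q(omega) psi^sharp(omega) d omega.\<close>
definition inv_ft_reg_distr :: "('a::euclidean_space \<Rightarrow> complex) \<Rightarrow> ('a \<Rightarrow> complex) \<Rightarrow> complex" where
  "inv_ft_reg_distr Q \<psi> = (\<integral>\<omega>. Q \<omega> * ift \<psi> \<omega> \<partial>lborel)"

text \<open>A finite signed Borel (= Radon on R^d) measure mu is represented as mu1 - mu2 with
  mu1, mu2 finite Borel measures.\<close>
definition fin_borel :: "'a::euclidean_space measure \<Rightarrow> bool" where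
  "fin_borel \<mu> \<longleftrightarrow> finite_measure \<mu> \<and> sets \<mu> = sets borel"

definition conv_meas :: "('a::euclidean_space \<Rightarrow> real) \<Rightarrow> 'a measure \<Rightarrow> 'a measure \<Rightarrow> 'a \<Rightarrow> real" where
  "conv_meas fV \<mu>1 \<mu>2 x = (\<integral>z. fV (x - z) \<partial>\<mu>1) - (\<integral>z. fV (x - z) \<partial>\<mu>2)"

end

theory Submission
  imports Defs
begin

text \<open>
  The functional extends because Schwartz functions are dense: the approximants of \<open>\<psi>\<close> are
  \<open>(\<psi> 1\<^sub>B) * \<gamma>\<^sub>s\<close> with a ball \<open>B\<close> and a Gaussian \<open>\<gamma>\<^sub>s\<close> of width \<open>s\<close>. Truncating before mollifying needs no
  product rule, since all derivatives fall on \<open>\<gamma>\<^sub>s\<close>, and it makes the inverse transform of the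
  approximant a uniformly bounded function times the transform of \<open>\<gamma>\<^sub>s\<close>. As that factor decays faster
  than \<open>Q\<close> grows, letting \<open>B\<close> exhaust the space gives \<open>L (\<psi> * \<gamma>\<^sub>s) = \<integral> Q \<psi>\<^sup>\<sharp> exp (- s\<^sup>2 |\<omega>|\<^sup>2 / 2)\<close>. For
  \<open>\<psi> = f\<^sub>V * \<mu>\<close> the factor \<open>\<phi>\<^sub>V\<close> in \<open>\<psi>\<^sup>\<sharp>\<close> cancels the denominator of \<open>Q\<close>, and by Fubini the integral is
  \<open>\<integral> (\<lambda> * \<gamma>\<^sub>s) d\<mu>\<close>, which tends to \<open>\<integral> \<lambda> d\<mu>\<close> as \<open>s\<close> tends to 0.
\<close>

section \<open>Seminorms and extension by density\<close>

text \<open>The growth bound on \<open>Q\<close> does not make the integral of \<open>Q\<close>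
  against the inverse transform of a general element of \<open>Xi k\<close> converge, so the
  extension is explicit only on Schwartz functions. A convolution of \<open>fV\<close> with a
  measure, even mollified, need not be Schwartz. This forces two limits of different kinds. At a
  fixed Gaussian width the radius of the ball tends to infinity, and both the norm of
  \<open>Xi k\<close> and the frequency integral can follow. When the width tends to 0, the
  frequency integral is out of reach: continuity in the norm of \<open>Xi k\<close> is used on one
  side, and bounded convergence against the measure on the other. The Gaussian is convenient because
  its transform is explicit: the only inversion formula needed is its own, and it supplies the
  factor \<open>(2 * pi) ^ DIM('a)\<close> that cancels the normalisation of \<open>ift\<close>. The
  evaluation is done for one finite positive measure at a time; linearity of the extension then
  gives differences of two.\<close>

lemma Nil_in_multi_idx [simp]: "[] \<in> multi_idx k"
  by (simp add: multi_idx_def)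

text \<open>Finiteness bounds the outer supremum in \<open>xi_norm\<close>, gives one bound for all
  derivatives at once, and makes uniform convergence of each single derivative simultaneous.\<close>

lemma finite_multi_idx [simp]: "finite (multi_idx k :: 'a::euclidean_space list set)"
proof -
  have "multi_idx k = {bs :: 'a list. set bs \<subseteq> Basis \<and> length bs \<le> k}"
    by (simp add: multi_idx_def)
  then show ?thesis
    using finite_lists_length_le[of "Basis :: 'a set" k] by simp
qed

lemma Ck_differentiable:
  assumes "Ck k f" "set bs \<subseteq> Basis" "length bs < k"
  shows "pds bs f differentiable at x"
  using assms by (auto simp: Ck_def)

lemma Ck_continuous:
  assumes "Ck k f" "bs \<in> multi_idx k"
  shows "continuous_on UNIV (pds bs f)"
  using assms by (auto simp: Ck_def)

section \<open>Continuous functions that vanish at infinity\<close>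

lemma C0k_0: "C0k 0 f \<longleftrightarrow> continuous_on UNIV f \<and> (f \<longlongrightarrow> 0) at_infinity"
proof -
  have "multi_idx 0 = {[] :: 'a list}"
    by (auto simp: multi_idx_def)
  then show ?thesis
    by (simp add: C0k_def Ck_def)
qed

lemma C0_bounded:
  fixes f :: "'a::euclidean_space \<Rightarrow> 'b::real_normed_vector"
  assumes "continuous_on UNIV f" "(f \<longlongrightarrow> 0) at_infinity"
  shows "bounded (range f)"
proof -
  have "eventually (\<lambda>x. dist (f x) 0 < 1) at_infinity"
    using tendstoD[OF assms(2), of 1] by simp
  then obtain R where R: "\<And>x. norm x \<ge> R \<Longrightarrow> norm (f x) < 1"
    by (auto simp: eventually_at_infinity)
  have "compact (f ` cball 0 R)"
    using assms(1) by (intro compact_continuous_image) (auto intro: continuous_on_subset)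
  then obtain B where B: "\<And>x. norm x \<le> R \<Longrightarrow> norm (f x) \<le> B"
    unfolding bounded_iff by (metis (no_types) compact_imp_bounded bounded_iff imageI mem_cball_0)
  have "norm (f x) \<le> max 1 B" for x
    using R[of x] B[of x] by (cases "norm x \<le> R") auto
  then show ?thesis
    by (auto simp: bounded_iff)
qed

text \<open>Compactness gives uniform continuity on a ball only. The ball has radius
  \<open>R + 1\<close> and distances are kept below 1, so two close points lie both in it or both
  where \<open>f\<close> is below \<open>e / 2\<close>.\<close>

lemma C0_uniformly_continuous:
  fixes f :: "'a::euclidean_space \<Rightarrow> 'b::real_normed_vector"
  assumes "continuous_on UNIV f" "(f \<longlongrightarrow> 0) at_infinity" "e > 0"
  obtains d where "d > 0" "\<And>x z. norm (x - z) < d \<Longrightarrow> norm (f x - f z) < e"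
proof -
  have "eventually (\<lambda>x. dist (f x) 0 < e / 2) at_infinity"
    using tendstoD[OF assms(2), of "e / 2"] assms(3) by simp
  then obtain R where R: "\<And>x. norm x \<ge> R \<Longrightarrow> norm (f x) < e / 2"
    by (auto simp: eventually_at_infinity)
  have "uniformly_continuous_on (cball 0 (R + 1)) f"
    using assms(1) by (intro compact_uniformly_continuous) (auto intro: continuous_on_subset)
  then obtain d where d: "d > 0"
    "\<And>x z. x \<in> cball 0 (R + 1) \<Longrightarrow> z \<in> cball 0 (R + 1) \<Longrightarrow> dist x z < d \<Longrightarrow> dist (f x) (f z) < e"
    using assms(3) unfolding uniformly_continuous_on_def by metis
  have "norm (f x - f z) < e" if xz: "norm (x - z) < min d 1" for x z
  proof (cases "norm x \<le> R + 1 \<and> norm z \<le> R + 1")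
    case True
    then show ?thesis
      using d(2)[of z x] xz by (auto simp: dist_norm norm_minus_commute)
  next
    case False
    have "norm x \<le> norm z + norm (x - z)" "norm z \<le> norm x + norm (x - z)"
      using norm_triangle_sub[of x z] norm_triangle_sub[of z x] by (auto simp: norm_minus_commute)
    then have "norm x \<ge> R" "norm z \<ge> R"
      using xz False by auto
    then have "norm (f x) < e / 2" "norm (f z) < e / 2"
      using R by auto
    then show ?thesis
      using norm_triangle_ineq4[of "f x" "f z"] by linarith
  qed
  then show thesis
    using d(1) by (intro that[of "min d 1"]) auto
qed

lemma C0k_pds_bounded:
  assumes "C0k k f" "bs \<in> multi_idx k"
  obtains B where "\<And>x. norm (pds bs f x) \<le> B"
proof -
  have "bounded (range (pds bs f))"
    using assms by (intro C0_bounded) (auto simp: C0k_def Ck_def)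
  then show thesis
    using that by (auto simp: bounded_iff)
qed

section \<open>Linear combinations and the norm of Xi\<close>

lemma has_derivative_lincomb:
  fixes f g :: "'a::real_normed_vector \<Rightarrow> complex"
  assumes "f differentiable at x" "g differentiable at x"
  shows "((\<lambda>x. a * f x + b * g x) has_derivative
    (\<lambda>h. a * frechet_derivative f (at x) h + b * frechet_derivative g (at x) h)) (at x)"
  using assms by (auto intro!: derivative_eq_intros simp: frechet_derivative_works)

lemma pds_lincomb:
  fixes f g :: "'a::euclidean_space \<Rightarrow> complex"
  assumes "Ck k f" "Ck k g" "set bs \<subseteq> Basis" "length bs \<le> k"
  shows "pds bs (\<lambda>x. a * f x + b * g x) = (\<lambda>x. a * pds bs f x + b * pds bs g x)"
  using assms(3,4)
proof (induction bs)
  case (Cons c bs)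
  have "(pds bs f) differentiable at x" "(pds bs g) differentiable at x" for x
    using Cons.prems assms(1,2) by (auto intro: Ck_differentiable)
  note frechet_derivative_at[OF has_derivative_lincomb[OF this], symmetric]
  then show ?case
    using Cons by simp
qed simp

lemma Ck_lincomb:
  fixes f g :: "'a::euclidean_space \<Rightarrow> complex"
  assumes "Ck k f" "Ck k g"
  shows "Ck k (\<lambda>x. a * f x + b * g x)"
  unfolding Ck_def
proof (intro conjI allI ballI impI, elim conjE)
  fix bs :: "'a list" and x assume bs: "set bs \<subseteq> Basis" "length bs < k"
  then have "(pds bs f) differentiable at x" "(pds bs g) differentiable at x"
    using assms by (auto intro: Ck_differentiable)
  from has_derivative_lincomb[OF this]
  show "pds bs (\<lambda>x. a * f x + b * g x) differentiable at x"
    using assms bs by (auto simp: pds_lincomb differentiable_def)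
next
  fix bs :: "'a list" assume "bs \<in> multi_idx k"
  then show "continuous_on UNIV (pds bs (\<lambda>x. a * f x + b * g x))"
    using assms Ck_continuous[OF assms(1)] Ck_continuous[OF assms(2)]
    by (subst pds_lincomb[of k]) (auto simp: multi_idx_def intro!: continuous_intros)
qed

lemma Xi_lincomb:
  assumes "f \<in> Xi k" "g \<in> Xi k"
  shows "(\<lambda>x. a * f x + b * g x) \<in> Xi k"
proof -
  have "Ck k f" "Ck k g"
    using assms by (auto simp: Xi_def C0k_def)
  moreover have "(pds bs (\<lambda>x. a * f x + b * g x) \<longlongrightarrow> 0) at_infinity" if "bs \<in> multi_idx k" for bs
  proof -
    have "(pds bs f \<longlongrightarrow> 0) at_infinity" "(pds bs g \<longlongrightarrow> 0) at_infinity"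
      using assms that by (auto simp: Xi_def C0k_def)
    then have "((\<lambda>x. a * pds bs f x + b * pds bs g x) \<longlongrightarrow> a * 0 + b * 0) at_infinity"
      by (intro tendsto_intros)
    then show ?thesis
      using that \<open>Ck k f\<close> \<open>Ck k g\<close> by (subst pds_lincomb[of k]) (auto simp: multi_idx_def)
  qed
  ultimately show ?thesis
    using assms by (auto simp: Xi_def C0k_def Ck_lincomb)
qed

lemma Xi_diff:
  assumes "f \<in> Xi k" "g \<in> Xi k"
  shows "(\<lambda>x. f x - g x) \<in> Xi k"
  using Xi_lincomb[OF assms, of 1 "-1"] by simp

lemma pds_diff:
  fixes f g :: "'a::euclidean_space \<Rightarrow> complex"
  assumes "Ck k f" "Ck k g" "bs \<in> multi_idx k"
  shows "pds bs (\<lambda>x. f x - g x) x = pds bs f x - pds bs g x"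
  using pds_lincomb[OF assms(1,2), of bs 1 "-1"] assms(3) by (simp add: multi_idx_def)

lemma xi_norm_le:
  assumes "\<And>bs x. bs \<in> multi_idx k \<Longrightarrow> norm (pds bs f x) \<le> A"
  shows "xi_norm k f \<le> A + (\<integral>x. norm (f x) \<partial>lborel)"
proof -
  have "multi_idx k \<noteq> {}"
    using Nil_in_multi_idx by blast
  then show ?thesis
    unfolding xi_norm_def using assms by (intro add_right_mono cSUP_least) auto
qed

text \<open>The L1 term stays on the left so that \<open>xi_norm k f\<close> minus it bounds every
  derivative. In this form later estimates treat the supremum part and the L1 part separately and
  add them up again, without touching the nested suprema.\<close>

lemma xi_norm_ge:
  assumes "f \<in> Xi k" "bs \<in> multi_idx k"
  shows "norm (pds bs f x) + (\<integral>x. norm (f x) \<partial>lborel) \<le> xi_norm k f"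
proof -
  have "C0k k f"
    using assms(1) by (simp add: Xi_def)
  then obtain B where "\<And>x. norm (pds bs f x) \<le> B"
    using C0k_pds_bounded assms(2) by metis
  then have "norm (pds bs f x) \<le> (SUP x. norm (pds bs f x))"
    by (intro cSUP_upper) (auto simp: bdd_above_def)
  also have "\<dots> \<le> (SUP bs\<in>multi_idx k. SUP x. norm (pds bs f x))"
    using assms(2) by (intro cSUP_upper) (auto intro!: bdd_above_finite)
  finally show ?thesis
    by (simp add: xi_norm_def)
qed

lemma xi_norm_nonneg:
  assumes "f \<in> Xi k"
  shows "0 \<le> xi_norm k f"
  using xi_norm_ge[OF assms Nil_in_multi_idx, of 0] Bochner_Integration.integral_nonneg[of lborel "\<lambda>x. norm (f x)"]
  by (smt (verit) norm_ge_zero)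

lemma xi_norm_lincomb:
  assumes f: "f \<in> Xi k" and g: "g \<in> Xi k"
  shows "xi_norm k (\<lambda>x. a * f x + b * g x) \<le> norm a * xi_norm k f + norm b * xi_norm k g"
proof -
  let ?If = "\<integral>x. norm (f x) \<partial>lborel" and ?Ig = "\<integral>x. norm (g x) \<partial>lborel"
  have [simp]: "integrable lborel f" "integrable lborel g"
    using f g by (auto simp: Xi_def)
  have C: "Ck k f" "Ck k g"
    using f g by (auto simp: Xi_def C0k_def)
  have "xi_norm k (\<lambda>x. a * f x + b * g x) \<le>
     (norm a * (xi_norm k f - ?If) + norm b * (xi_norm k g - ?Ig)) + (\<integral>x. norm (a * f x + b * g x) \<partial>lborel)"
  proof (rule xi_norm_le)
    fix bs :: "'a list" and x assume bs: "bs \<in> multi_idx k"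
    have "norm (a * pds bs f x + b * pds bs g x) \<le> norm a * norm (pds bs f x) + norm b * norm (pds bs g x)"
      by (metis norm_mult norm_triangle_ineq)
    also have "\<dots> \<le> norm a * (xi_norm k f - ?If) + norm b * (xi_norm k g - ?Ig)"
      using xi_norm_ge[OF f bs, of x] xi_norm_ge[OF g bs, of x]
      by (intro add_mono mult_left_mono) auto
    finally show "norm (pds bs (\<lambda>x. a * f x + b * g x) x) \<le> \<dots>"
      using bs C by (simp add: pds_lincomb[of k] multi_idx_def)
  qed
  also have "(\<integral>x. norm (a * f x + b * g x) \<partial>lborel) \<le> (\<integral>x. norm a * norm (f x) + norm b * norm (g x) \<partial>lborel)"
    by (intro integral_mono) (auto simp flip: norm_mult intro: norm_triangle_ineq)
  also have "\<dots> = norm a * ?If + norm b * ?Ig"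
    by simp
  finally show ?thesis
    by (simp add: algebra_simps)
qed

section \<open>Schwartz functions form a vector space\<close>

lemma schwartz_bound:
  assumes "schwartz f" "set bs \<subseteq> Basis"
  obtains B where "B > 0" "\<And>x. (1 + norm x) ^ N * norm (pds bs f x) \<le> B"
proof -
  have "bounded (range (\<lambda>x. (1 + norm x) ^ N *\<^sub>R pds bs f x))"
    using assms by (auto simp: schwartz_def)
  then obtain B where "B > 0" "\<And>x. norm ((1 + norm x) ^ N *\<^sub>R pds bs f x) \<le> B"
    unfolding bounded_pos by blast
  then show thesis
    by (intro that[of B]) (auto simp: abs_of_nonneg)
qed

lemma schwartz_lincomb:
  assumes "schwartz f" "schwartz g"
  shows "schwartz (\<lambda>x. a * f x + b * g x)"
proof -
  have C: "Ck k f" "Ck k g" for k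
    using assms by (auto simp: schwartz_def)
  have "bounded (range (\<lambda>x. (1 + norm x) ^ N *\<^sub>R pds bs (\<lambda>x. a * f x + b * g x) x))"
    if bs: "set bs \<subseteq> Basis" for bs N
  proof -
    obtain A where A: "\<And>x. (1 + norm x) ^ N * norm (pds bs f x) \<le> A"
      using schwartz_bound[OF assms(1) bs, of N] by metis
    obtain B where B: "\<And>x. (1 + norm x) ^ N * norm (pds bs g x) \<le> B"
      using schwartz_bound[OF assms(2) bs, of N] by metis
    have "norm ((1 + norm x) ^ N *\<^sub>R (a * pds bs f x + b * pds bs g x)) \<le> norm a * A + norm b * B" for x
    proof -
      have "norm ((1 + norm x) ^ N *\<^sub>R (a * pds bs f x + b * pds bs g x)) \<le>
        (1 + norm x) ^ N * (norm a * norm (pds bs f x) + norm b * norm (pds bs g x))"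
        by (auto simp: abs_of_nonneg simp flip: norm_mult intro!: mult_left_mono norm_triangle_ineq)
      also have "\<dots> = norm a * ((1 + norm x) ^ N * norm (pds bs f x)) + norm b * ((1 + norm x) ^ N * norm (pds bs g x))"
        by (simp add: algebra_simps)
      also have "\<dots> \<le> norm a * A + norm b * B"
        using A B by (intro add_mono mult_left_mono) auto
      finally show ?thesis .
    qed
    then have "bounded (range (\<lambda>x. (1 + norm x) ^ N *\<^sub>R (a * pds bs f x + b * pds bs g x)))"
      unfolding bounded_iff by blast
    then show ?thesis
      using pds_lincomb[OF C, of bs "length bs" a b] bs by simp
  qed
  then show ?thesis
    unfolding schwartz_def using C Ck_lincomb by blast
qed

text \<open>\<open>Xi k\<close> is a set of functions rather than a normed type, so extension by
  density is carried out for an abstract set \<open>E\<close> with a seminorm-like \<open>p\<close>.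
  The value at \<open>f\<close> is the limit along one chosen approximating sequence. The choices
  for different \<open>f\<close> are unrelated, so linearity and agreement with \<open>T\<close>
  come not from the sequences but from a characterisation of the limit by approximants of arbitrary
  precision.\<close>

lemma bounded_linear_extension:
  fixes E D :: "('a \<Rightarrow> complex) set" and p :: "('a \<Rightarrow> complex) \<Rightarrow> real" and T :: "('a \<Rightarrow> complex) \<Rightarrow> complex"
  assumes E: "\<And>f g a b. f \<in> E \<Longrightarrow> g \<in> E \<Longrightarrow> (\<lambda>x. a * f x + b * g x) \<in> E"
    and p: "\<And>f g a b. f \<in> E \<Longrightarrow> g \<in> E \<Longrightarrow> p (\<lambda>x. a * f x + b * g x) \<le> norm a * p f + norm b * p g"
    and p0: "\<And>f. f \<in> E \<Longrightarrow> 0 \<le> p f"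
    and DE: "D \<subseteq> E"
    and D: "\<And>f g a b. f \<in> D \<Longrightarrow> g \<in> D \<Longrightarrow> (\<lambda>x. a * f x + b * g x) \<in> D"
    and dense: "\<And>f e. f \<in> E \<Longrightarrow> e > 0 \<Longrightarrow> \<exists>h\<in>D. p (\<lambda>x. h x - f x) < e"
    and T: "\<And>f g a b. f \<in> D \<Longrightarrow> g \<in> D \<Longrightarrow> T (\<lambda>x. a * f x + b * g x) = a * T f + b * T g"
    and bound: "\<And>f. f \<in> D \<Longrightarrow> norm (T f) \<le> C * p f" and "C \<ge> 0"
  shows "\<exists>L. (\<forall>f\<in>E. \<forall>g\<in>E. \<forall>a b. L (\<lambda>x. a * f x + b * g x) = a * L f + b * L g) \<and>
    (\<forall>f\<in>E. norm (L f) \<le> C * p f) \<and> (\<forall>f\<in>D. L f = T f)"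
proof -
  \<comment> \<open>Both differences are taken to the same \<open>g\<close>, in the orientation of
    \<open>dense\<close>; the coefficient -1 does the work of symmetry.\<close>
  have p_sub: "p (\<lambda>x. f x - h x) \<le> p (\<lambda>x. f x - g x) + p (\<lambda>x. h x - g x)"
    if "f \<in> E" "g \<in> E" "h \<in> E" for f g h
    using p[OF E[OF that(1,2), of 1 "-1"] E[OF that(3,2), of 1 "-1"], of 1 "-1"] by (simp add: algebra_simps)
  have lip: "norm (T f - T g) \<le> C * p (\<lambda>x. f x - g x)" if "f \<in> D" "g \<in> D" for f g
    using bound[OF D[OF that, of 1 "-1"]] T[OF that, of 1 "-1"] by simp
  have "\<forall>f\<in>E. \<exists>S. \<forall>n. S n \<in> D \<and> p (\<lambda>x. S n x - f x) < 1 / Suc n"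
    using dense by (intro ballI choice allI) (metis zero_less_divide_1_iff of_nat_0_less_iff zero_less_Suc)
  then obtain S where S: "\<And>f n. f \<in> E \<Longrightarrow> S f n \<in> D" "\<And>f n. f \<in> E \<Longrightarrow> p (\<lambda>x. S f n x - f x) < 1 / Suc n"
    by metis
  define L where "L f = lim (\<lambda>n. T (S f n))" for f
  have conv: "(\<lambda>n. T (S f n)) \<longlonglongrightarrow> L f" if f: "f \<in> E" for f
  proof -
    have "Cauchy (\<lambda>n. T (S f n))"
    proof (rule metric_CauchyI)
      fix e :: real assume "e > 0"
      \<comment> \<open>Two approximants with indices from \<open>N\<close> on differ in
        \<open>p\<close> by at most \<open>2 / Suc N\<close>; as \<open>2 * C / e \<le> N\<close>,
        the factor \<open>C\<close> brings this strictly below \<open>e\<close>.\<close>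
      define N where "N = nat \<lceil>2 * C / e\<rceil>"
      have N: "2 * C / e \<le> N"
        by (simp add: N_def real_nat_ceiling_ge)
      have "dist (T (S f m)) (T (S f n)) < e" if "m \<ge> N" "n \<ge> N" for m n
      proof -
        have "dist (T (S f m)) (T (S f n)) \<le> C * p (\<lambda>x. S f m x - S f n x)"
          using lip S(1)[OF f] by (simp add: dist_norm)
        also have "\<dots> \<le> C * (1 / Suc m + 1 / Suc n)"
        proof (intro mult_left_mono)
          have "S f m \<in> E" "S f n \<in> E"
            using S(1)[OF f] DE by auto
          then show "p (\<lambda>x. S f m x - S f n x) \<le> 1 / Suc m + 1 / Suc n"
            using p_sub[of "S f m" f "S f n"] S(2)[OF f, of m] S(2)[OF f, of n] f by linarith
        qed fact
        also have "\<dots> \<le> C * (1 / Suc N + 1 / Suc N)"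
          using that \<open>C \<ge> 0\<close> by (intro mult_left_mono add_mono divide_left_mono) auto
        also have "\<dots> < e"
          using N \<open>e > 0\<close> by (simp add: field_simps)
        finally show ?thesis .
      qed
      then show "\<exists>N. \<forall>m\<ge>N. \<forall>n\<ge>N. dist (T (S f m)) (T (S f n)) < e"
        by blast
    qed
    then show ?thesis
      by (simp add: L_def Cauchy_convergent_iff convergent_LIMSEQ_iff)
  qed
  \<comment> \<open>Passing to the limit in \<open>n\<close> compares \<open>L f\<close> with
    \<open>T h\<close> for every \<open>h\<close> in \<open>D\<close>, not only for members of the
    chosen sequence.\<close>
  have near: "norm (T h - L f) \<le> C * p (\<lambda>x. h x - f x)" if "f \<in> E" "h \<in> D" for f h
  proof (rule LIMSEQ_le)
    show "(\<lambda>n. norm (T h - T (S f n))) \<longlonglongrightarrow> norm (T h - L f)"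
      by (intro tendsto_intros conv that)
    have "(\<lambda>n. C * (p (\<lambda>x. h x - f x) + inverse (real (Suc n)))) \<longlonglongrightarrow> C * (p (\<lambda>x. h x - f x) + 0)"
      by (intro tendsto_intros LIMSEQ_inverse_real_of_nat)
    then show "(\<lambda>n. C * (p (\<lambda>x. h x - f x) + 1 / (real (Suc n)))) \<longlonglongrightarrow> C * p (\<lambda>x. h x - f x)"
      by (simp add: inverse_eq_divide)
    have "norm (T h - T (S f n)) \<le> C * (p (\<lambda>x. h x - f x) + 1 / (real (Suc n)))" for n
    proof -
      have "norm (T h - T (S f n)) \<le> C * p (\<lambda>x. h x - S f n x)"
        using lip that S(1) by blast
      also have "\<dots> \<le> C * (p (\<lambda>x. h x - f x) + 1 / (real (Suc n)))"
      proof (intro mult_left_mono)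
        have "h \<in> E" "S f n \<in> E"
          using S(1)[OF that(1)] that DE by auto
        then show "p (\<lambda>x. h x - S f n x) \<le> p (\<lambda>x. h x - f x) + 1 / Suc n"
          using p_sub[of h f "S f n"] S(2)[OF that(1), of n] that by linarith
      qed fact
      finally show ?thesis .
    qed
    then show "\<exists>N. \<forall>n\<ge>N. norm (T h - T (S f n)) \<le> C * (p (\<lambda>x. h x - f x) + 1 / (real (Suc n)))"
      by blast
  qed
  have near_le: "norm (T h - L f) \<le> C * e" if "f \<in> E" "h \<in> D" "p (\<lambda>x. h x - f x) < e" for f h e
    using near[OF that(1,2)] mult_left_mono[of "p (\<lambda>x. h x - f x)" e C] that(3) \<open>C \<ge> 0\<close> by linarith
  \<comment> \<open>A number is \<open>L f\<close> as soon as approximants of every precision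
    \<open>e\<close> have values of \<open>T\<close> within a fixed multiple of \<open>e\<close> of
    it; the chosen sequence no longer enters.\<close>
  have uniq: "z = L f" if f: "f \<in> E" and z: "\<And>e. e > 0 \<Longrightarrow> \<exists>h\<in>D. p (\<lambda>x. h x - f x) < e \<and> norm (T h - z) \<le> K * e" 
    and "K \<ge> 0" for f z K
  proof (rule ccontr)
    assume "z \<noteq> L f"
    \<comment> \<open>Makes \<open>(C + K + 1) * e\<close> half of \<open>norm (z - L f)\<close>;
      the summand 1 keeps the denominator positive when \<open>C = K = 0\<close>.\<close>
    define e where "e = norm (z - L f) / (2 * (C + K + 1))"
    have "e > 0"
      using \<open>z \<noteq> L f\<close> \<open>C \<ge> 0\<close> \<open>K \<ge> 0\<close> by (simp add: e_def)
    then obtain h where h: "h \<in> D" "p (\<lambda>x. h x - f x) < e" "norm (T h - z) \<le> K * e"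
      using z by blast
    have "norm (z - L f) \<le> norm (T h - z) + norm (T h - L f)"
      by (metis norm_minus_commute norm_diff_triangle_le order_refl)
    also have "\<dots> \<le> K * e + C * e"
      using h(3) near_le[OF f h(1,2)] by linarith
    also have "\<dots> < (C + K + 1) * e"
      using \<open>e > 0\<close> by (simp add: algebra_simps)
    also have "\<dots> = norm (z - L f) / 2"
      using \<open>C \<ge> 0\<close> \<open>K \<ge> 0\<close> by (simp add: e_def field_simps)
    finally show False
      using norm_ge_zero[of "z - L f"] by linarith
  qed
  show ?thesis
  proof (intro exI[of _ L] conjI ballI allI)
    show "L f = T f" if "f \<in> D" for f
    proof (rule sym, rule uniq[of _ _ 0])
      show "f \<in> E"
        using that DE by blast
      fix e :: real assume "e > 0"
      \<comment> \<open>The estimate for \<open>p\<close> with both coefficients 0 gives its value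
        at the zero function.\<close>
      have "p (\<lambda>x. f x - f x) \<le> 0"
        using p[OF \<open>f \<in> E\<close> \<open>f \<in> E\<close>, of 0 0] by simp
      then show "\<exists>h\<in>D. p (\<lambda>x. h x - f x) < e \<and> norm (T h - T f) \<le> 0 * e"
        using that \<open>e > 0\<close> by (intro bexI[of _ f]) auto
    qed simp
  next
    show "norm (L f) \<le> C * p f" if f: "f \<in> E" for f
    proof (rule LIMSEQ_le)
      show "(\<lambda>n. norm (T (S f n))) \<longlonglongrightarrow> norm (L f)"
        by (intro tendsto_intros conv f)
      have "(\<lambda>n. C * (p f + inverse (real (Suc n)))) \<longlonglongrightarrow> C * (p f + 0)"
        by (intro tendsto_intros LIMSEQ_inverse_real_of_nat)
      then show "(\<lambda>n. C * (p f + 1 / (real (Suc n)))) \<longlonglongrightarrow> C * p f"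
        by (simp add: inverse_eq_divide)
      have "norm (T (S f n)) \<le> C * (p f + 1 / (real (Suc n)))" for n
      proof -
        have "S f n \<in> E" 
          using S(1)[OF f] DE by blast
        have "norm (T (S f n)) \<le> C * p (S f n)"
          using bound S(1)[OF f] by blast
        also have "\<dots> \<le> C * (p f + 1 / (real (Suc n)))"
          using p[OF E[OF \<open>S f n \<in> E\<close> f, of 1 "-1"] f, of 1 1] S(2)[OF f, of n] \<open>C \<ge> 0\<close>
          by (intro mult_left_mono) auto
        finally show ?thesis .
      qed
      then show "\<exists>N. \<forall>n\<ge>N. norm (T (S f n)) \<le> C * (p f + 1 / (real (Suc n)))"
        by blast
    qed
  next
    show "L (\<lambda>x. a * f x + b * g x) = a * L f + b * L g" if f: "f \<in> E" and g: "g \<in> E" for f g a b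
    proof (rule sym, rule uniq[OF E[OF f g]])
      show "C \<ge> 0"
        by fact
      fix e :: real assume "e > 0"
      \<comment> \<open>Chosen for \<open>norm a * d + norm b * d < e\<close>; the summand 1 covers
        \<open>a = b = 0\<close>.\<close>
      define d where "d = e / (norm a + norm b + 1)"
      have ab: "norm a + norm b + 1 > 0"
        by (smt (verit) norm_ge_zero)
      then have "d > 0"
        using \<open>e > 0\<close> by (simp add: d_def)
      obtain h where h: "h \<in> D" "p (\<lambda>x. h x - f x) < d"
        using dense f \<open>d > 0\<close> by blast
      obtain k where k: "k \<in> D" "p (\<lambda>x. k x - g x) < d"
        using dense g \<open>d > 0\<close> by blast
      have hk: "h \<in> E" "k \<in> E"
        using h k DE by auto
      have de: "norm a * d + norm b * d < e"
      proof -
        have "(norm a + norm b + 1) * d = e"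
          using ab by (simp add: d_def)
        then show ?thesis
          using \<open>d > 0\<close> by (simp add: algebra_simps)
      qed
      show "\<exists>h\<in>D. p (\<lambda>x. h x - (a * f x + b * g x)) < e \<and> norm (T h - (a * L f + b * L g)) \<le> C * e"
      proof (intro bexI[of _ "\<lambda>x. a * h x + b * k x"] conjI D h k)
        have "p (\<lambda>x. a * (h x - f x) + b * (k x - g x)) \<le> norm a * p (\<lambda>x. h x - f x) + norm b * p (\<lambda>x. k x - g x)"
          using p[OF E[OF hk(1) f, of 1 "-1"] E[OF hk(2) g, of 1 "-1"], of a b] by simp
        also have "\<dots> \<le> norm a * d + norm b * d"
          using h k by (intro add_mono mult_left_mono) auto
        finally show "p (\<lambda>x. a * h x + b * k x - (a * f x + b * g x)) < e"
          using de by (simp add: algebra_simps)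
        have "T (\<lambda>x. a * h x + b * k x) - (a * L f + b * L g) = a * (T h - L f) + b * (T k - L g)"
          using T[OF h(1) k(1)] by (simp add: algebra_simps)
        also have "norm \<dots> \<le> norm a * (C * d) + norm b * (C * d)"
          using near_le[OF f h] near_le[OF g k]
          by (intro norm_triangle_le add_mono) (simp_all only: norm_mult mult_left_mono norm_ge_zero)
        also have "\<dots> = C * (norm a * d + norm b * d)"
          by (simp add: algebra_simps)
        also have "\<dots> \<le> C * e"
          using de \<open>C \<ge> 0\<close> by (intro mult_left_mono) auto
        finally show "norm (T (\<lambda>x. a * h x + b * k x) - (a * L f + b * L g)) \<le> C * e" .
      qed
    qed
  qed
qed

section \<open>Weighted convolutions\<close>

text \<open>One operator serves all convolutions here: a truncated function with a Gaussian in
  either role, over Lebesgue measure, and \<open>fV\<close> with a finite measure, where the weight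
  is 1. The weight only has to be integrable; all regularity is asked of \<open>F\<close>.\<close>

definition wconv :: "'a::euclidean_space measure \<Rightarrow> ('a \<Rightarrow> complex) \<Rightarrow> ('a \<Rightarrow> complex) \<Rightarrow> 'a \<Rightarrow> complex" where
  "wconv N w F x = (\<integral>z. w z * F (x - z) \<partial>N)"

lemma frechet_derivative_eq_sum_Basis:
  fixes F :: "'a::euclidean_space \<Rightarrow> 'b::real_normed_vector"
  assumes "F differentiable at x"
  shows "frechet_derivative F (at x) h = (\<Sum>b\<in>Basis. (h \<bullet> b) *\<^sub>R frechet_derivative F (at x) b)"
proof -
  have lin: "linear (frechet_derivative F (at x))"
    using assms by (rule linear_frechet_derivative)
  have "frechet_derivative F (at x) h = frechet_derivative F (at x) (\<Sum>b\<in>Basis. (h \<bullet> b) *\<^sub>R b)"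
    by (simp add: euclidean_representation)
  then show ?thesis
    by (simp only: linear_sum[OF lin] linear_scale[OF lin])
qed

text \<open>Only derivatives in basis directions are controlled by \<open>multi_idx\<close>.
  Expanding \<open>h\<close> in coordinates, each at most \<open>norm h\<close>, recovers the total
  derivative at the price of the factor \<open>DIM('a)\<close>.\<close>

lemma norm_frechet_derivative_le:
  fixes F :: "'a::euclidean_space \<Rightarrow> 'b::real_normed_vector" and B :: real
  assumes "F differentiable at x" and "\<And>b. b \<in> Basis \<Longrightarrow> norm (frechet_derivative F (at x) b) \<le> B"
  shows "norm (frechet_derivative F (at x) h) \<le> DIM('a) * B * norm h"
proof -
  have "frechet_derivative F (at x) h = (\<Sum>b\<in>Basis. (h \<bullet> b) *\<^sub>R frechet_derivative F (at x) b)"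
    using assms(1) by (rule frechet_derivative_eq_sum_Basis)
  also have "norm \<dots> \<le> (\<Sum>b\<in>(Basis :: 'a set). norm h * B)"
    using assms(2) by (intro sum_norm_le) (auto intro!: mult_mono Basis_le_norm)
  finally show ?thesis
    by (simp add: algebra_simps)
qed

context
  fixes N :: "'a::euclidean_space measure" and w :: "'a \<Rightarrow> complex"
  assumes sets_N [measurable_cong]: "sets N = sets borel" and w: "integrable N w"
begin

lemma wconv_integrable:
  assumes [measurable]: "F \<in> borel_measurable borel" and B: "\<And>x. norm (F x) \<le> B"
  shows "integrable N (\<lambda>z. w z * F (x - z))"
proof (rule Bochner_Integration.integrable_bound)
  show "integrable N (\<lambda>z. norm (w z) * B)"
    using w by simp
  have "norm (w z * F (x - z)) \<le> norm (norm (w z) * B)" for z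
    using B[of "x - z"] by (auto simp: norm_mult abs_mult intro!: mult_left_mono)
  then show "AE z in N. norm (w z * F (x - z)) \<le> norm (norm (w z) * B)"
    by simp
qed (use borel_measurable_integrable[OF w] in measurable)

lemma norm_wconv_le:
  assumes "F \<in> borel_measurable borel" and B: "\<And>x. norm (F x) \<le> B"
  shows "norm (wconv N w F x) \<le> (\<integral>z. norm (w z) \<partial>N) * B"
proof -
  have "norm (wconv N w F x) \<le> (\<integral>z. norm (w z * F (x - z)) \<partial>N)"
    unfolding wconv_def by (rule integral_norm_bound)
  also have "\<dots> \<le> (\<integral>z. norm (w z) * B \<partial>N)"
    using w B by (intro integral_mono integrable_norm wconv_integrable[OF assms])
      (auto simp: norm_mult intro!: mult_left_mono)
  finally show ?thesis
    by simp
qed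

text \<open>Dominated convergence with majorant \<open>norm (w z) * B\<close>. The sequence
  \<open>F n\<close> is arbitrary because it is used with translates of one function, for continuity
  and decay, and with normalised remainders, for differentiability.\<close>

lemma wconv_tendsto:
  assumes "\<And>n. F n \<in> borel_measurable borel" "G \<in> borel_measurable N"
    and B: "\<And>n x. norm (F n x) \<le> B" and "\<And>z. (\<lambda>n. F n z) \<longlonglongrightarrow> G z"
  shows "(\<lambda>n. \<integral>z. w z * F n z \<partial>N) \<longlonglongrightarrow> (\<integral>z. w z * G z \<partial>N)"
proof (rule integral_dominated_convergence[where w="\<lambda>z. norm (w z) * B"])
  have [measurable]: "w \<in> borel_measurable N" "\<And>n. F n \<in> borel_measurable N"
    using assms w by (auto simp: measurable_cong_sets[OF sets_N refl])
  show "(\<lambda>z. w z * G z) \<in> borel_measurable N" "\<And>n. (\<lambda>z. w z * F n z) \<in> borel_measurable N"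
    using assms(2) by measurable
  show "integrable N (\<lambda>z. norm (w z) * B)"
    using w by simp
  show "AE x in N. (\<lambda>n. w x * F n x) \<longlonglongrightarrow> w x * G x"
    by (intro AE_I2 tendsto_intros assms)
  show "AE x in N. norm (w x * F n x) \<le> norm (w x) * B" for n
    using B by (auto simp: norm_mult intro!: mult_left_mono)
qed

lemma continuous_wconv:
  assumes F: "continuous_on UNIV F" and B: "\<And>x. norm (F x) \<le> B"
  shows "continuous_on UNIV (wconv N w F)"
proof (rule continuous_at_imp_continuous_on, intro ballI)
  fix x
  have [measurable]: "F \<in> borel_measurable borel"
    using F by (rule borel_measurable_continuous_onI)
  have "((\<lambda>n. wconv N w F (u n)) \<longlonglongrightarrow> wconv N w F x)" if u: "u \<longlonglongrightarrow> x" for u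
    unfolding wconv_def
  proof (rule wconv_tendsto)
    show "(\<lambda>n. F (u n - z)) \<longlonglongrightarrow> F (x - z)" for z
      by (rule continuous_on_tendsto_compose[OF F]) (auto intro!: tendsto_intros u)
  qed (use B in \<open>auto simp: measurable_cong_sets[OF sets_N refl]\<close>)
  then show "isCont (wconv N w F) x"
    by (auto simp: continuous_at_sequentially comp_def)
qed

text \<open>For fixed \<open>z\<close> the argument \<open>x - z\<close> escapes to infinity with
  \<open>x\<close>. A sequence violating the limit is extracted because dominated convergence speaks
  about sequences.\<close>

lemma wconv_vanishes:
  assumes F: "continuous_on UNIV F" and F0: "(F \<longlongrightarrow> 0) at_infinity"
  shows "(wconv N w F \<longlongrightarrow> 0) at_infinity"
proof (rule ccontr)
  have [measurable]: "F \<in> borel_measurable borel"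
    using F by (rule borel_measurable_continuous_onI)
  obtain B where B: "\<And>x. norm (F x) \<le> B"
    using C0_bounded[OF F F0] by (auto simp: bounded_iff)
  assume "\<not> ?thesis"
  then obtain e where e: "e > 0" "\<not> eventually (\<lambda>x. norm (wconv N w F x) < e) at_infinity"
    by (auto simp: tendsto_iff)
  then have "\<exists>x. norm x \<ge> real n \<and> norm (wconv N w F x) \<ge> e" for n
    unfolding eventually_at_infinity by (meson not_le)
  then obtain u where u: "\<And>n. norm (u n) \<ge> real n" "\<And>n. norm (wconv N w F (u n)) \<ge> e"
    by metis
  have "filterlim u at_infinity sequentially"
    using filterlim_real_sequentially u(1)
    by (intro filterlim_norm_at_top_imp_at_infinity) (auto intro: filterlim_at_top_mono)
  have "(\<lambda>n. wconv N w F (u n)) \<longlonglongrightarrow> (\<integral>z. w z * 0 \<partial>N)"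
    unfolding wconv_def
  proof (rule wconv_tendsto)
    fix z
    have "filterlim (\<lambda>n. - z + u n) at_infinity sequentially"
      by (intro tendsto_add_filterlim_at_infinity[OF tendsto_const]) fact
    then show "(\<lambda>n. F (u n - z)) \<longlonglongrightarrow> 0"
      using filterlim_compose[OF F0] by simp
  qed (use B in \<open>auto simp: measurable_cong_sets[OF sets_N refl]\<close>)
  then have "(\<lambda>n. norm (wconv N w F (u n))) \<longlonglongrightarrow> 0"
    by (simp add: tendsto_norm_zero)
  then have "e \<le> 0"
    using u(2) by (intro LIMSEQ_le_const) auto
  then show False
    using e by simp
qed

text \<open>Along any sequence \<open>u n\<close> tending to \<open>x\<close>, the Frechet remainder
  of \<open>F\<close> divided by \<open>norm (u n - x)\<close> tends to 0 for each \<open>z\<close>.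
  It is bounded by \<open>2 * K\<close>: one \<open>K\<close> from the Lipschitz bound for
  \<open>F\<close>, one from its derivative. The derivative is written as a sum over
  \<open>Basis\<close> since the assumptions concern partial derivatives.\<close>

lemma has_derivative_wconv:
  assumes F: "\<And>x. F differentiable at x"
    and FB: "\<And>x. norm (F x) \<le> B0"
    and cont: "\<And>b. b \<in> Basis \<Longrightarrow> continuous_on UNIV (\<lambda>x. frechet_derivative F (at x) b)"
    and B: "\<And>x b. b \<in> Basis \<Longrightarrow> norm (frechet_derivative F (at x) b) \<le> B"
  shows "(wconv N w F has_derivative
    (\<lambda>h. \<Sum>b\<in>Basis. (h \<bullet> b) *\<^sub>R wconv N w (\<lambda>x. frechet_derivative F (at x) b) x)) (at x)"
    (is "(_ has_derivative ?D) _")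
proof -
  define F' where "F' x = frechet_derivative F (at x)" for x
  define K where "K = DIM('a) * B"
  have F': "(F has_derivative F' x) (at x)" for x
    using F by (simp add: F'_def frechet_derivative_works)
  have F'K: "norm (F' x h) \<le> K * norm h" for x h
    unfolding F'_def K_def by (rule norm_frechet_derivative_le[OF F B])
  have lip: "norm (F u - F v) \<le> K * norm (u - v)" for u v
  proof (rule differentiable_bound[where f'=F' and S=UNIV])
    show "onorm (F' x) \<le> K" for x
      by (intro onorm_le F'K)
  qed (use F' in \<open>auto intro: has_derivative_at_withinI\<close>)
  have contF: "continuous_on UNIV F"
    using F by (simp add: continuous_on_eq_continuous_at differentiable_imp_continuous_within)
  have [measurable]: "F \<in> borel_measurable borel"
    using contF by (rule borel_measurable_continuous_onI)
  have meas_b [measurable]: "(\<lambda>x. F' x b) \<in> borel_measurable borel" if "b \<in> Basis" for b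
    unfolding F'_def using cont[OF that] by (rule borel_measurable_continuous_onI)
  have F'_sum: "F' u h = (\<Sum>b\<in>Basis. (h \<bullet> b) *\<^sub>R F' u b)" for u h
    unfolding F'_def using F by (rule frechet_derivative_eq_sum_Basis)
  have F'_meas [measurable]: "(\<lambda>u. F' u h) \<in> borel_measurable borel" for h
    by (subst F'_sum) (intro borel_measurable_sum borel_measurable_scaleR meas_b; simp)
  have D: "?D h = (\<integral>z. w z * F' (x - z) h \<partial>N)" for h
  proof -
    have int: "integrable N (\<lambda>z. w z * F' (x - z) b)" if "b \<in> Basis" for b
      using that B by (intro wconv_integrable) (auto simp: F'_def[symmetric])
    have "(\<integral>z. w z * F' (x - z) h \<partial>N) = (\<integral>z. (\<Sum>b\<in>Basis. (h \<bullet> b) *\<^sub>R (w z * F' (x - z) b)) \<partial>N)"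
      by (subst F'_sum) (simp add: sum_distrib_left)
    also have "\<dots> = (\<Sum>b\<in>Basis. (h \<bullet> b) *\<^sub>R (\<integral>z. w z * F' (x - z) b \<partial>N))"
      using int by (subst Bochner_Integration.integral_sum) auto
    finally show ?thesis
      by (simp add: wconv_def F'_def)
  qed
  have "(\<lambda>n. (wconv N w F (u n) - wconv N w F x - ?D (u n - x)) /\<^sub>R norm (u n - x)) \<longlonglongrightarrow> 0"
    if u: "u \<longlonglongrightarrow> x" "\<And>n. u n \<noteq> x" for u
  proof -
    define R where "R n z = (F (u n - z) - F (x - z) - F' (x - z) (u n - x)) /\<^sub>R norm (u n - x)" for n z
    have R_meas [measurable]: "R n \<in> borel_measurable borel" for n
      unfolding R_def by measurable
    have "(\<lambda>n. \<integral>z. w z * R n z \<partial>N) \<longlonglongrightarrow> (\<integral>z. w z * 0 \<partial>N)"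
    proof (rule wconv_tendsto[where B="2 * K"])
      fix n z
      have "norm (F (u n - z) - F (x - z) - F' (x - z) (u n - x)) \<le> K * norm (u n - x) + K * norm (u n - x)"
        using lip[of "u n - z" "x - z"] F'K[of "x - z" "u n - x"]
        by (intro order_trans[OF norm_triangle_ineq4[of "F (u n - z) - F (x - z)"]] add_mono) auto
      moreover have "norm (R n z) = norm (F (u n - z) - F (x - z) - F' (x - z) (u n - x)) / norm (u n - x)"
        by (simp add: R_def divide_inverse mult.commute)
      ultimately show "norm (R n z) \<le> 2 * K"
        using u(2)[of n] by (simp add: pos_divide_le_eq)
    next
      fix z
      have "((\<lambda>y. (F y - F (x - z) - F' (x - z) (y - (x - z))) /\<^sub>R norm (y - (x - z))) \<longlongrightarrow> 0) (at (x - z))"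
        using F'[of "x - z"] by (simp add: has_derivative_def netlimit_at)
      moreover have "filterlim (\<lambda>n. u n - z) (at (x - z)) sequentially"
        using u by (auto simp: filterlim_at intro!: tendsto_intros always_eventually)
      ultimately show "(\<lambda>n. R n z) \<longlonglongrightarrow> 0"
        unfolding R_def by (auto dest: filterlim_compose)
    qed auto
    moreover have "(\<integral>z. w z * R n z \<partial>N) = (wconv N w F (u n) - wconv N w F x - ?D (u n - x)) /\<^sub>R norm (u n - x)" for n
    proof -
      have "integrable N (\<lambda>z. w z * F' (x - z) (u n - x))"
        using F'K by (intro wconv_integrable[where B="K * norm (u n - x)"]) auto
      moreover have "integrable N (\<lambda>z. w z * F (y - z))" for y
        using FB by (intro wconv_integrable) auto
      ultimately show ?thesis
        unfolding D by (simp add: R_def wconv_def algebra_simps flip: scaleR_diff_right)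
    qed
    ultimately show ?thesis
      by simp
  qed
  then have "((\<lambda>y. (wconv N w F y - wconv N w F x - ?D (y - x)) /\<^sub>R norm (y - x)) \<longlongrightarrow> 0) (at x)"
    by (auto simp: tendsto_at_iff_sequentially comp_def)
  moreover have "bounded_linear ?D"
    by (intro bounded_linear_sum bounded_linear_scaleR_const bounded_linear_inner_left)
  ultimately show ?thesis
    by (simp add: has_derivative_def netlimit_at)
qed

text \<open>Since \<open>pds\<close> adds derivatives at the head of the list, the induction applies
  \<open>has_derivative_wconv\<close> to \<open>pds bs F\<close>. At a basis vector, orthonormality
  leaves a single term of its sum over \<open>Basis\<close>.\<close>

lemma pds_wconv:
  assumes F: "Ck k F" and B: "\<And>bs x. bs \<in> multi_idx k \<Longrightarrow> norm (pds bs F x) \<le> B"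
    and "set bs \<subseteq> Basis" "length bs \<le> k"
  shows "pds bs (wconv N w F) = wconv N w (pds bs F)"
    "length bs < k \<Longrightarrow> wconv N w (pds bs F) differentiable at x"
proof -
  have der: "(wconv N w (pds bs F) has_derivative
    (\<lambda>h. \<Sum>b\<in>Basis. (h \<bullet> b) *\<^sub>R wconv N w (pds (b # bs) F) x)) (at x)"
    if "set bs \<subseteq> Basis" "length bs < k" for bs x
    unfolding pds.simps
  proof (rule has_derivative_wconv)
    show "pds bs F differentiable at x" for x
      using F that by (rule Ck_differentiable)
    show "norm (pds bs F x) \<le> B" for x
      using B that by (auto simp: multi_idx_def)
    fix b :: 'a assume "b \<in> Basis"
    then show "continuous_on UNIV (\<lambda>x. frechet_derivative (pds bs F) (at x) b)"
      "norm (frechet_derivative (pds bs F) (at x) b) \<le> B" for x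
      using Ck_continuous[OF F, of "b # bs"] B[of "b # bs" x] that by (auto simp: multi_idx_def)
  qed
  show "length bs < k \<Longrightarrow> wconv N w (pds bs F) differentiable at x"
    using der[OF assms(3)] by (auto simp: differentiable_def)
  show "pds bs (wconv N w F) = wconv N w (pds bs F)"
    using assms(3,4)
  proof (induction bs)
    case (Cons b bs)
    have "frechet_derivative (wconv N w (pds bs F)) (at x) b = wconv N w (pds (b # bs) F) x" for x
    proof -
      have "frechet_derivative (wconv N w (pds bs F)) (at x) b =
        (\<Sum>c\<in>Basis. (b \<bullet> c) *\<^sub>R wconv N w (pds (c # bs) F) x)"
        using Cons.prems by (subst frechet_derivative_at[OF der, symmetric]) auto
      also have "\<dots> = (\<Sum>c\<in>Basis. if c = b then wconv N w (pds (b # bs) F) x else 0)"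
        using Cons.prems by (intro sum.cong) (auto simp: inner_Basis)
      finally show ?thesis
        using Cons.prems by simp
    qed
    then show ?case
      using Cons by auto
  qed simp
qed

lemma Ck_wconv:
  assumes F: "Ck k F" and B: "\<And>bs x. bs \<in> multi_idx k \<Longrightarrow> norm (pds bs F x) \<le> B"
  shows "Ck k (wconv N w F)"
  unfolding Ck_def
proof (intro conjI allI impI ballI, elim conjE)
  fix bs :: "'a list" and x assume "set bs \<subseteq> Basis" "length bs < k"
  then show "pds bs (wconv N w F) differentiable at x"
    using pds_wconv(1)[OF F B, of bs] pds_wconv(2)[OF F B, of bs x] by simp
next
  fix bs :: "'a list" assume bs: "bs \<in> multi_idx k"
  have "continuous_on UNIV (wconv N w (pds bs F))"
    using Ck_continuous[OF F bs] B[OF bs] by (rule continuous_wconv)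
  then show "continuous_on UNIV (pds bs (wconv N w F))"
    using bs by (subst pds_wconv[OF F B]) (auto simp: multi_idx_def)
qed

end

lemma C0k_pds_uniformly_bounded:
  assumes "C0k k (f :: 'a::euclidean_space \<Rightarrow> 'b::real_normed_vector)"
  obtains B where "\<And>bs x. bs \<in> multi_idx k \<Longrightarrow> norm (pds bs f x) \<le> B"
proof -
  have "\<exists>B. \<forall>x. norm (pds bs f x) \<le> B" if "bs \<in> multi_idx k" for bs
    using C0k_pds_bounded[OF assms that] by metis
  then obtain B where B: "\<And>bs x. bs \<in> multi_idx k \<Longrightarrow> norm (pds bs f x) \<le> B bs"
    by metis
  have "norm (pds bs f x) \<le> Max (B ` multi_idx k)" if "bs \<in> multi_idx k" for bs x
    using B[OF that, of x] that by (auto intro: order_trans[OF _ Max_ge])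
  then show thesis
    by (rule that)
qed

lemma C0k_wconv:
  assumes N: "sets N = sets borel" "integrable N w" and F: "C0k k F"
  shows "C0k k (wconv N w F)"
    and "bs \<in> multi_idx k \<Longrightarrow> pds bs (wconv N w F) = wconv N w (pds bs F)"
proof -
  obtain B where B: "\<And>bs x. bs \<in> multi_idx k \<Longrightarrow> norm (pds bs F x) \<le> B"
    using C0k_pds_uniformly_bounded[OF F] by metis
  have C: "Ck k F"
    using F by (simp add: C0k_def)
  have pds: "pds bs (wconv N w F) = wconv N w (pds bs F)" if "bs \<in> multi_idx k" for bs
    using that by (intro pds_wconv(1)[OF N C B]) (auto simp: multi_idx_def)
  then show "bs \<in> multi_idx k \<Longrightarrow> pds bs (wconv N w F) = wconv N w (pds bs F)" .
  have "(wconv N w (pds bs F) \<longlongrightarrow> 0) at_infinity" if "bs \<in> multi_idx k" for bs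
    using F Ck_continuous[OF C that] that by (intro wconv_vanishes N) (auto simp: C0k_def)
  then show "C0k k (wconv N w F)"
    using pds Ck_wconv[OF N C B] by (simp add: C0k_def)
qed

section \<open>Translation invariance and Fubini for convolutions\<close>

lemma borel_measurable_cis [measurable]: "cis \<in> borel_measurable borel"
  by (intro borel_measurable_continuous_onI continuous_intros)

lemma integrable_cis_mult:
  fixes f :: "'a::euclidean_space \<Rightarrow> complex"
  assumes [measurable]: "c \<in> borel_measurable borel" and f: "integrable lborel f"
  shows "integrable lborel (\<lambda>x. cis (c x) * f x)"
proof (rule Bochner_Integration.integrable_bound[OF f])
  have [measurable]: "f \<in> borel_measurable borel"
    using borel_measurable_integrable[OF f] by simp
  show "(\<lambda>x. cis (c x) * f x) \<in> borel_measurable lborel"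
    by measurable
qed (simp add: norm_mult)

lemma distr_lborel_reflect: "distr lborel borel (\<lambda>x :: 'a::euclidean_space. t - x) = lborel"
  by (subst lborel_affine[of "-1" t]) (simp_all add: density_1)

lemma distr_lborel_shift: "distr lborel borel (\<lambda>x :: 'a::euclidean_space. x - t) = lborel"
  using lborel_distr_plus[of "- t"] by (simp add: add.commute cong: distr_cong)

lemma lborel_integral_reflect:
  fixes f :: "'a::euclidean_space \<Rightarrow> 'b::{banach, second_countable_topology}"
  assumes "f \<in> borel_measurable borel"
  shows "(\<integral>x. f (t - x) \<partial>lborel) = (\<integral>x. f x \<partial>lborel)"
  by (subst (2) distr_lborel_reflect[of t, symmetric]) (use assms in \<open>simp add: integral_distr\<close>)

lemma lborel_integral_shift:
  fixes f :: "'a::euclidean_space \<Rightarrow> 'b::{banach, second_countable_topology}"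
  assumes "f \<in> borel_measurable borel"
  shows "(\<integral>x. f (x - t) \<partial>lborel) = (\<integral>x. f x \<partial>lborel)"
  by (subst (2) distr_lborel_shift[of t, symmetric]) (use assms in \<open>simp add: integral_distr\<close>)

lemma lborel_integrable_shift:
  fixes f :: "'a::euclidean_space \<Rightarrow> 'b::{banach, second_countable_topology}"
  assumes "integrable lborel f"
  shows "integrable lborel (\<lambda>x. f (x - t))"
  using assms integrable_distr[of "\<lambda>x. x - t" lborel borel f] by (simp add: distr_lborel_shift)

text \<open>Exchanging the roles changes where the derivatives fall: with the Gaussian as second
  argument the convolution inherits its smoothness, with the Gaussian as weight the derivatives are
  mollified derivatives of \<open>f\<close>.\<close>

lemma wconv_commute:
  assumes [measurable]: "f \<in> borel_measurable borel" "g \<in> borel_measurable borel"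
  shows "wconv lborel f g = wconv lborel g f"
proof
  fix x
  have "wconv lborel f g x = (\<integral>z. f (x - z) * g (x - (x - z)) \<partial>lborel)"
    unfolding wconv_def by (subst lborel_integral_reflect[of "\<lambda>z. f z * g (x - z)" x]) auto
  then show "wconv lborel f g x = wconv lborel g f x"
    by (simp add: wconv_def mult.commute)
qed

context
  fixes N :: "'a::euclidean_space measure" and w F :: "'a \<Rightarrow> complex"
  assumes N: "sigma_finite_measure N" and sets_N [measurable_cong]: "sets N = sets borel"
    and w: "integrable N w" and F: "integrable lborel F"
begin

interpretation pair_sigma_finite N lborel
  by (intro pair_sigma_finite.intro N sigma_finite_lborel)

lemma [measurable]: "w \<in> borel_measurable borel" "F \<in> borel_measurable borel"
  using w F by (auto simp: measurable_cong_sets[OF sets_N refl] dest!: borel_measurable_integrable)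

text \<open>By translation invariance the inner integral of the norm is \<open>norm (w z)\<close>
  times the L1 norm of \<open>F\<close>. The bounded factor \<open>c\<close> is carried along so
  that \<open>c = 1\<close> yields the L1 estimate of the convolution and a character yields its
  transform.\<close>

lemma integrable_pair_wconv:
  assumes [measurable]: "c \<in> borel_measurable borel" and c: "\<And>x. norm (c x) \<le> (1 :: real)"
  shows "integrable (N \<Otimes>\<^sub>M lborel) (\<lambda>(z, x). c x * (w z * F (x - z)))"
proof (rule Bochner_Integration.integrable_bound)
  show "integrable (N \<Otimes>\<^sub>M lborel) (\<lambda>(z, x). w z * F (x - z))"
  proof (rule Fubini_integrable)
    have "(\<integral>x. norm (w z * F (x - z)) \<partial>lborel) = norm (w z) * (\<integral>x. norm (F x) \<partial>lborel)" for z
      using lborel_integral_shift[of "\<lambda>x. norm (F x)" z] by (simp add: norm_mult)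
    then show "integrable N (\<lambda>z. \<integral>x. norm (case (z, x) of (z, x) \<Rightarrow> w z * F (x - z)) \<partial>lborel)"
      using w by simp
    show "AE z in N. integrable lborel (\<lambda>x. case (z, x) of (z, x) \<Rightarrow> w z * F (x - z))"
      using lborel_integrable_shift[OF F] by simp
  qed measurable
  show "AE y in N \<Otimes>\<^sub>M lborel. norm (case y of (z, x) \<Rightarrow> c x * (w z * F (x - z))) \<le> norm (case y of (z, x) \<Rightarrow> w z * F (x - z))"
    using c by (auto simp: norm_mult mult_le_cancel_right1 split: prod.splits intro!: AE_I2 mult_left_le_one_le)
qed measurable

lemma integral_wconv:
  assumes c: "c \<in> borel_measurable borel" "\<And>x. norm (c x) \<le> 1"
  shows "(\<integral>x. c x * wconv N w F x \<partial>lborel) = (\<integral>z. w z * (\<integral>x. c x * F (x - z) \<partial>lborel) \<partial>N)"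
proof -
  have "(\<integral>x. c x * wconv N w F x \<partial>lborel) = (\<integral>x. (\<integral>z. c x * (w z * F (x - z)) \<partial>N) \<partial>lborel)"
    by (simp add: wconv_def)
  also have "\<dots> = (\<integral>z. (\<integral>x. w z * (c x * F (x - z)) \<partial>lborel) \<partial>N)"
    using Fubini_integral[OF integrable_pair_wconv[OF c]] by (simp add: mult.left_commute)
  finally show ?thesis
    by simp
qed

lemma integrable_wconv: "integrable lborel (wconv N w F)"
  using integrable_snd[OF integrable_pair_wconv[of "\<lambda>_. 1"]] by (simp add: wconv_def[abs_def])

lemma integral_norm_wconv_le:
  "(\<integral>x. norm (wconv N w F x) \<partial>lborel) \<le> (\<integral>z. norm (w z) \<partial>N) * (\<integral>x. norm (F x) \<partial>lborel)"
proof -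
  have int: "integrable (N \<Otimes>\<^sub>M lborel) (\<lambda>(z, x). norm (w z * F (x - z)))"
    using integrable_norm[OF integrable_pair_wconv[of "\<lambda>_. 1"]] by (simp add: case_prod_beta')
  have "(\<integral>x. norm (wconv N w F x) \<partial>lborel) \<le> (\<integral>x. (\<integral>z. norm (w z * F (x - z)) \<partial>N) \<partial>lborel)"
    using integrable_snd[OF int]
    by (intro integral_mono integrable_norm integrable_wconv) (auto simp: wconv_def)
  also have "\<dots> = (\<integral>z. (\<integral>x. norm (w z * F (x - z)) \<partial>lborel) \<partial>N)"
    using Fubini_integral[OF int] .
  also have "\<dots> = (\<integral>z. norm (w z) * (\<integral>x. norm (F x) \<partial>lborel) \<partial>N)"
    using lborel_integral_shift[of "\<lambda>x. norm (F x)"] by (simp add: norm_mult)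
  finally show ?thesis
    by simp
qed

text \<open>Shifting \<open>x\<close> by \<open>z\<close> splits the character into two factors. The
  constant of \<open>ift\<close> stays with \<open>F\<close>, so the transform of the weighted
  measure carries none.\<close>

lemma ift_wconv: "ift (wconv N w F) \<omega> = (\<integral>z. w z * cis (- (\<omega> \<bullet> z)) \<partial>N) * ift F \<omega>"
proof -
  have cis_meas: "(\<lambda>x :: 'a. cis (- (x \<bullet> \<omega>))) \<in> borel_measurable borel"
    by measurable
  have "(\<integral>x. cis (- (x \<bullet> \<omega>)) * wconv N w F x \<partial>lborel) =
    (\<integral>z. w z * (\<integral>x. cis (- (x \<bullet> \<omega>)) * F (x - z) \<partial>lborel) \<partial>N)"
    by (rule integral_wconv[OF cis_meas]) simp
  also have "\<dots> = (\<integral>z. w z * cis (- (\<omega> \<bullet> z)) * (\<integral>x. cis (- (x \<bullet> \<omega>)) * F x \<partial>lborel) \<partial>N)"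
  proof -
    have "(\<integral>x. cis (- (x \<bullet> \<omega>)) * F (x - z) \<partial>lborel) =
      (\<integral>x. cis (- (\<omega> \<bullet> z)) * (cis (- ((x - z) \<bullet> \<omega>)) * F (x - z)) \<partial>lborel)" for z
      by (simp add: cis_mult inner_diff_left inner_commute[of \<omega>] flip: mult.assoc)
    also have "\<dots> z = cis (- (\<omega> \<bullet> z)) * (\<integral>x. cis (- (x \<bullet> \<omega>)) * F x \<partial>lborel)" for z
      using lborel_integral_shift[of "\<lambda>x. cis (- (x \<bullet> \<omega>)) * F x" z] by simp
    finally show ?thesis
      by (simp add: mult.assoc)
  qed
  finally show ?thesis
    by (simp add: ift_def)
qed

end

lemma Xi_wconv:
  assumes "sigma_finite_measure N" "sets N = sets borel" "integrable N w" "F \<in> Xi k"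
  shows "wconv N w F \<in> Xi k"
  using assms by (auto simp: Xi_def intro: C0k_wconv integrable_wconv)

section \<open>The Gaussian\<close>

definition gauss :: "real \<Rightarrow> 'a::euclidean_space \<Rightarrow> real" where
  "gauss s x = exp (- (norm x)\<^sup>2 / (2 * s\<^sup>2)) / (s * sqrt (2 * pi)) ^ DIM('a)"

text \<open>The characteristic function of the normal law with density \<open>gauss s\<close>; the
  identification is \<open>integral_cis_gauss\<close>.\<close>

definition gauss_ft :: "real \<Rightarrow> 'a::euclidean_space \<Rightarrow> real" where
  "gauss_ft s \<omega> = exp (- (s * norm \<omega>)\<^sup>2 / 2)"

lemma gauss_ft_nonneg [simp]: "0 \<le> gauss_ft s \<omega>"
  by (simp add: gauss_ft_def)

lemma borel_measurable_gauss_ft [measurable]: "gauss_ft s \<in> borel_measurable borel"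
  unfolding gauss_ft_def by measurable

lemma gauss_nonneg [simp]: "s > 0 \<Longrightarrow> 0 \<le> gauss s x"
  by (simp add: gauss_def)

lemma gauss_minus: "gauss s (- x) = gauss s x"
  by (simp add: gauss_def)

lemma continuous_gauss: "continuous_on UNIV (gauss s)"
  unfolding gauss_def[abs_def] divide_inverse by (intro continuous_intros)

lemma borel_measurable_gauss [measurable]: "gauss s \<in> borel_measurable borel"
  using continuous_gauss by (rule borel_measurable_continuous_onI)

lemma norm_power2_eq_sum_Basis: "(norm x)\<^sup>2 = (\<Sum>b\<in>Basis. (x \<bullet> b)\<^sup>2)" for x :: "'a::euclidean_space"
  unfolding power2_norm_eq_inner by (subst euclidean_inner) (simp add: power2_eq_square)

lemma gauss_eq_prod:
  fixes x :: "'a::euclidean_space"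
  assumes "s > 0"
  shows "gauss s x = (\<Prod>b\<in>Basis. normal_density 0 s (x \<bullet> b))"
proof -
  have "sqrt (2 * pi * s\<^sup>2) = s * sqrt (2 * pi)"
    using assms by (simp add: real_sqrt_mult)
  then have "(\<Prod>b\<in>Basis. normal_density 0 s (x \<bullet> b)) =
    (\<Prod>b\<in>(Basis :: 'a set). exp (- (x \<bullet> b)\<^sup>2 / (2 * s\<^sup>2)) / (s * sqrt (2 * pi)))"
    by (simp add: normal_density_def)
  also have "\<dots> = exp (\<Sum>b\<in>Basis. - (x \<bullet> b)\<^sup>2 / (2 * s\<^sup>2)) / (s * sqrt (2 * pi)) ^ DIM('a)"
    by (simp add: prod_dividef exp_sum)
  also have "(\<Sum>b\<in>Basis. - (x \<bullet> b)\<^sup>2 / (2 * s\<^sup>2)) = - (norm x)\<^sup>2 / (2 * s\<^sup>2)"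
    by (simp add: norm_power2_eq_sum_Basis sum_negf flip: sum_divide_distrib)
  finally show ?thesis
    by (simp add: gauss_def)
qed

text \<open>\<open>lborel\<close> is the image of a product of one-dimensional Lebesgue measures
  under the coordinate map. Gaussian integrals and the majorant for rapidly decaying functions thus
  reduce to dimension one.\<close>

lemma lborel_prod_Basis:
  fixes f :: "'a::euclidean_space \<Rightarrow> real \<Rightarrow> 'b::{real_normed_field, banach, second_countable_topology}"
  assumes f: "\<And>b. b \<in> Basis \<Longrightarrow> integrable lborel (f b)"
  shows lborel_integrable_prod_Basis: "integrable lborel (\<lambda>x. \<Prod>b\<in>Basis. f b (x \<bullet> b))"
    and lborel_integral_prod_Basis: "(\<integral>x. (\<Prod>b\<in>Basis. f b (x \<bullet> b)) \<partial>lborel) = (\<Prod>b\<in>Basis. \<integral>t. f b t \<partial>lborel)"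
proof -
  interpret product_sigma_finite "\<lambda>b :: 'a. lborel :: real measure"
    by standard
  let ?T = "\<lambda>x :: 'a \<Rightarrow> real. \<Sum>b\<in>Basis. x b *\<^sub>R b"
  have T: "?T \<in> measurable (\<Pi>\<^sub>M b\<in>Basis. lborel) borel"
    by measurable
  have inner_T: "?T x \<bullet> b = x b" if "b \<in> Basis" for x b
    using that by (simp add: inner_sum_left inner_Basis if_distrib cong: if_cong)
  have [measurable]: "(\<lambda>x. \<Prod>b\<in>Basis. f b (x \<bullet> b)) \<in> borel_measurable borel"
  proof (intro borel_measurable_prod)
    fix b :: 'a assume "b \<in> Basis"
    then have [measurable]: "f b \<in> borel_measurable borel"
      using f by (auto dest!: borel_measurable_integrable)
    show "(\<lambda>x. f b (x \<bullet> b)) \<in> borel_measurable borel"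
      by measurable
  qed
  have eq: "(\<Prod>b\<in>Basis. f b (?T x \<bullet> b)) = (\<Prod>b\<in>Basis. f b (x b))" for x
    by (intro prod.cong) (simp_all add: inner_T)
  show "integrable lborel (\<lambda>x. \<Prod>b\<in>Basis. f b (x \<bullet> b))"
    using product_integrable_prod[of Basis f] f
    by (subst lborel_eq, subst integrable_distr_eq[OF T]) (auto simp: eq)
  show "(\<integral>x. (\<Prod>b\<in>Basis. f b (x \<bullet> b)) \<partial>lborel) = (\<Prod>b\<in>Basis. \<integral>t. f b t \<partial>lborel)"
    using product_integral_prod[of Basis f] f
    by (subst lborel_eq, subst integral_distr[OF T]) (auto simp: eq)
qed

lemma gauss_integrable [simp]: "s > 0 \<Longrightarrow> integrable lborel (gauss s)"
proof -
  assume "s > 0"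
  then have "gauss s = (\<lambda>x :: 'a. \<Prod>b\<in>Basis. normal_density 0 s (x \<bullet> b))"
    by (simp add: fun_eq_iff gauss_eq_prod)
  then show ?thesis
    using \<open>s > 0\<close> lborel_integrable_prod_Basis[of "\<lambda>_ :: 'a. normal_density 0 s"] by simp
qed

lemma gauss_integral [simp]: "s > 0 \<Longrightarrow> (\<integral>x. gauss s x \<partial>lborel) = 1"
  using lborel_integral_prod_Basis[of "\<lambda>_. normal_density 0 s"] by (simp add: gauss_eq_prod)

text \<open>Expanding the squared norm in coordinates turns the integrand into a sum of products; in
  each, one factor integrates to the variance \<open>s\<^sup>2\<close> and the others to 1. This
  moment is all that the uniform approximation below uses about the tails of the Gaussian.\<close>

lemma gauss_second_moment:
  fixes s :: real
  assumes "s > 0"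
  shows "integrable lborel (\<lambda>x :: 'a::euclidean_space. gauss s x * (norm x)\<^sup>2)"
    and "(\<integral>x. gauss s (x :: 'a) * (norm x)\<^sup>2 \<partial>lborel) = DIM('a) * s\<^sup>2"
proof -
  have M2: "integrable lborel (\<lambda>t. normal_density 0 s t * t\<^sup>2)" "(\<integral>t. normal_density 0 s t * t\<^sup>2 \<partial>lborel) = s\<^sup>2"
    using integrable_normal_moment[OF assms, of 0 2] integral_normal_moment_even[OF assms, of 0 1] assms
    by (simp_all add: fact_numeral)
  define h where "h b c t = normal_density 0 s t * (if b = c then t\<^sup>2 else 1)" for b c :: 'a and t
  have h_int: "integrable lborel (h b c)" for b c
    unfolding h_def using M2 assms by (cases "b = c") (auto simp: integrable_normal_density)
  have h_val: "(\<integral>t. h b c t \<partial>lborel) = (if b = c then s\<^sup>2 else 1)" for b c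
    unfolding h_def using M2 assms by (cases "b = c") auto
  have eq: "gauss s x * (norm x)\<^sup>2 = (\<Sum>b\<in>Basis. \<Prod>c\<in>Basis. h b c (x \<bullet> c))" for x :: 'a
  proof -
    have "(\<Prod>c\<in>Basis. h b c (x \<bullet> c)) = gauss s x * (x \<bullet> b)\<^sup>2" if "b \<in> Basis" for b
      using that assms by (simp add: h_def prod.distrib gauss_eq_prod)
    then show ?thesis
      by (simp add: norm_power2_eq_sum_Basis sum_distrib_left)
  qed
  show "integrable lborel (\<lambda>x :: 'a. gauss s x * (norm x)\<^sup>2)"
    unfolding eq by (intro Bochner_Integration.integrable_sum lborel_integrable_prod_Basis h_int)
  show "(\<integral>x. gauss s (x :: 'a) * (norm x)\<^sup>2 \<partial>lborel) = DIM('a) * s\<^sup>2"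
    unfolding eq
    by (subst Bochner_Integration.integral_sum) (simp_all add: lborel_integral_prod_Basis lborel_integrable_prod_Basis h_int h_val)
qed

text \<open>Rescaling by \<open>s\<close> leads to the characteristic function of the standard
  normal law at \<open>s * t\<close>.\<close>

lemma integral_cis_normal_density:
  assumes "s > 0"
  shows "(\<integral>x. cis (t * x) * complex_of_real (normal_density 0 s x) \<partial>lborel) = complex_of_real (exp (- (s * t)\<^sup>2 / 2))"
proof -
  have nd: "s * normal_density 0 s (s * x) = std_normal_density x" for x
    using assms by (simp add: normal_density_def real_sqrt_mult power_mult_distrib)
  have "(\<integral>x. cis (t * x) * complex_of_real (normal_density 0 s x) \<partial>lborel) =
    (\<integral>x. s *\<^sub>R (cis (t * (s * x)) * complex_of_real (normal_density 0 s (s * x))) \<partial>lborel)"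
    using assms by (subst lborel_integral_real_affine[of s _ 0]) auto
  also have "\<dots> = (\<integral>x. std_normal_density x *\<^sub>R cis ((s * t) * x) \<partial>lborel)"
    by (intro Bochner_Integration.integral_cong) (auto simp: scaleR_conv_of_real ac_simps simp flip: nd)
  also have "\<dots> = char std_normal_distribution (s * t)"
    unfolding char_def by (subst integral_density) (auto simp: cis_conv_exp)
  finally show ?thesis
    by (simp add: char_std_normal_distribution)
qed

lemma cis_sum: "finite A \<Longrightarrow> cis (\<Sum>i\<in>A. f i) = (\<Prod>i\<in>A. cis (f i))"
  by (simp add: cis_conv_exp sum_distrib_left exp_sum)

lemma integral_cis_gauss:
  fixes \<omega> :: "'a::euclidean_space"
  assumes "s > 0"
  shows "(\<integral>x. cis (\<omega> \<bullet> x) * complex_of_real (gauss s x) \<partial>lborel) = complex_of_real (gauss_ft s \<omega>)"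
proof -
  define h where "h b t = cis ((\<omega> \<bullet> b) * t) * complex_of_real (normal_density 0 s t)" for b :: 'a and t
  have int: "integrable lborel (h b)" for b
  proof (rule Bochner_Integration.integrable_bound)
    show "integrable lborel (normal_density 0 s)"
      using assms by simp
    show "h b \<in> borel_measurable lborel"
      unfolding h_def by measurable
  qed (auto simp: h_def norm_mult)
  have "cis (\<omega> \<bullet> x) * complex_of_real (gauss s x) = (\<Prod>b\<in>Basis. h b (x \<bullet> b))" for x
    using assms by (simp add: h_def prod.distrib gauss_eq_prod cis_sum euclidean_inner[of \<omega> x])
  then have "(\<integral>x. cis (\<omega> \<bullet> x) * complex_of_real (gauss s x) \<partial>lborel) =
    (\<Prod>b\<in>Basis. complex_of_real (exp (- (s * (\<omega> \<bullet> b))\<^sup>2 / 2)))"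
    using int by (simp add: lborel_integral_prod_Basis) (simp add: h_def integral_cis_normal_density assms)
  also have "\<dots> = complex_of_real (exp (\<Sum>b\<in>Basis. - (s * (\<omega> \<bullet> b))\<^sup>2 / 2))"
    by (simp only: of_real_prod exp_sum finite_Basis)
  also have "(\<Sum>b\<in>Basis. - (s * (\<omega> \<bullet> b))\<^sup>2 / 2) = - (s * norm \<omega>)\<^sup>2 / 2"
    by (simp add: power_mult_distrib norm_power2_eq_sum_Basis sum_negf sum_distrib_left flip: sum_divide_distrib)
  finally show ?thesis
    by (simp add: gauss_ft_def)
qed

text \<open>Up to a constant the transform is a Gaussian of inverse width, so inverting it amounts
  to computing a second forward transform.\<close>

lemma gauss_ft_eq_gauss:
  fixes \<omega> :: "'a::euclidean_space"
  assumes "s > 0"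
  shows "gauss_ft s \<omega> = (sqrt (2 * pi) / s) ^ DIM('a) * gauss (1 / s) \<omega>"
  using assms by (simp add: gauss_def gauss_ft_def power_mult_distrib power_divide)

lemma integral_cis_gauss_ft:
  fixes x :: "'a::euclidean_space"
  assumes "s > 0"
  shows "(\<integral>\<omega>. cis (x \<bullet> \<omega>) * complex_of_real (gauss_ft s \<omega>) \<partial>lborel) =
    complex_of_real ((2 * pi) ^ DIM('a) * gauss s x)"
proof -
  have "(\<integral>\<omega>. cis (x \<bullet> \<omega>) * complex_of_real (gauss_ft s \<omega>) \<partial>lborel) =
    complex_of_real ((sqrt (2 * pi) / s) ^ DIM('a)) *
      (\<integral>\<omega>. cis (x \<bullet> \<omega>) * complex_of_real (gauss (1 / s) \<omega>) \<partial>lborel)"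
    unfolding gauss_ft_eq_gauss[OF assms] integral_mult_right_zero[symmetric]
    by (intro Bochner_Integration.integral_cong) auto
  also have "\<dots> = complex_of_real ((sqrt (2 * pi) / s) ^ DIM('a) * exp (- (norm x)\<^sup>2 / (2 * s\<^sup>2)))"
    using assms by (subst integral_cis_gauss) (simp_all add: gauss_ft_def power_divide power_mult_distrib)
  also have "(sqrt (2 * pi) / s) ^ DIM('a) * exp (- (norm x)\<^sup>2 / (2 * s\<^sup>2)) = (2 * pi) ^ DIM('a) * gauss s x"
  proof -
    \<comment> \<open>This identity, raised to the dimension, produces one factor
      \<open>2 * pi\<close> per coordinate and the normalisation of \<open>gauss s\<close>.\<close>
    have "sqrt (2 * pi) / s = (2 * pi) / (s * sqrt (2 * pi))"
      using assms by (simp add: field_simps)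
    then show ?thesis
      unfolding gauss_def by (simp only: power_divide) simp
  qed
  finally show ?thesis .
qed

lemma integrable_gauss_ft:
  "s > 0 \<Longrightarrow> integrable lborel (\<lambda>\<omega> :: 'a::euclidean_space. gauss_ft s \<omega>)"
  by (subst gauss_ft_eq_gauss) auto

text \<open>By \<open>1 + t \<le> exp t\<close> the exponent is at most
  \<open>n * t - (a * t)\<^sup>2 / 2\<close>, and completing the square bounds this by
  \<open>(n / a)\<^sup>2 / 2\<close>. The values \<open>a = s\<close> and \<open>a = 1 / s\<close>
  cover \<open>gauss_ft s\<close> and \<open>gauss s\<close>.\<close>

lemma power_mult_exp_le:
  fixes t :: real
  assumes "t \<ge> 0" "a > 0"
  shows "(1 + t) ^ n * exp (- (a * t)\<^sup>2 / 2) \<le> exp ((n / a)\<^sup>2 / 2)"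
proof -
  have "(1 + t) ^ n * exp (- (a * t)\<^sup>2 / 2) \<le> exp t ^ n * exp (- (a * t)\<^sup>2 / 2)"
    using assms exp_ge_add_one_self[of t] by (intro mult_right_mono power_mono) auto
  also have "\<dots> = exp (n * t - (a * t)\<^sup>2 / 2)"
    by (simp flip: exp_of_nat_mult exp_add)
  also have "n * t - (a * t)\<^sup>2 / 2 \<le> (n / a)\<^sup>2 / 2"
  proof -
    have "0 \<le> (n / a - a * t)\<^sup>2"
      by simp
    also have "\<dots> = (n / a)\<^sup>2 + (a * t)\<^sup>2 - 2 * (n * t)"
      using assms by (simp add: power2_diff)
    finally show ?thesis
      by simp
  qed
  finally show ?thesis
    by simp
qed

lemma gauss_ft_decay:
  "s > 0 \<Longrightarrow> (1 + norm \<omega>) ^ n * gauss_ft s \<omega> \<le> exp ((n / s)\<^sup>2 / 2)"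
  unfolding gauss_ft_def by (rule power_mult_exp_le) auto

lemma gauss_decay:
  assumes "s > 0"
  obtains C where "C \<ge> 0" "\<And>x :: 'a::euclidean_space. (1 + norm x) ^ n * gauss s x \<le> C"
proof
  let ?C = "exp ((n / (1 / s))\<^sup>2 / 2) / (s * sqrt (2 * pi)) ^ DIM('a)"
  show "?C \<ge> 0"
    using assms by simp
  fix x :: 'a
  have "(1 + norm x) ^ n * gauss s x = (1 + norm x) ^ n * exp (- (1 / s * norm x)\<^sup>2 / 2) / (s * sqrt (2 * pi)) ^ DIM('a)"
    by (simp add: gauss_def power_divide)
  also have "\<dots> \<le> ?C"
    using assms by (intro divide_right_mono power_mult_exp_le) auto
  finally show "(1 + norm x) ^ n * gauss s x \<le> ?C" .
qed

section \<open>Derivatives of the Gaussian\<close>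

lemma real_polynomial_function_has_derivative:
  fixes p :: "'a::real_normed_vector \<Rightarrow> real"
  assumes "real_polynomial_function p"
  shows "\<exists>p'. (\<forall>x. (p has_derivative p' x) (at x)) \<and> (\<forall>b. real_polynomial_function (\<lambda>x. p' x b))"
  using assms
proof induction
  case (linear f)
  then show ?case
    by (intro exI[of _ "\<lambda>_. f"]) (auto intro: bounded_linear_imp_has_derivative)
next
  case (const c)
  then show ?case
    by (intro exI[of _ "\<lambda>_ _. 0"]) auto
next
  case (add f g)
  then obtain f' g' where "\<forall>x. (f has_derivative f' x) (at x)" "\<forall>b. real_polynomial_function (\<lambda>x. f' x b)"
    "\<forall>x. (g has_derivative g' x) (at x)" "\<forall>b. real_polynomial_function (\<lambda>x. g' x b)"
    by blast
  then show ?case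
    by (intro exI[of _ "\<lambda>x h. f' x h + g' x h"]) (auto intro: has_derivative_add)
next
  case (mult f g)
  then obtain f' g' where "\<forall>x. (f has_derivative f' x) (at x)" "\<forall>b. real_polynomial_function (\<lambda>x. f' x b)"
    "\<forall>x. (g has_derivative g' x) (at x)" "\<forall>b. real_polynomial_function (\<lambda>x. g' x b)"
    by blast
  then show ?case
    using mult by (intro exI[of _ "\<lambda>x h. f x * g' x h + f' x h * g x"])
      (auto intro!: has_derivative_mult real_polynomial_function.intros(3,4))
qed

lemma real_polynomial_function_growth:
  fixes p :: "'a::real_normed_vector \<Rightarrow> real"
  assumes "real_polynomial_function p"
  shows "\<exists>C m. C \<ge> 0 \<and> (\<forall>x. \<bar>p x\<bar> \<le> C * (1 + norm x) ^ m)"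
  using assms
proof induction
  case (linear f)
  then obtain K where K: "K > 0" "\<And>x. \<bar>f x\<bar> \<le> norm x * K"
    using bounded_linear.pos_bounded[of f] by auto
  have "\<bar>f x\<bar> \<le> K * (1 + norm x) ^ 1" for x
    using K(2)[of x] K(1) by (simp add: algebra_simps)
  then show ?case
    using K(1) by (intro exI[of _ K] exI[of _ 1]) auto
next
  case (const c)
  then show ?case
    by (intro exI[of _ "\<bar>c\<bar>"] exI[of _ 0]) auto
next
  case (add f g)
  then obtain C m D n where *: "C \<ge> 0" "\<And>x. \<bar>f x\<bar> \<le> C * (1 + norm x) ^ m" "D \<ge> 0" "\<And>x. \<bar>g x\<bar> \<le> D * (1 + norm x) ^ n"
    by blast
  have "\<bar>f x + g x\<bar> \<le> (C + D) * (1 + norm x) ^ (m + n)" for x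
  proof -
    have "\<bar>f x + g x\<bar> \<le> C * (1 + norm x) ^ m + D * (1 + norm x) ^ n"
      using *(2,4)[of x] by linarith
    also have "\<dots> \<le> C * (1 + norm x) ^ (m + n) + D * (1 + norm x) ^ (m + n)"
      using * by (intro add_mono mult_left_mono power_increasing) auto
    finally show ?thesis
      by (simp add: algebra_simps)
  qed
  then show ?case
    using * by (intro exI[of _ "C + D"] exI[of _ "m + n"]) auto
next
  case (mult f g)
  then obtain C m D n where *: "C \<ge> 0" "\<And>x. \<bar>f x\<bar> \<le> C * (1 + norm x) ^ m" "D \<ge> 0" "\<And>x. \<bar>g x\<bar> \<le> D * (1 + norm x) ^ n"
    by blast
  have "\<bar>f x * g x\<bar> \<le> (C * D) * (1 + norm x) ^ (m + n)" for x
  proof -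
    have "\<bar>f x * g x\<bar> \<le> (C * (1 + norm x) ^ m) * (D * (1 + norm x) ^ n)"
      unfolding abs_mult using * by (intro mult_mono) auto
    then show ?thesis
      by (simp add: power_add algebra_simps)
  qed
  then show ?case
    using * by (intro exI[of _ "C * D"] exI[of _ "m + n"]) auto
qed

lemma has_derivative_gauss:
  "s > 0 \<Longrightarrow> (gauss s has_derivative (\<lambda>h. - (x \<bullet> h) / s\<^sup>2 * gauss s x)) (at (x :: 'a::euclidean_space))"
proof -
  assume "s > 0"
  then   have "((\<lambda>x. exp (- (x \<bullet> x) * (1 / (2 * s\<^sup>2))) * (1 / (s * sqrt (2 * pi)) ^ DIM('a))) has_derivative
    (\<lambda>h. - (x \<bullet> h) / s\<^sup>2 * gauss s x)) (at x)"
    by (auto intro!: derivative_eq_intros simp: gauss_def power2_norm_eq_inner inner_commute divide_simps)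
  then show ?thesis
    by (simp add: gauss_def[abs_def] power2_norm_eq_inner)
qed

text \<open>A derivative in direction \<open>b\<close> replaces the factor \<open>q\<close> by its
  own derivative minus \<open>(x \<bullet> b) / s\<^sup>2 * q\<close>, the recursion behind Hermite
  polynomials. Of \<open>q\<close> only its being a polynomial is recorded: this is stable under the
  recursion and bounds the growth.\<close>

lemma pds_gauss:
  fixes s :: real
  assumes "s > 0"
  obtains q :: "'a::euclidean_space \<Rightarrow> real" where "real_polynomial_function q"
    "pds bs (\<lambda>x. complex_of_real (gauss s x)) = (\<lambda>x. complex_of_real (q x * gauss s x))"
proof -
  have "\<exists>q. real_polynomial_function q \<and>
    pds bs (\<lambda>x. complex_of_real (gauss s x)) = (\<lambda>x :: 'a. complex_of_real (q x * gauss s x))"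
  proof (induction bs)
    case Nil
    then show ?case
      by (intro exI[of _ "\<lambda>_. 1"]) auto
  next
    case (Cons b bs)
    then obtain q where q: "real_polynomial_function q"
      "pds bs (\<lambda>x. complex_of_real (gauss s x)) = (\<lambda>x :: 'a. complex_of_real (q x * gauss s x))"
      by blast
    obtain q' where q': "\<And>x. (q has_derivative q' x) (at x)" "\<And>b. real_polynomial_function (\<lambda>x. q' x b)"
      using real_polynomial_function_has_derivative[OF q(1)] by blast
    have "frechet_derivative (\<lambda>x. complex_of_real (q x * gauss s x)) (at x) b =
      complex_of_real ((q x * (- (x \<bullet> b) / s\<^sup>2) + q' x b) * gauss s x)" for x
    proof -
      have "((\<lambda>x. complex_of_real (q x * gauss s x)) has_derivative
        (\<lambda>h. complex_of_real (q x * (- (x \<bullet> h) / s\<^sup>2 * gauss s x) + q' x h * gauss s x))) (at x)"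
        by (intro has_derivative_of_real has_derivative_mult q' has_derivative_gauss assms)
      from frechet_derivative_at[OF this, symmetric] show ?thesis
        by (simp add: algebra_simps)
    qed
    then have "pds (b # bs) (\<lambda>x. complex_of_real (gauss s x)) =
      (\<lambda>x. complex_of_real ((q x * (- (x \<bullet> b) / s\<^sup>2) + q' x b) * gauss s x))"
      by (simp add: q(2))
    moreover have "real_polynomial_function (\<lambda>x. q x * (- (x \<bullet> b) / s\<^sup>2) + q' x b)"
      using q' q by (intro real_polynomial_function.intros(3,4) real_polynomial_function_divide
          real_polynomial_function_minus) (auto intro: real_polynomial_function.intros(1) bounded_linear_inner_left)
    ultimately show ?case
      by blast
  qed
  then show thesis
    using that by blast
qed

lemma schwartz_gauss:
  assumes "s > 0"
  shows "schwartz (\<lambda>x :: 'a::euclidean_space. complex_of_real (gauss s x))"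
  unfolding schwartz_def Ck_def
proof (intro conjI allI impI ballI)
  fix bs :: "'a list" and x
  obtain q :: "'a \<Rightarrow> real" where q: "real_polynomial_function q"
    "pds bs (\<lambda>x. complex_of_real (gauss s x)) = (\<lambda>x. complex_of_real (q x * gauss s x))"
    using pds_gauss[OF assms] .
  obtain q' where q': "\<And>x. (q has_derivative q' x) (at x)"
    using real_polynomial_function_has_derivative[OF q(1)] by blast
  have diff: "pds bs (\<lambda>x. complex_of_real (gauss s x)) differentiable at x" for x
    unfolding q(2) differentiable_def
    using has_derivative_of_real[OF has_derivative_mult[OF q' has_derivative_gauss[OF assms]]] by blast
  then show "pds bs (\<lambda>x. complex_of_real (gauss s x)) differentiable at x" .
  show "continuous_on UNIV (pds bs (\<lambda>x. complex_of_real (gauss s x)))"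
    using diff by (simp add: continuous_on_eq_continuous_at differentiable_imp_continuous_within)
  fix N :: nat
  obtain C m where C: "C \<ge> 0" "\<And>x. \<bar>q x\<bar> \<le> C * (1 + norm x) ^ m"
    using real_polynomial_function_growth[OF q(1)] by blast
  \<comment> \<open>The exponent \<open>N + m\<close> also absorbs the growth of the polynomial
    factor.\<close>
  obtain D where D: "\<And>x :: 'a. (1 + norm x) ^ (N + m) * gauss s x \<le> D"
    using gauss_decay[OF assms] by metis
  have "norm ((1 + norm x) ^ N *\<^sub>R pds bs (\<lambda>x. complex_of_real (gauss s x)) x) \<le> C * D" for x :: 'a
  proof -
    have "norm ((1 + norm x) ^ N *\<^sub>R pds bs (\<lambda>x. complex_of_real (gauss s x)) x) =
      (1 + norm x) ^ N * (\<bar>q x\<bar> * gauss s x)"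
      using assms by (simp add: q(2) abs_mult norm_mult)
    also have "\<dots> \<le> (1 + norm x) ^ N * ((C * (1 + norm x) ^ m) * gauss s x)"
      using C assms by (intro mult_left_mono mult_right_mono) auto
    also have "\<dots> = C * ((1 + norm x) ^ (N + m) * gauss s x)"
      by (simp add: power_add)
    also have "\<dots> \<le> C * D"
      using C D by (intro mult_left_mono) auto
    finally show ?thesis .
  qed
  then show "bounded (range (\<lambda>x. (1 + norm x) ^ N *\<^sub>R pds bs (\<lambda>x. complex_of_real (gauss s x)) x))"
    unfolding bounded_iff by blast
qed

section \<open>Schwartz functions and their Fourier transforms\<close>

text \<open>The majorant is a product of one-dimensional functions
  \<open>inverse (1 + t\<^sup>2)\<close> over the coordinates. Each
  \<open>1 + (x \<bullet> b)\<^sup>2\<close> is at most \<open>(1 + norm x)\<^sup>2\<close>, whence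
  the exponent \<open>2 * DIM('a)\<close>.\<close>

lemma integrable_rapid_decay:
  fixes f :: "'a::euclidean_space \<Rightarrow> 'b::{banach, second_countable_topology}"
  assumes "f \<in> borel_measurable borel" and B: "\<And>x. (1 + norm x) ^ (2 * DIM('a)) * norm (f x) \<le> B"
  shows "integrable lborel f"
proof (rule Bochner_Integration.integrable_bound)
  have "integrable lborel (\<lambda>t :: real. inverse (1 + t\<^sup>2))"
    using integrable_inverse_1_plus_square by (simp add: set_integrable_def)
  then show "integrable lborel (\<lambda>x :: 'a. B * (\<Prod>b\<in>Basis. inverse (1 + (x \<bullet> b)\<^sup>2)))"
    by (intro integrable_mult_right lborel_integrable_prod_Basis)
  have "norm (f x) \<le> norm (B * (\<Prod>b\<in>Basis. inverse (1 + (x \<bullet> b)\<^sup>2)))" for x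
  proof -
    let ?P = "\<Prod>b\<in>Basis. 1 + (x \<bullet> b)\<^sup>2"
    have "1 + (x \<bullet> b)\<^sup>2 \<le> (1 + norm x)\<^sup>2" if "b \<in> Basis" for b
    proof -
      have "(x \<bullet> b)\<^sup>2 \<le> (norm x)\<^sup>2"
        using Basis_le_norm[OF that, of x] by (simp add: power2_le_iff_abs_le)
      then show ?thesis
        using norm_ge_zero[of x] unfolding power2_sum one_power2 by linarith
    qed
    then have "?P \<le> (\<Prod>b\<in>(Basis :: 'a set). (1 + norm x)\<^sup>2)"
      by (intro prod_mono) auto
    then have "?P \<le> (1 + norm x) ^ (2 * DIM('a))"
      by (simp add: power_mult)
    then have "?P * norm (f x) \<le> B"
      using B[of x] by (smt (verit) mult_right_mono norm_ge_zero)
    moreover have "?P > 0"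
      by (intro prod_pos) (auto intro: add_pos_nonneg)
    ultimately have "norm (f x) \<le> B * inverse ?P"
      by (simp add: field_simps)
    then have "norm (f x) \<le> B * (\<Prod>b\<in>Basis. inverse (1 + (x \<bullet> b)\<^sup>2))"
      using prod_inversef[of "\<lambda>b. 1 + (x \<bullet> b)\<^sup>2" Basis] by (simp add: o_def)
    then show ?thesis
      by simp
  qed
  then show "AE x in lborel. norm (f x) \<le> norm (B * (\<Prod>b\<in>Basis. inverse (1 + (x \<bullet> b)\<^sup>2)))"
    by simp
qed (use assms in simp)

lemma schwartz_continuous:
  assumes "schwartz f" "set bs \<subseteq> Basis"
  shows "continuous_on UNIV (pds bs f)"
  using assms Ck_continuous[of "length bs" f bs] by (auto simp: schwartz_def multi_idx_def)

lemma schwartz_imp_Xi: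
  fixes f :: "'a::euclidean_space \<Rightarrow> complex"
  assumes "schwartz f"
  shows "f \<in> Xi k"
proof -
  have "(pds bs f \<longlongrightarrow> 0) at_infinity" if bs: "set bs \<subseteq> Basis" for bs
  proof -
    obtain B where B: "\<And>x. (1 + norm x) ^ 1 * norm (pds bs f x) \<le> B"
      using schwartz_bound[OF assms bs] by metis
    have "norm (pds bs f x) \<le> B * inverse (1 + norm x)" for x
      using B[of x] by (simp add: field_simps add_pos_nonneg)
    moreover have "((\<lambda>x :: 'a. B * inverse (1 + norm x)) \<longlongrightarrow> B * 0) at_infinity"
      by (intro tendsto_mult tendsto_const tendsto_inverse_0_at_top filterlim_tendsto_add_at_top[OF tendsto_const]
          filterlim_norm_at_top)
    ultimately show ?thesis
      by (intro Lim_null_comparison[of "pds bs f" "\<lambda>x. B * inverse (1 + norm x)"]) auto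
  qed
  moreover obtain B where "\<And>x. (1 + norm x) ^ (2 * DIM('a)) * norm (f x) \<le> B"
    using schwartz_bound[OF assms, of "[]" "2 * DIM('a)"] by auto
  moreover have "f \<in> borel_measurable borel"
    using schwartz_continuous[OF assms, of "[]"] by (auto intro: borel_measurable_continuous_onI)
  ultimately show ?thesis
    using assms by (auto simp: Xi_def C0k_def schwartz_def multi_idx_def intro: integrable_rapid_decay)
qed

lemma pds_append: "pds (bs @ cs) f = pds bs (pds cs f)"
  by (induction bs) auto

lemma schwartz_pds:
  fixes f :: "'a::euclidean_space \<Rightarrow> complex"
  assumes f: "schwartz f" and cs: "set cs \<subseteq> Basis"
  shows "schwartz (pds cs f)"
  unfolding schwartz_def Ck_def
proof (intro conjI allI impI ballI)
  fix k :: nat and bs :: "'a list" and x assume "set bs \<subseteq> Basis \<and> length bs < k"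
  then show "pds bs (pds cs f) differentiable at x"
    using f cs Ck_differentiable[of "length bs + length cs + 1" f "bs @ cs" x]
    by (simp add: schwartz_def pds_append)
next
  fix k :: nat and bs :: "'a list" assume "bs \<in> multi_idx k"
  then show "continuous_on UNIV (pds bs (pds cs f))"
    using schwartz_continuous[OF f, of "bs @ cs"] cs by (simp add: multi_idx_def pds_append)
next
  fix N and bs :: "'a list" assume "set bs \<subseteq> Basis"
  then show "bounded (range (\<lambda>x. (1 + norm x) ^ N *\<^sub>R pds bs (pds cs f) x))"
    using f cs unfolding schwartz_def pds_append[symmetric] by auto
qed

section \<open>Decay of inverse Fourier transforms\<close>

lemma norm_ift_le: "norm (ift f \<omega>) \<le> (\<integral>x. norm (f x) \<partial>lborel)"
  for \<omega> :: "'a::euclidean_space"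
proof -
  have "norm (\<integral>x. cis (- (x \<bullet> \<omega>)) * f x \<partial>lborel) \<le> (\<integral>x. norm (cis (- (x \<bullet> \<omega>)) * f x) \<partial>lborel)"
    by (rule integral_norm_bound)
  then have "norm (\<integral>x. cis (- (x \<bullet> \<omega>)) * f x \<partial>lborel) \<le> (\<integral>x. norm (f x) \<partial>lborel)"
    by (simp add: norm_mult)
  moreover have "1 \<le> (2 * pi) ^ DIM('a)"
    using pi_ge_two by (intro one_le_power) simp
  ultimately show ?thesis
    by (simp add: ift_def norm_mult norm_divide norm_power divide_le_eq)
      (smt (verit) Bochner_Integration.integral_nonneg mult_le_cancel_left1 norm_ge_zero)
qed

lemma difference_quotient_LIMSEQ:
  fixes f :: "real \<Rightarrow> 'b::real_normed_vector"
  assumes "(f has_vector_derivative D) (at 0)" "h \<longlonglongrightarrow> 0" "\<And>n. h n \<noteq> 0"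
  shows "(\<lambda>n. (f (h n) - f 0) /\<^sub>R h n) \<longlonglongrightarrow> D"
proof -
  have "((\<lambda>t. norm (f (0 + t) - f 0 - t *\<^sub>R D) / norm t) \<longlongrightarrow> 0) (at 0)"
    using assms(1) by (simp add: has_vector_derivative_def has_derivative_at)
  moreover have "filterlim h (at 0) sequentially"
    using assms(2,3) by (simp add: filterlim_at)
  ultimately have "(\<lambda>n. norm (f (0 + h n) - f 0 - h n *\<^sub>R D) / norm (h n)) \<longlonglongrightarrow> 0"
    by (rule filterlim_compose)
  moreover have "norm (f (0 + h n) - f 0 - h n *\<^sub>R D) / norm (h n) = norm ((f (h n) - f 0) /\<^sub>R h n - D)" for n
  proof -
    have "(f (h n) - f 0) /\<^sub>R h n - D = (f (0 + h n) - f 0 - h n *\<^sub>R D) /\<^sub>R h n"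
      using assms(3)[of n] by (simp add: scaleR_diff_right)
    then show ?thesis
      by (simp add: divide_inverse mult.commute)
  qed
  ultimately show ?thesis
    by (simp add: tendsto_norm_zero_iff LIM_zero_iff)
qed

text \<open>In place of integration by parts, the difference quotient in direction \<open>b\<close>
  is transformed: translation multiplies a transform by a character, so the quotient turns into
  \<open>(cis (h * (\<omega> \<bullet> b)) - 1) / h\<close> times the transform of \<open>f\<close>.
  Dominated convergence gives the limit of one side, the derivative of \<open>cis\<close> that of
  the other. The sign is plus because \<open>ift\<close> integrates against
  \<open>cis (- (\<omega> \<bullet> x))\<close>.\<close>

lemma ift_pds_Basis:
  fixes f :: "'a::euclidean_space \<Rightarrow> complex"
  assumes f: "schwartz f" and b: "b \<in> Basis"
  shows "ift (pds [b] f) \<omega> = \<i> * complex_of_real (\<omega> \<bullet> b) * ift f \<omega>"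
proof -
  define I where "I g = (\<integral>x. cis (- (x \<bullet> \<omega>)) * g x \<partial>lborel)" for g
  define h where "h n = inverse (real (Suc n))" for n
  have h: "h n > 0" "h n \<le> 1" "h \<longlonglongrightarrow> 0" for n
    unfolding h_def using LIMSEQ_inverse_real_of_nat by (auto simp: field_simps)
  have diff: "(f has_derivative frechet_derivative f (at x)) (at x)" for x
    using f Ck_differentiable[of 1 f "[]" x] by (simp add: schwartz_def frechet_derivative_works)
  have line: "((\<lambda>t. f (x + t *\<^sub>R b)) has_vector_derivative pds [b] f (x + t *\<^sub>R b)) (at t)" for x t
  proof -
    have "((\<lambda>t. f (x + t *\<^sub>R b)) has_derivative (\<lambda>h. frechet_derivative f (at (x + t *\<^sub>R b)) (h *\<^sub>R b))) (at t)"
      by (rule has_derivative_compose[OF _ diff, of "\<lambda>t. x + t *\<^sub>R b"]) (auto intro!: derivative_eq_intros)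
    moreover have "linear (frechet_derivative f (at (x + t *\<^sub>R b)))"
      using diff by (rule has_derivative_linear)
    ultimately show ?thesis
      by (simp add: has_vector_derivative_def linear_scale)
  qed
  have contf: "continuous_on UNIV f"
    using schwartz_continuous[OF f, of "[]"] by simp
  have [measurable]: "f \<in> borel_measurable borel"
    using contf by (rule borel_measurable_continuous_onI)
  have [measurable]: "pds [b] f \<in> borel_measurable borel"
    using schwartz_continuous[OF f, of "[b]"] b by (intro borel_measurable_continuous_onI) simp
  have intf: "integrable lborel f"
    using schwartz_imp_Xi[OF f, of 0] by (simp add: Xi_def)
  have cis_int: "integrable lborel (\<lambda>x. cis (- (x \<bullet> \<omega>)) * g x)" if "integrable lborel g" for g :: "'a \<Rightarrow> complex"
    using that by (rule integrable_cis_mult[rotated]) measurable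
  define n where "n = 2 * DIM('a)"
  obtain B where B: "B > 0" "\<And>x. (1 + norm x) ^ n * norm (pds [b] f x) \<le> B"
    using schwartz_bound[OF f, of "[b]" n] b by auto
  \<comment> \<open>On the segment from \<open>x\<close> to \<open>x + b\<close> the weight changes
    by at most a factor 2, since \<open>1 + norm x \<le> 2 * (1 + norm (x + t *\<^sub>R b))\<close>;
    this explains \<open>2 ^ n\<close>. The steps \<open>h m \<le> 1\<close> keep the mean value
    estimate on that segment, and \<open>n = 2 * DIM('a)\<close> makes \<open>D\<close>
    integrable.\<close>
  define D where "D x = B * 2 ^ n * inverse ((1 + norm x) ^ n)" for x :: 'a
  have D: "integrable lborel D"
  proof (rule integrable_rapid_decay[where B="B * 2 ^ n"])
    show "D \<in> borel_measurable borel"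
      unfolding D_def by measurable
    fix x :: 'a
    have "1 + norm x > 0"
      by (simp add: add_pos_nonneg)
    then show "(1 + norm x) ^ (2 * DIM('a)) * norm (D x) \<le> B * 2 ^ n"
      using B(1) by (simp add: D_def abs_mult n_def)
  qed
  have bound: "norm (pds [b] f (x + t *\<^sub>R b)) \<le> D x" if t: "0 \<le> t" "t \<le> 1" for x t
  proof -
    have "norm x \<le> norm (x + t *\<^sub>R b) + norm (t *\<^sub>R b)"
      by (metis add_diff_cancel norm_triangle_ineq4)
    also have "norm (t *\<^sub>R b) \<le> 1"
      using t b by simp
    finally have "1 + norm x \<le> 2 * (1 + norm (x + t *\<^sub>R b))"
      by (smt (verit) norm_ge_zero)
    then have "(1 + norm x) ^ n \<le> (2 * (1 + norm (x + t *\<^sub>R b))) ^ n"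
      by (intro power_mono) auto
    then have "(1 + norm x) ^ n * norm (pds [b] f (x + t *\<^sub>R b)) \<le>
      2 ^ n * ((1 + norm (x + t *\<^sub>R b)) ^ n * norm (pds [b] f (x + t *\<^sub>R b)))"
      unfolding power_mult_distrib mult.assoc[symmetric] by (intro mult_right_mono) auto
    also have "\<dots> \<le> 2 ^ n * B"
      using B(2) by (intro mult_left_mono) auto
    finally show ?thesis
      by (simp add: D_def field_simps add_pos_nonneg)
  qed
  define q where "q m x = (f (x + h m *\<^sub>R b) - f x) /\<^sub>R h m" for m x
  have q_bound: "norm (q m x) \<le> D x" for m x
  proof -
    have "norm (f (x + h m *\<^sub>R b) - f (x + 0 *\<^sub>R b)) \<le> D x * norm (h m - 0)"
    proof (rule differentiable_bound[where S="{0..1}"])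
      show "((\<lambda>t. f (x + t *\<^sub>R b)) has_derivative (\<lambda>h. h *\<^sub>R pds [b] f (x + t *\<^sub>R b))) (at t within {0..1})" for t
        using line[of x t] by (auto simp: has_vector_derivative_def intro: has_derivative_at_withinI)
      show "onorm (\<lambda>h. h *\<^sub>R pds [b] f (x + t *\<^sub>R b)) \<le> D x" if "t \<in> {0..1}" for t
        using bound[of t x] that
        by (intro onorm_le) (simp add: mult.commute[of "D x"] mult_left_mono del: pds.simps)
    qed (use h in \<open>auto simp: less_imp_le\<close>)
    moreover have "norm (q m x) = norm (f (x + h m *\<^sub>R b) - f x) / h m"
      using h(1)[of m] by (simp add: q_def divide_inverse mult.commute)
    ultimately show ?thesis
      using h(1)[of m] by (simp add: pos_divide_le_eq)
  qed
  have q_lim: "(\<lambda>m. q m x) \<longlonglongrightarrow> pds [b] f x" for x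
  proof -
    have "(\<lambda>m. (f (x + h m *\<^sub>R b) - f (x + 0 *\<^sub>R b)) /\<^sub>R h m) \<longlonglongrightarrow> pds [b] f (x + 0 *\<^sub>R b)"
      using h by (intro difference_quotient_LIMSEQ[OF line]) (auto simp: less_imp_neq[symmetric])
    then show ?thesis
      by (simp add: q_def)
  qed
  have "(\<lambda>m. I (q m)) \<longlonglongrightarrow> I (pds [b] f)"
    unfolding I_def
  proof (rule integral_dominated_convergence[OF _ _ D])
    show "(\<lambda>x. cis (- (x \<bullet> \<omega>)) * pds [b] f x) \<in> borel_measurable lborel"
      "(\<lambda>x. cis (- (x \<bullet> \<omega>)) * q m x) \<in> borel_measurable lborel" for m
      unfolding q_def by measurable
    show "AE x in lborel. (\<lambda>m. cis (- (x \<bullet> \<omega>)) * q m x) \<longlonglongrightarrow> cis (- (x \<bullet> \<omega>)) * pds [b] f x"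
      by (intro AE_I2 tendsto_intros q_lim)
    show "AE x in lborel. norm (cis (- (x \<bullet> \<omega>)) * q m x) \<le> D x" for m
      using q_bound by (simp add: norm_mult)
  qed
  moreover have "I (q m) = ((cis (h m * (\<omega> \<bullet> b)) - 1) /\<^sub>R h m) * I f" for m
  proof -
    have shift: "I (\<lambda>x. f (x + h m *\<^sub>R b)) = cis (h m * (\<omega> \<bullet> b)) * I f"
    proof -
      have "I (\<lambda>x. f (x + h m *\<^sub>R b)) =
        (\<integral>x. cis (h m * (\<omega> \<bullet> b)) * (cis (- ((x - (- (h m *\<^sub>R b))) \<bullet> \<omega>)) * f (x - (- (h m *\<^sub>R b)))) \<partial>lborel)"
        unfolding I_def by (simp add: cis_mult inner_add_left inner_commute[of \<omega>] flip: mult.assoc)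
      also have "\<dots> = cis (h m * (\<omega> \<bullet> b)) * I f"
        unfolding I_def
        using lborel_integral_shift[of "\<lambda>x. cis (- (x \<bullet> \<omega>)) * f x" "- (h m *\<^sub>R b)"] by simp
      finally show ?thesis .
    qed
    have int1: "integrable lborel (\<lambda>x. f (x + h m *\<^sub>R b))"
      using lborel_integrable_shift[OF intf, of "- (h m *\<^sub>R b)"] by simp
    have "I (q m) = (\<integral>x. (cis (- (x \<bullet> \<omega>)) * f (x + h m *\<^sub>R b) - cis (- (x \<bullet> \<omega>)) * f x) /\<^sub>R h m \<partial>lborel)"
      unfolding I_def q_def by (simp add: algebra_simps)
    also have "\<dots> = (I (\<lambda>x. f (x + h m *\<^sub>R b)) - I f) /\<^sub>R h m"
      unfolding I_def using cis_int[OF int1] cis_int[OF intf] by simp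
    finally show ?thesis
      by (simp add: shift algebra_simps)
  qed
  moreover have "(\<lambda>m. ((cis (h m * (\<omega> \<bullet> b)) - 1) /\<^sub>R h m) * I f) \<longlonglongrightarrow> (\<i> * complex_of_real (\<omega> \<bullet> b)) * I f"
  proof (intro tendsto_mult tendsto_const)
    have "((\<lambda>t. cis (t * (\<omega> \<bullet> b))) has_vector_derivative \<i> * complex_of_real (\<omega> \<bullet> b)) (at 0)"
      unfolding has_vector_derivative_def
      by (auto intro!: derivative_eq_intros simp: scaleR_conv_of_real algebra_simps)
    then have "(\<lambda>m. (cis (h m * (\<omega> \<bullet> b)) - cis (0 * (\<omega> \<bullet> b))) /\<^sub>R h m) \<longlonglongrightarrow> \<i> * complex_of_real (\<omega> \<bullet> b)"
      using h by (intro difference_quotient_LIMSEQ) (auto simp: less_imp_neq[symmetric])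
    then show "(\<lambda>m. (cis (h m * (\<omega> \<bullet> b)) - 1) /\<^sub>R h m) \<longlonglongrightarrow> \<i> * complex_of_real (\<omega> \<bullet> b)"
      by simp
  qed
  ultimately have "I (pds [b] f) = (\<i> * complex_of_real (\<omega> \<bullet> b)) * I f"
    using LIMSEQ_unique by simp
  then show ?thesis
    by (simp add: ift_def I_def)
qed

text \<open>Differentiating \<open>N\<close> times in one coordinate direction multiplies the
  transform by the \<open>N\<close>-th power of that frequency coordinate, up to a factor of modulus
  1, and the result is still bounded by an L1 norm. Pure derivatives suffice because the largest
  coordinate controls the norm.\<close>

lemma ift_schwartz_decay:
  fixes f :: "'a::euclidean_space \<Rightarrow> complex"
  assumes f: "schwartz f"
  obtains C where "\<And>\<omega>. (1 + norm \<omega>) ^ N * norm (ift f \<omega>) \<le> C"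
proof -
  have iter: "ift (pds (replicate m b) f) \<omega> = (\<i> * complex_of_real (\<omega> \<bullet> b)) ^ m * ift f \<omega>" if b: "b \<in> Basis" for m b \<omega>
  proof (induction m)
    case (Suc m)
    have "schwartz (pds (replicate m b) f)"
      using f b by (intro schwartz_pds) auto
    from ift_pds_Basis[OF this b, of \<omega>] show ?case
      using Suc by simp
  qed simp
  define K where "K b = (\<integral>x. norm (pds (replicate N b) f x) \<partial>lborel)" for b
  have K: "\<bar>\<omega> \<bullet> b\<bar> ^ N * norm (ift f \<omega>) \<le> K b" if "b \<in> Basis" for b \<omega>
    using norm_ift_le[of "pds (replicate N b) f" \<omega>] that
    by (simp add: iter K_def norm_mult norm_power)
  define K0 where "K0 = (\<integral>x. norm (f x) \<partial>lborel)"
  have "(1 + norm \<omega>) ^ N * norm (ift f \<omega>) \<le> (1 + real DIM('a)) ^ N * (K0 + (\<Sum>b\<in>Basis. K b))" for \<omega>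
  proof -
    \<comment> \<open>The largest coordinate, but at least 1, so that
      \<open>1 + norm \<omega> \<le> (1 + DIM('a)) * M\<close>. If \<open>M = 1\<close> the bound
      comes from \<open>K0\<close>, otherwise from one of the \<open>K b\<close>.\<close>
    define M where "M = Max (insert 1 ((\<lambda>b. \<bar>\<omega> \<bullet> b\<bar>) ` Basis))"
    have M: "1 \<le> M" "\<And>b. b \<in> Basis \<Longrightarrow> \<bar>\<omega> \<bullet> b\<bar> \<le> M" "M = 1 \<or> (\<exists>b\<in>Basis. M = \<bar>\<omega> \<bullet> b\<bar>)"
      using Max_in[of "insert 1 ((\<lambda>b. \<bar>\<omega> \<bullet> b\<bar>) ` Basis)"] unfolding M_def
      by (auto intro!: Max_ge simp del: Max_insert)
    have "norm \<omega> \<le> (\<Sum>b\<in>(Basis :: 'a set). M)"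
      using M(2) by (intro order_trans[OF norm_le_l1] sum_mono)
    then have "1 + norm \<omega> \<le> (1 + real DIM('a)) * M"
      using M(1) by (simp add: algebra_simps)
    then have "(1 + norm \<omega>) ^ N \<le> (1 + real DIM('a)) ^ N * M ^ N"
      unfolding power_mult_distrib[symmetric] by (intro power_mono) auto
    then have "(1 + norm \<omega>) ^ N * norm (ift f \<omega>) \<le> ((1 + real DIM('a)) ^ N * M ^ N) * norm (ift f \<omega>)"
      by (intro mult_right_mono) auto
    moreover have "M ^ N * norm (ift f \<omega>) \<le> K0 + (\<Sum>b\<in>Basis. K b)"
    proof -
      have K_nonneg: "0 \<le> K b" "0 \<le> K0" for b
        by (simp_all add: K_def K0_def)
      from M(3) show ?thesis
      proof
        assume "M = 1"
        then show ?thesis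
          using norm_ift_le[of f \<omega>] sum_nonneg[of Basis K] K_nonneg by (simp add: K0_def)
      next
        assume "\<exists>b\<in>Basis. M = \<bar>\<omega> \<bullet> b\<bar>"
        then obtain b where b: "b \<in> Basis" "M = \<bar>\<omega> \<bullet> b\<bar>"
          by blast
        have "K b \<le> (\<Sum>b\<in>Basis. K b)"
          using b K_nonneg by (intro member_le_sum) auto
        then show ?thesis
          using K[OF b(1), of \<omega>] K_nonneg b(2) by simp
      qed
    qed
    moreover from this have "(1 + real DIM('a)) ^ N * (M ^ N * norm (ift f \<omega>)) \<le> (1 + real DIM('a)) ^ N * (K0 + (\<Sum>b\<in>Basis. K b))"
      by (intro mult_left_mono) auto
    ultimately show ?thesis
      unfolding mult.assoc by linarith
  qed
  then show thesis
    by (rule that)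
qed

section \<open>Density of the Schwartz functions\<close>

abbreviation cgauss :: "real \<Rightarrow> 'a::euclidean_space \<Rightarrow> complex" where
  "cgauss s \<equiv> \<lambda>x. complex_of_real (gauss s x)"

definition inv_Suc :: "nat \<Rightarrow> real" where
  "inv_Suc n = inverse (real (Suc n))"

lemma inv_Suc_pos [simp]: "inv_Suc n > 0"
  by (simp add: inv_Suc_def)

lemma inv_Suc_LIMSEQ: "inv_Suc \<longlonglongrightarrow> 0"
  unfolding inv_Suc_def by (rule LIMSEQ_inverse_real_of_nat)

text \<open>Uniform continuity for small \<open>z\<close> and boundedness for large \<open>z\<close>
  combine into the single estimate
  \<open>norm (F (x - z) - F x) \<le> e / 2 + K * (norm z)\<^sup>2\<close>. Integrated against a
  Gaussian of mass 1 it gives \<open>e / 2 + K * (DIM('a) * s\<^sup>2)\<close>, independently of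
  \<open>x\<close>.\<close>

lemma uniform_limit_wconv_gauss:
  fixes F :: "'a::euclidean_space \<Rightarrow> complex"
  assumes F: "continuous_on UNIV F" "(F \<longlongrightarrow> 0) at_infinity"
  shows "uniform_limit UNIV (\<lambda>n. wconv lborel (cgauss (inv_Suc n)) F) F sequentially"
proof (rule uniform_limitI)
  fix e :: real assume "e > 0"
  obtain d where d: "d > 0" "\<And>x z. norm (x - z) < d \<Longrightarrow> norm (F x - F z) < e / 2"
    using C0_uniformly_continuous[OF F, of "e / 2"] \<open>e > 0\<close> by auto
  obtain B where B: "B > 0" "\<And>x. norm (F x) \<le> B"
    using C0_bounded[OF F] unfolding bounded_pos by auto
  have [measurable]: "F \<in> borel_measurable borel"
    using F(1) by (rule borel_measurable_continuous_onI)
  \<comment> \<open>From \<open>norm z = d\<close> on, the quadratic term exceeds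
    \<open>2 * B\<close>, the trivial bound for the oscillation.\<close>
  define K where "K = 2 * B / d\<^sup>2"
  have osc: "norm (F (x - z) - F x) \<le> e / 2 + K * (norm z)\<^sup>2" for x z
  proof (cases "norm z < d")
    case True
    then have "norm (F (x - z) - F x) < e / 2"
      using d(2)[of "x - z" x] by simp
    moreover have "0 \<le> K * (norm z)\<^sup>2"
      using B by (simp add: K_def)
    ultimately show ?thesis
      by linarith
  next
    case False
    then have "d\<^sup>2 \<le> (norm z)\<^sup>2"
      using d(1) by (intro power_mono) auto
    then have "2 * B \<le> K * (norm z)\<^sup>2"
      using B d by (simp add: K_def field_simps)
    moreover have "norm (F (x - z) - F x) \<le> 2 * B"
      using norm_triangle_ineq4[of "F (x - z)" "F x"] B(2)[of "x - z"] B(2)[of x] by linarith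
    ultimately show ?thesis
      using \<open>e > 0\<close> by linarith
  qed
  have est: "norm (wconv lborel (cgauss s) F x - F x) \<le> e / 2 + K * (DIM('a) * s\<^sup>2)" if s: "s > 0" for s :: real and x
  proof -
    have int: "integrable lborel (\<lambda>z. cgauss s z * F (x - z))"
      using B s by (intro wconv_integrable) auto
    have int': "integrable lborel (\<lambda>z. cgauss s z * F x)"
      using s by simp
    have "wconv lborel (cgauss s) F x - F x =
      (\<integral>z. cgauss s z * F (x - z) \<partial>lborel) - (\<integral>z. cgauss s (z :: 'a) * F x \<partial>lborel)"
      using s by (simp add: wconv_def)
    also have "\<dots> = (\<integral>z. cgauss s z * (F (x - z) - F x) \<partial>lborel)"
      unfolding right_diff_distrib by (rule Bochner_Integration.integral_diff[OF int int', symmetric])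
    also have "norm \<dots> \<le> (\<integral>z. norm (cgauss s z * (F (x - z) - F x)) \<partial>lborel)"
      by (rule integral_norm_bound)
    also have "\<dots> \<le> (\<integral>z. e / 2 * gauss s (z :: 'a) + K * (gauss s z * (norm z)\<^sup>2) \<partial>lborel)"
    proof (rule integral_mono)
      show "integrable lborel (\<lambda>z. norm (cgauss s z * (F (x - z) - F x)))"
        unfolding right_diff_distrib using int int' by (intro integrable_norm Bochner_Integration.integrable_diff)
      show "integrable lborel (\<lambda>z :: 'a. e / 2 * gauss s z + K * (gauss s z * (norm z)\<^sup>2))"
        using s gauss_second_moment(1)[OF s, where 'a='a] by simp
      show "norm (cgauss s z * (F (x - z) - F x)) \<le> e / 2 * gauss s z + K * (gauss s z * (norm z)\<^sup>2)" for z
        using mult_left_mono[OF osc[of x z] gauss_nonneg[OF s, of z]] s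
        unfolding norm_mult by (simp add: distrib_left mult_ac)
    qed
    also have "\<dots> = e / 2 + K * (DIM('a) * s\<^sup>2)"
      using s gauss_second_moment[OF s, where 'a='a] by simp
    finally show ?thesis .
  qed
  have "(\<lambda>n. e / 2 + K * (DIM('a) * (inv_Suc n)\<^sup>2)) \<longlonglongrightarrow> e / 2 + K * (real DIM('a) * 0\<^sup>2)"
    by (intro tendsto_intros inv_Suc_LIMSEQ)
  then have "\<forall>\<^sub>F n in sequentially. e / 2 + K * (DIM('a) * (inv_Suc n)\<^sup>2) < e"
    by (rule order_tendstoD(2)) (use \<open>e > 0\<close> in simp)
  then show "\<forall>\<^sub>F n in sequentially. \<forall>x\<in>UNIV. dist (wconv lborel (cgauss (inv_Suc n)) F x) (F x) < e"
    by eventually_elim (use est[OF inv_Suc_pos] in \<open>auto simp: dist_norm intro: le_less_trans\<close>)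
qed

lemma wconv_gauss_LIMSEQ:
  fixes F :: "'a::euclidean_space \<Rightarrow> complex"
  assumes F: "continuous_on UNIV F" "(F \<longlongrightarrow> 0) at_infinity"
  shows "(\<lambda>n. wconv lborel (cgauss (inv_Suc n)) F x) \<longlonglongrightarrow> F x"
  using uniform_limit_wconv_gauss[OF assms] by (rule tendsto_uniform_limitI) simp

lemma Xi_wconv_gauss:
  assumes "f \<in> Xi k" "s > 0"
  shows "wconv lborel (cgauss s) f \<in> Xi k"
  using assms by (intro Xi_wconv sigma_finite_lborel) auto

text \<open>The derivatives converge uniformly, being mollified derivatives of \<open>f\<close>. For
  the L1 term, Scheffe's lemma needs only pointwise convergence and the fact that a Gaussian of mass
  1 does not increase the L1 norm; it takes the place of continuity of translations in L1.\<close>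

lemma xi_norm_wconv_gauss_tendsto:
  fixes f :: "'a::euclidean_space \<Rightarrow> complex"
  assumes f: "f \<in> Xi k"
  shows "(\<lambda>n. xi_norm k (\<lambda>x. wconv lborel (cgauss (inv_Suc n)) f x - f x)) \<longlonglongrightarrow> 0"
proof -
  let ?G = "\<lambda>n. cgauss (inv_Suc n) :: 'a \<Rightarrow> complex"
  let ?f = "\<lambda>n. wconv lborel (?G n) f"
  have C: "C0k k f" and int: "integrable lborel f"
    using f by (auto simp: Xi_def)
  have fn: "?f n \<in> Xi k" for n
    using f by (simp add: Xi_wconv_gauss)
  then have intn: "integrable lborel (?f n)" for n
    by (simp add: Xi_def)
  define I where "I n = (\<integral>x. norm (?f n x - f x) \<partial>lborel)" for n
  have C0: "continuous_on UNIV f" "(f \<longlongrightarrow> 0) at_infinity"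
    using C Ck_continuous[of k f "[]"] Nil_in_multi_idx[of k] unfolding C0k_def
    by (auto dest: bspec[of _ _ "[]"])
  have "(\<lambda>n. \<integral>\<^sup>+ x. norm (?f n x - f x) \<partial>lborel) \<longlonglongrightarrow> 0"
  proof (rule Scheffe_lemma2)
    show "?f n \<in> borel_measurable lborel" for n
      using intn by auto
    show "AE x in lborel. (\<lambda>n. ?f n x) \<longlonglongrightarrow> f x"
      by (intro AE_I2 wconv_gauss_LIMSEQ C0)
    have "(\<integral>x. norm (?f n x) \<partial>lborel) \<le> (\<integral>z. norm (?G n z) \<partial>lborel) * (\<integral>x. norm (f x) \<partial>lborel)" for n
      using int by (intro integral_norm_wconv_le sigma_finite_lborel) auto
    then show "(\<integral>\<^sup>+ x. norm (?f n x) \<partial>lborel) \<le> (\<integral>\<^sup>+ x. norm (f x) \<partial>lborel)" for n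
      using int intn[of n] by (simp add: nn_integral_eq_integral ennreal_leI)
  qed fact
  then have "(\<lambda>n. ennreal (I n)) \<longlonglongrightarrow> ennreal 0"
    using int intn by (simp add: nn_integral_eq_integral I_def)
  then have I: "I \<longlonglongrightarrow> 0"
    by (subst (asm) tendsto_ennreal_iff) (auto simp: I_def)
  have "\<forall>\<^sub>F n in sequentially. norm (xi_norm k (\<lambda>x. ?f n x - f x)) < e" if "e > 0" for e
  proof -
    have "\<forall>\<^sub>F n in sequentially. \<forall>x. dist (wconv lborel (?G n) (pds bs f) x) (pds bs f x) < e / 3"
      if "bs \<in> multi_idx k" for bs
      using uniform_limitD[OF uniform_limit_wconv_gauss[of "pds bs f"], of "e / 3"] C that \<open>e > 0\<close>
      by (auto simp: C0k_def Ck_continuous)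
    then have "\<forall>\<^sub>F n in sequentially. \<forall>bs\<in>multi_idx k. \<forall>x. dist (wconv lborel (?G n) (pds bs f) x) (pds bs f x) < e / 3"
      by (intro eventually_ball_finite) auto
    moreover have "\<forall>\<^sub>F n in sequentially. I n < e / 3"
      using I \<open>e > 0\<close> by (intro order_tendstoD(2)) auto
    ultimately show ?thesis
    proof eventually_elim
      case (elim n)
      have "xi_norm k (\<lambda>x. ?f n x - f x) \<le> e / 3 + I n"
        unfolding I_def
      proof (rule xi_norm_le)
        fix bs :: "'a list" and x assume bs: "bs \<in> multi_idx k"
        have "pds bs (\<lambda>x. ?f n x - f x) x = pds bs (?f n) x - pds bs f x"
          using fn[of n] C bs by (intro pds_diff[of k]) (auto simp: Xi_def C0k_def)
        also have "pds bs (?f n) = wconv lborel (?G n) (pds bs f)"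
          using C bs by (intro C0k_wconv(2)) auto
        finally show "norm (pds bs (\<lambda>x. ?f n x - f x) x) \<le> e / 3"
          using elim bs by (auto simp: dist_norm intro: less_imp_le)
      qed
      then show ?case
        using elim xi_norm_nonneg[OF Xi_diff[OF fn[of n] f]] \<open>e > 0\<close> by simp
    qed
  qed
  then show ?thesis
    by (simp add: tendsto_iff)
qed

text \<open>Young's inequality, with the same factor for the supremum part and for the L1 part. It
  is applied to a weight that is small in L1 and a fixed Gaussian \<open>F\<close>.\<close>

lemma xi_norm_wconv_le:
  assumes N: "sigma_finite_measure N" "sets N = sets borel" "integrable N w" and F: "F \<in> Xi k"
  shows "xi_norm k (wconv N w F) \<le> (\<integral>z. norm (w z) \<partial>N) * xi_norm k F"
proof -
  let ?W = "\<integral>z. norm (w z) \<partial>N" and ?I = "\<integral>x. norm (F x) \<partial>lborel"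
  have C: "C0k k F" and int: "integrable lborel F"
    using F by (auto simp: Xi_def)
  have "xi_norm k (wconv N w F) \<le> ?W * (xi_norm k F - ?I) + (\<integral>x. norm (wconv N w F x) \<partial>lborel)"
  proof (rule xi_norm_le)
    fix bs :: "'a list" and x assume bs: "bs \<in> multi_idx k"
    have "pds bs F \<in> borel_measurable borel"
      using C bs by (intro borel_measurable_continuous_onI) (auto simp: C0k_def Ck_continuous)
    then have "norm (wconv N w (pds bs F) x) \<le> ?W * (xi_norm k F - ?I)"
      using xi_norm_ge[OF F bs] by (intro norm_wconv_le N) (auto simp: algebra_simps)
    then show "norm (pds bs (wconv N w F) x) \<le> ?W * (xi_norm k F - ?I)"
      by (simp add: C0k_wconv(2)[OF N(2,3) C bs])
  qed
  also have "\<dots> \<le> ?W * (xi_norm k F - ?I) + ?W * ?I"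
    using integral_norm_wconv_le[OF N int] by simp
  finally show ?thesis
    by (simp add: algebra_simps)
qed

section \<open>Truncation to balls\<close>

definition truncate_ball :: "nat \<Rightarrow> ('a::euclidean_space \<Rightarrow> complex) \<Rightarrow> 'a \<Rightarrow> complex" where
  "truncate_ball n f x = indicator (cball 0 (real n)) x * f x"

lemma norm_truncate_ball_le: "norm (truncate_ball n f x) \<le> norm (f x)"
  by (simp add: truncate_ball_def indicator_def)

lemma truncate_ball_LIMSEQ: "(\<lambda>n. truncate_ball n f x) \<longlonglongrightarrow> f x"
proof (rule tendsto_eventually)
  have "truncate_ball n f x = f x" if "n \<ge> nat \<lceil>norm x\<rceil>" for n
  proof -
    have "norm x \<le> real n"
      using that by linarith
    then show ?thesis
      by (simp add: truncate_ball_def)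
  qed
  then show "\<forall>\<^sub>F n in sequentially. truncate_ball n f x = f x"
    unfolding eventually_sequentially by blast
qed

lemma borel_measurable_truncate_ball [measurable]:
  fixes f :: "'a::euclidean_space \<Rightarrow> complex"
  assumes [measurable]: "f \<in> borel_measurable borel"
  shows "truncate_ball n f \<in> borel_measurable borel"
proof -
  have [measurable]: "cball 0 (real n) \<in> sets (borel :: 'a measure)"
    by simp
  show ?thesis
    unfolding truncate_ball_def by measurable
qed

lemma integrable_truncate_ball:
  assumes "integrable lborel f"
  shows "integrable lborel (truncate_ball n f)"
  using borel_measurable_integrable[OF assms]
  by (intro Bochner_Integration.integrable_bound[OF assms]) (auto simp: norm_truncate_ball_le)

lemma integral_truncate_ball_diff_LIMSEQ:
  assumes f: "integrable lborel f"
  shows "(\<lambda>n. \<integral>x. norm (truncate_ball n f x - f x) \<partial>lborel) \<longlonglongrightarrow> 0"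
proof -
  have [measurable]: "f \<in> borel_measurable borel"
    using borel_measurable_integrable[OF f] by simp
  have "(\<lambda>n. \<integral>x. norm (truncate_ball n f x - f x) \<partial>lborel) \<longlonglongrightarrow> (\<integral>x. 0 \<partial>(lborel :: 'a measure))"
  proof (rule integral_dominated_convergence[where w="\<lambda>x. norm (f x)"])
    show "AE x in lborel. (\<lambda>n. norm (truncate_ball n f x - f x)) \<longlonglongrightarrow> 0"
      using truncate_ball_LIMSEQ[of f] by (auto simp: tendsto_norm_zero_iff LIM_zero_iff)
    show "AE x in lborel. norm (norm (truncate_ball n f x - f x)) \<le> norm (f x)" for n
      by (simp add: truncate_ball_def indicator_def)
  qed (use f in auto)
  then show ?thesis
    by simp
qed

text \<open>For \<open>norm z \<le> R'\<close> one has
  \<open>1 + norm x \<le> (1 + R') * (1 + norm (x - z))\<close>, so a polynomial weight in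
  \<open>x\<close> moves onto \<open>F\<close> at the cost of a constant. This is where the bounded
  support of \<open>w\<close> enters.\<close>

lemma schwartz_wconv:
  fixes w F :: "'a::euclidean_space \<Rightarrow> complex"
  assumes w: "integrable lborel w" and R: "\<And>z. w z \<noteq> 0 \<Longrightarrow> norm z \<le> R" and F: "schwartz F"
  shows "schwartz (wconv lborel w F)"
proof -
  have C: "C0k k F" for k
    using schwartz_imp_Xi[OF F, of k] by (simp add: Xi_def)
  have "bounded (range (\<lambda>x. (1 + norm x) ^ N *\<^sub>R pds bs (wconv lborel w F) x))" if bs: "set bs \<subseteq> Basis" for bs N
  proof -
    have idx: "bs \<in> multi_idx (length bs)"
      using bs by (simp add: multi_idx_def)
    obtain B where B: "B > 0" "\<And>x. (1 + norm x) ^ N * norm (pds bs F x) \<le> B"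
      using schwartz_bound[OF F bs] by metis
    have contF: "continuous_on UNIV (pds bs F)"
      by (rule schwartz_continuous[OF F bs])
    obtain B0 where B0: "\<And>x. norm (pds bs F x) \<le> B0"
      using C0k_pds_bounded[OF C idx] by metis
    have int: "integrable lborel (\<lambda>z. w z * pds bs F (x - z))" for x
      using w B0 contF by (intro wconv_integrable) (auto intro: borel_measurable_continuous_onI)
    \<comment> \<open>\<open>R\<close> may be negative when \<open>w\<close> vanishes
      identically.\<close>
    define R' where "R' = max R 0"
    have "norm ((1 + norm x) ^ N *\<^sub>R pds bs (wconv lborel w F) x) \<le> (\<integral>z. norm (w z) \<partial>lborel) * ((1 + R') ^ N * B)" for x
    proof -
      have "norm ((1 + norm x) ^ N *\<^sub>R pds bs (wconv lborel w F) x) =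
        norm (\<integral>z. (1 + norm x) ^ N *\<^sub>R (w z * pds bs F (x - z)) \<partial>lborel)"
        unfolding C0k_wconv(2)[OF _ w C idx, OF sets_lborel] by (simp add: wconv_def)
      also have "\<dots> \<le> (\<integral>z. norm ((1 + norm x) ^ N *\<^sub>R (w z * pds bs F (x - z))) \<partial>lborel)"
        by (rule integral_norm_bound)
      also have "\<dots> \<le> (\<integral>z. norm (w z) * ((1 + R') ^ N * B) \<partial>lborel)"
      proof (rule integral_mono)
        show "integrable lborel (\<lambda>z. norm ((1 + norm x) ^ N *\<^sub>R (w z * pds bs F (x - z))))"
          using int by (intro integrable_norm) simp
        show "integrable lborel (\<lambda>z. norm (w z) * ((1 + R') ^ N * B))"
          using w by simp
        fix z
        show "norm ((1 + norm x) ^ N *\<^sub>R (w z * pds bs F (x - z))) \<le> norm (w z) * ((1 + R') ^ N * B)"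
        proof (cases "w z = 0")
          case False
          then have "norm z \<le> R'"
            using R[OF False] by (simp add: R'_def)
          moreover have "norm x \<le> norm z + norm (x - z)"
            using norm_triangle_sub[of x z] by simp
          moreover have "0 \<le> R' * norm (x - z)"
            by (simp add: R'_def)
          ultimately have "1 + norm x \<le> (1 + R') * (1 + norm (x - z))"
            by (simp add: algebra_simps)
          then have "(1 + norm x) ^ N \<le> (1 + R') ^ N * (1 + norm (x - z)) ^ N"
            unfolding power_mult_distrib[symmetric] by (intro power_mono) auto
          then have "(1 + norm x) ^ N * norm (pds bs F (x - z)) \<le>
            ((1 + R') ^ N * (1 + norm (x - z)) ^ N) * norm (pds bs F (x - z))"
            by (intro mult_right_mono) auto
          also have "\<dots> = (1 + R') ^ N * ((1 + norm (x - z)) ^ N * norm (pds bs F (x - z)))"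
            by simp
          also have "\<dots> \<le> (1 + R') ^ N * B"
            using B(2) by (intro mult_left_mono) (auto simp: R'_def)
          finally have "norm (w z) * ((1 + norm x) ^ N * norm (pds bs F (x - z))) \<le> norm (w z) * ((1 + R') ^ N * B)"
            by (intro mult_left_mono) auto
          then show ?thesis
            by (simp add: norm_mult mult.left_commute)
        qed simp
      qed
      finally show ?thesis
        by simp
    qed
    then show ?thesis
      unfolding bounded_iff by blast
  qed
  moreover have "Ck k (wconv lborel w F)" for k
    using C0k_wconv(1)[OF sets_lborel w C, of k] by (simp add: C0k_def)
  ultimately show ?thesis
    by (simp add: schwartz_def)
qed

lemma schwartz_mollified_truncation:
  assumes "integrable lborel f" "s > 0"
  shows "schwartz (wconv lborel (truncate_ball n f) (cgauss s))"
proof (rule schwartz_wconv[where R="real n"])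
  show "integrable lborel (truncate_ball n f)"
    using assms by (simp add: integrable_truncate_ball)
  show "norm z \<le> real n" if "truncate_ball n f z \<noteq> 0" for z
    using that by (auto simp: truncate_ball_def indicator_def split: if_splits)
qed (use assms schwartz_gauss in auto)

text \<open>At a fixed width the error is again a convolution with the Gaussian, of weight
  \<open>truncate_ball n f z - f z\<close>. Its norm is at most the L1 norm of this weight times a
  constant, so integrability of \<open>f\<close> is enough although derivatives up to order
  \<open>k\<close> are compared.\<close>

lemma xi_norm_mollified_truncation_tendsto:
  fixes f :: "'a::euclidean_space \<Rightarrow> complex"
  assumes f: "integrable lborel f" and s: "s > 0"
  shows "(\<lambda>n. xi_norm k (\<lambda>x. wconv lborel (truncate_ball n f) (cgauss s) x - wconv lborel (cgauss s) f x)) \<longlonglongrightarrow> 0"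
proof -
  let ?g = "cgauss s :: 'a \<Rightarrow> complex"
  have g: "?g \<in> Xi k" for k
    using schwartz_imp_Xi[OF schwartz_gauss[OF s]] .
  have [measurable]: "f \<in> borel_measurable borel"
    using borel_measurable_integrable[OF f] by simp
  have int_n: "integrable lborel (truncate_ball n f)" for n
    using f by (rule integrable_truncate_ball)
  have gmeas: "?g \<in> borel_measurable borel"
    by measurable
  obtain B where B: "\<And>x. norm (?g x) \<le> B"
    using C0k_pds_bounded[of 0 ?g "[]"] g[of 0] by (auto simp: Xi_def)
  have eq: "(\<lambda>x. wconv lborel (truncate_ball n f) ?g x - wconv lborel ?g f x) =
    wconv lborel (\<lambda>z. truncate_ball n f z - f z) ?g" for n
  proof
    fix x
    have "integrable lborel (\<lambda>z. truncate_ball n f z * ?g (x - z))" "integrable lborel (\<lambda>z. f z * ?g (x - z))"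
      using f int_n B by (auto intro!: wconv_integrable[OF _ _ gmeas])
    moreover have "wconv lborel ?g f = wconv lborel f ?g"
      by (rule wconv_commute) measurable
    ultimately show "wconv lborel (truncate_ball n f) ?g x - wconv lborel ?g f x =
      wconv lborel (\<lambda>z. truncate_ball n f z - f z) ?g x"
      by (simp add: wconv_def left_diff_distrib)
  qed
  have le: "xi_norm k (wconv lborel (\<lambda>z. truncate_ball n f z - f z) ?g) \<le>
    (\<integral>x. norm (truncate_ball n f x - f x) \<partial>lborel) * xi_norm k ?g" for n
    using f int_n g by (intro xi_norm_wconv_le sigma_finite_lborel) auto
  have nonneg: "0 \<le> xi_norm k (wconv lborel (\<lambda>z. truncate_ball n f z - f z) ?g)" for n
    using f int_n g by (intro xi_norm_nonneg Xi_wconv sigma_finite_lborel) auto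
  have "(\<lambda>n. (\<integral>x. norm (truncate_ball n f x - f x) \<partial>lborel) * xi_norm k ?g) \<longlonglongrightarrow> 0 * xi_norm k ?g"
    by (intro tendsto_intros integral_truncate_ball_diff_LIMSEQ f)
  then show ?thesis
    unfolding eq
    by (intro tendsto_sandwich[OF always_eventually[OF allI[OF nonneg]] always_eventually[OF allI[OF le]] tendsto_const])
      simp
qed

text \<open>The width is fixed before the radius: the truncation error is estimated through
  \<open>xi_norm\<close> of the Gaussian, which blows up as the width tends to 0.\<close>

lemma schwartz_dense_Xi:
  fixes f :: "'a::euclidean_space \<Rightarrow> complex"
  assumes f: "f \<in> Xi k" and "e > 0"
  obtains h where "schwartz h" "xi_norm k (\<lambda>x. h x - f x) < e"
proof -
  have int: "integrable lborel f"
    using f by (simp add: Xi_def)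
  have "\<forall>\<^sub>F n in sequentially. xi_norm k (\<lambda>x. wconv lborel (cgauss (inv_Suc n)) f x - f x) < e / 2"
    using xi_norm_wconv_gauss_tendsto[OF f] \<open>e > 0\<close> by (intro order_tendstoD(2)) auto
  then obtain n where n: "xi_norm k (\<lambda>x. wconv lborel (cgauss (inv_Suc n)) f x - f x) < e / 2"
    by (auto simp: eventually_sequentially)
  define f1 where "f1 = wconv lborel (cgauss (inv_Suc n)) f"
  define h where "h m = wconv lborel (truncate_ball m f) (cgauss (inv_Suc n))" for m
  have "\<forall>\<^sub>F m in sequentially. xi_norm k (\<lambda>x. h m x - f1 x) < e / 2"
    unfolding h_def f1_def
    using xi_norm_mollified_truncation_tendsto[OF int, of "inv_Suc n" k] \<open>e > 0\<close> by (intro order_tendstoD(2)) auto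
  then obtain m where m: "xi_norm k (\<lambda>x. h m x - f1 x) < e / 2"
    by (auto simp: eventually_sequentially)
  have h: "schwartz (h m)"
    unfolding h_def by (intro schwartz_mollified_truncation int) simp
  have "f1 \<in> Xi k" "h m \<in> Xi k"
    using Xi_wconv_gauss[OF f, of "inv_Suc n"] schwartz_imp_Xi[OF h] by (auto simp: f1_def)
  then have "xi_norm k (\<lambda>x. h m x - f x) \<le> xi_norm k (\<lambda>x. h m x - f1 x) + xi_norm k (\<lambda>x. f1 x - f x)"
    using xi_norm_lincomb[of "\<lambda>x. h m x - f1 x" k "\<lambda>x. f1 x - f x" 1 1] f by (simp add: Xi_diff)
  then show thesis
    using that[OF h] m n by (simp add: f1_def)
qed

section \<open>Fourier transforms of the approximants\<close>

lemma borel_measurable_ift: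
  fixes f :: "'a::euclidean_space \<Rightarrow> complex"
  assumes [measurable]: "f \<in> borel_measurable borel"
  shows "ift f \<in> borel_measurable borel"
  unfolding ift_def by measurable

lemma borel_measurable_ft:
  fixes f :: "'a::euclidean_space \<Rightarrow> complex"
  assumes [measurable]: "f \<in> borel_measurable borel"
  shows "ft f \<in> borel_measurable borel"
  unfolding ft_def by measurable

lemma borel_measurable_char_fn:
  fixes V :: "'s \<Rightarrow> 'a::euclidean_space"
  assumes "prob_space M" and [measurable]: "V \<in> borel_measurable M"
  shows "char_fn M V \<in> borel_measurable borel"
proof -
  interpret prob_space M by fact
  show ?thesis
    unfolding char_fn_def by measurable
qed

lemma ift_lincomb:
  fixes f g :: "'a::euclidean_space \<Rightarrow> complex"
  assumes "integrable lborel f" "integrable lborel g"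
  shows "ift (\<lambda>x. a * f x + b * g x) \<omega> = a * ift f \<omega> + b * ift g \<omega>"
proof -
  have int: "integrable lborel (\<lambda>x. cis (- (x \<bullet> \<omega>)) * f x)" "integrable lborel (\<lambda>x. cis (- (x \<bullet> \<omega>)) * g x)"
    using assms by (auto intro!: integrable_cis_mult)
  have "(\<integral>x. cis (- (x \<bullet> \<omega>)) * (a * f x + b * g x) \<partial>lborel) =
    (\<integral>x. a * (cis (- (x \<bullet> \<omega>)) * f x) + b * (cis (- (x \<bullet> \<omega>)) * g x) \<partial>lborel)"
    by (simp add: algebra_simps)
  also have "\<dots> = a * (\<integral>x. cis (- (x \<bullet> \<omega>)) * f x \<partial>lborel) + b * (\<integral>x. cis (- (x \<bullet> \<omega>)) * g x \<partial>lborel)"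
    using int by simp
  finally show ?thesis
    by (simp add: ift_def algebra_simps)
qed

text \<open>The polynomial weight moves from \<open>Q\<close> to \<open>h\<close>. This makes the
  pairings of \<open>Q\<close> with \<open>gauss_ft\<close> and with transforms of Schwartz
  functions absolutely convergent, so the default value 0 of a divergent integral never
  enters.\<close>

lemma integrable_mult_rapid:
  fixes Q h :: "'a::euclidean_space \<Rightarrow> complex"
  assumes [measurable]: "Q \<in> borel_measurable borel" "h \<in> borel_measurable borel"
    and Q: "integrable lborel (\<lambda>\<omega>. norm (Q \<omega>) / (1 + norm \<omega>) ^ N)"
    and C: "\<And>\<omega>. (1 + norm \<omega>) ^ N * norm (h \<omega>) \<le> C"
  shows "integrable lborel (\<lambda>\<omega>. Q \<omega> * h \<omega>)"
proof (rule Bochner_Integration.integrable_bound)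
  show "integrable lborel (\<lambda>\<omega>. C * (norm (Q \<omega>) / (1 + norm \<omega>) ^ N))"
    using Q by (rule integrable_mult_right)
  have "norm (Q \<omega> * h \<omega>) \<le> C * (norm (Q \<omega>) / (1 + norm \<omega>) ^ N)" for \<omega>
  proof -
    have pos: "1 + norm \<omega> > 0" "(1 + norm \<omega>) ^ N > 0"
      by (simp_all add: add_pos_nonneg)
    have "norm (Q \<omega> * h \<omega>) = norm (Q \<omega>) / (1 + norm \<omega>) ^ N * ((1 + norm \<omega>) ^ N * norm (h \<omega>))"
      using pos by (simp add: norm_mult)
    also have "\<dots> \<le> norm (Q \<omega>) / (1 + norm \<omega>) ^ N * C"
      using pos C by (intro mult_left_mono) auto
    finally show ?thesis
      by (simp add: mult.commute)
  qed
  then show "AE \<omega> in lborel. norm (Q \<omega> * h \<omega>) \<le> norm (C * (norm (Q \<omega>) / (1 + norm \<omega>) ^ N))"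
    unfolding real_norm_def by (intro AE_I2 order_trans[OF _ abs_ge_self])
qed measurable

lemma integrable_mult_ift_schwartz:
  fixes Q f :: "'a::euclidean_space \<Rightarrow> complex"
  assumes "Q \<in> borel_measurable borel" "integrable lborel (\<lambda>\<omega>. norm (Q \<omega>) / (1 + norm \<omega>) ^ N)"
    and f: "schwartz f"
  shows "integrable lborel (\<lambda>\<omega>. Q \<omega> * ift f \<omega>)"
proof -
  obtain C where C: "\<And>\<omega>. (1 + norm \<omega>) ^ N * norm (ift f \<omega>) \<le> C"
    using ift_schwartz_decay[OF f] by metis
  have "f \<in> borel_measurable borel"
    using schwartz_continuous[OF f, of "[]"] by (intro borel_measurable_continuous_onI) simp
  then show ?thesis
    by (intro integrable_mult_rapid[OF assms(1) borel_measurable_ift assms(2) C])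
qed

lemma inv_ft_reg_distr_lincomb:
  fixes Q f g :: "'a::euclidean_space \<Rightarrow> complex"
  assumes Q: "Q \<in> borel_measurable borel" "integrable lborel (\<lambda>\<omega>. norm (Q \<omega>) / (1 + norm \<omega>) ^ N)"
    and f: "schwartz f" and g: "schwartz g"
  shows "inv_ft_reg_distr Q (\<lambda>x. a * f x + b * g x) = a * inv_ft_reg_distr Q f + b * inv_ft_reg_distr Q g"
proof -
  have int: "integrable lborel f" "integrable lborel g"
    using schwartz_imp_Xi[OF f, of 0] schwartz_imp_Xi[OF g, of 0] by (auto simp: Xi_def)
  have "inv_ft_reg_distr Q (\<lambda>x. a * f x + b * g x) =
    (\<integral>\<omega>. a * (Q \<omega> * ift f \<omega>) + b * (Q \<omega> * ift g \<omega>) \<partial>lborel)"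
    unfolding inv_ft_reg_distr_def by (simp add: ift_lincomb[OF int] algebra_simps)
  then show ?thesis
    using integrable_mult_ift_schwartz[OF Q f] integrable_mult_ift_schwartz[OF Q g]
    by (simp add: inv_ft_reg_distr_def)
qed

text \<open>The Gaussian is made the weight because \<open>ift_wconv\<close> leaves the transform of
  the weight without the constant of \<open>ift\<close>; it is then exactly
  \<open>gauss_ft s\<close>.\<close>

lemma ift_wconv_gauss:
  fixes f :: "'a::euclidean_space \<Rightarrow> complex"
  assumes f: "integrable lborel f" and s: "s > 0"
  shows "ift (wconv lborel f (cgauss s)) \<omega> = complex_of_real (gauss_ft s \<omega>) * ift f \<omega>"
proof -
  have [measurable]: "f \<in> borel_measurable borel"
    using borel_measurable_integrable[OF f] by simp
  have "wconv lborel f (cgauss s) = wconv lborel (cgauss s) f"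
    by (rule wconv_commute) measurable
  moreover have "ift (wconv lborel (cgauss s) f) \<omega> = (\<integral>z. cgauss s z * cis (- (\<omega> \<bullet> z)) \<partial>lborel) * ift f \<omega>"
    using f s by (intro ift_wconv sigma_finite_lborel) auto
  moreover have "(\<integral>z. cgauss s z * cis (- (\<omega> \<bullet> z)) \<partial>lborel) = complex_of_real (gauss_ft s \<omega>)"
    using integral_cis_gauss[OF s, of "- \<omega>"] by (simp add: mult.commute gauss_ft_def)
  ultimately show ?thesis
    by simp
qed

lemma inv_ft_reg_distr_mollified_truncation_tendsto:
  fixes Q f :: "'a::euclidean_space \<Rightarrow> complex"
  assumes Q [measurable]: "Q \<in> borel_measurable borel"
    and Q': "integrable lborel (\<lambda>\<omega>. norm (Q \<omega>) / (1 + norm \<omega>) ^ N)"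
    and f: "integrable lborel f" and s: "s > 0"
  shows "(\<lambda>n. inv_ft_reg_distr Q (wconv lborel (truncate_ball n f) (cgauss s))) \<longlonglongrightarrow>
    (\<integral>\<omega>. Q \<omega> * (complex_of_real (gauss_ft s \<omega>) * ift f \<omega>) \<partial>lborel)"
  unfolding inv_ft_reg_distr_def ift_wconv_gauss[OF integrable_truncate_ball[OF f] s]
proof -
  let ?E = "\<lambda>\<omega> :: 'a. complex_of_real (gauss_ft s \<omega>)"
  let ?K = "\<integral>x. norm (f x) \<partial>lborel"
  have [measurable]: "f \<in> borel_measurable borel"
    using borel_measurable_integrable[OF f] by simp
  have ift_meas [measurable]: "ift f \<in> borel_measurable borel" "ift (truncate_ball n f) \<in> borel_measurable borel" for n
    by (intro borel_measurable_ift; measurable)+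
  have E_int: "integrable lborel (\<lambda>\<omega>. Q \<omega> * ?E \<omega>)"
    using s by (intro integrable_mult_rapid[OF Q _ Q', where C="exp ((N / s)\<^sup>2 / 2)"])
      (auto simp: gauss_ft_decay)
  show "(\<lambda>n. \<integral>\<omega>. Q \<omega> * (?E \<omega> * ift (truncate_ball n f) \<omega>) \<partial>lborel) \<longlonglongrightarrow> (\<integral>\<omega>. Q \<omega> * (?E \<omega> * ift f \<omega>) \<partial>lborel)"
  proof (rule integral_dominated_convergence[where w="\<lambda>\<omega>. norm (Q \<omega> * ?E \<omega>) * ?K"])
    show "integrable lborel (\<lambda>\<omega>. norm (Q \<omega> * ?E \<omega>) * ?K)"
      using E_int by simp
    have "(\<lambda>n. ift (truncate_ball n f) \<omega>) \<longlonglongrightarrow> ift f \<omega>" for \<omega>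
      unfolding ift_def
    proof (intro tendsto_mult tendsto_const integral_dominated_convergence[where w="\<lambda>x. norm (f x)"])
      show "AE x in lborel. (\<lambda>n. cis (- (x \<bullet> \<omega>)) * truncate_ball n f x) \<longlonglongrightarrow> cis (- (x \<bullet> \<omega>)) * f x"
        by (intro AE_I2 tendsto_intros truncate_ball_LIMSEQ)
      show "AE x in lborel. norm (cis (- (x \<bullet> \<omega>)) * truncate_ball n f x) \<le> norm (f x)" for n
        by (simp add: norm_mult norm_truncate_ball_le)
    qed (use f in auto)
    then show "AE \<omega> in lborel. (\<lambda>n. Q \<omega> * (?E \<omega> * ift (truncate_ball n f) \<omega>)) \<longlonglongrightarrow> Q \<omega> * (?E \<omega> * ift f \<omega>)"
      by (intro AE_I2 tendsto_intros)
    have "norm (ift (truncate_ball n f) \<omega>) \<le> ?K" for n \<omega>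
      using f by (intro order_trans[OF norm_ift_le] integral_mono integrable_norm integrable_truncate_ball)
        (auto simp: norm_truncate_ball_le)
    then show "AE \<omega> in lborel. norm (Q \<omega> * (?E \<omega> * ift (truncate_ball n f) \<omega>)) \<le> norm (Q \<omega> * ?E \<omega>) * ?K" for n
      unfolding mult.assoc[symmetric] norm_mult[of "Q _ * ?E _"] by (intro AE_I2 mult_left_mono) auto
  qed measurable
qed

lemma integrable_pair_product_bound:
  fixes h :: "'a \<times> 'b \<Rightarrow> complex" and f :: "'a \<Rightarrow> complex" and g :: "'b \<Rightarrow> complex"
  assumes "pair_sigma_finite A B" and h [measurable]: "h \<in> borel_measurable (A \<Otimes>\<^sub>M B)"
    and f: "integrable A f" and g: "integrable B g"
    and le: "\<And>x y. norm (h (x, y)) \<le> norm (f x) * norm (g y)"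
  shows "integrable (A \<Otimes>\<^sub>M B) h"
proof -
  interpret pair_sigma_finite A B by fact
  have [measurable]: "f \<in> borel_measurable A" "g \<in> borel_measurable B"
    using f g by auto
  have "integrable (A \<Otimes>\<^sub>M B) (\<lambda>p. f (fst p) * g (snd p))"
    by (rule Fubini_integrable) (use f g in \<open>auto simp: norm_mult\<close>)
  then show ?thesis
    by (rule Bochner_Integration.integrable_bound) (use le in \<open>auto simp: norm_mult\<close>)
qed

text \<open>Fubini moves the frequency integral onto \<open>gauss_ft\<close>, where inversion is
  explicit, and evenness of the Gaussian turns \<open>x - z\<close> into \<open>z - x\<close>. This
  is Fourier inversion in Gauss-Weierstrass summed form.\<close>

lemma integral_ft_mult_gauss:
  fixes f :: "'a::euclidean_space \<Rightarrow> complex"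
  assumes f: "integrable lborel f" and s: "s > 0"
  shows "(\<integral>\<omega>. ft f \<omega> * cis (- (\<omega> \<bullet> z)) * complex_of_real (gauss_ft s \<omega>) \<partial>lborel) =
    complex_of_real ((2 * pi) ^ DIM('a)) * wconv lborel (cgauss s) f z"
proof -
  let ?E = "\<lambda>\<omega> :: 'a. complex_of_real (gauss_ft s \<omega>)"
  have [measurable]: "f \<in> borel_measurable borel"
    using borel_measurable_integrable[OF f] by simp
  have E: "integrable lborel ?E"
    using integrable_gauss_ft[OF s, where 'a='a] by simp
  have "integrable (lborel \<Otimes>\<^sub>M lborel) (\<lambda>(x, \<omega>). f x * (cis ((x - z) \<bullet> \<omega>) * ?E \<omega>))"
    by (rule integrable_pair_product_bound[OF lborel_pair.pair_sigma_finite_axioms _ f E])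
      (simp_all add: norm_mult)
  then have "(\<integral>\<omega>. (\<integral>x. f x * (cis ((x - z) \<bullet> \<omega>) * ?E \<omega>) \<partial>lborel) \<partial>lborel) =
    (\<integral>x. (\<integral>\<omega>. f x * (cis ((x - z) \<bullet> \<omega>) * ?E \<omega>) \<partial>lborel) \<partial>lborel)"
    by (rule lborel_pair.Fubini_integral)
  also have "\<dots> = (\<integral>x. complex_of_real ((2 * pi) ^ DIM('a)) * (f x * cgauss s (z - x)) \<partial>lborel)"
    using s gauss_minus[of s "z - _"]
    by (simp add: integral_cis_gauss_ft mult.left_commute)
  also have "\<dots> = complex_of_real ((2 * pi) ^ DIM('a)) * wconv lborel f (cgauss s) z"
    unfolding wconv_def by (rule integral_mult_right_zero)
  also have "wconv lborel f (cgauss s) = wconv lborel (cgauss s) f"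
    by (rule wconv_commute) measurable
  also have "(\<integral>\<omega>. (\<integral>x. f x * (cis ((x - z) \<bullet> \<omega>) * ?E \<omega>) \<partial>lborel) \<partial>lborel) =
    (\<integral>\<omega>. ft f \<omega> * cis (- (\<omega> \<bullet> z)) * ?E \<omega> \<partial>lborel)"
  proof (rule Bochner_Integration.integral_cong)
    fix \<omega> :: 'a
    have "cis ((x - z) \<bullet> \<omega>) = cis (\<omega> \<bullet> x) * cis (- (\<omega> \<bullet> z))" for x
      by (simp add: cis_mult inner_diff_left inner_commute[of \<omega>])
    then have "f x * (cis ((x - z) \<bullet> \<omega>) * ?E \<omega>) = (cis (\<omega> \<bullet> x) * f x) * (cis (- (\<omega> \<bullet> z)) * ?E \<omega>)" for x
      by simp
    then show "(\<integral>x. f x * (cis ((x - z) \<bullet> \<omega>) * ?E \<omega>) \<partial>lborel) = ft f \<omega> * cis (- (\<omega> \<bullet> z)) * ?E \<omega>"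
      by (simp only: ft_def integral_mult_left_zero) simp
  qed simp
  finally show ?thesis .
qed

text \<open>\<open>ft f\<close> is bounded by the L1 norm of \<open>f\<close> and \<mu> is finite,
  so the Gaussian factor makes the double integral absolutely convergent. Fubini then reduces to a
  single character.\<close>

lemma integral_ft_mult_char_gauss:
  fixes f :: "'a::euclidean_space \<Rightarrow> complex"
  assumes \<mu>: "fin_borel \<mu>" and f: "integrable lborel f" and s: "s > 0"
  shows "(\<integral>\<omega>. ft f \<omega> * (\<integral>z. cis (- (\<omega> \<bullet> z)) \<partial>\<mu>) * complex_of_real (gauss_ft s \<omega>) \<partial>lborel) =
    complex_of_real ((2 * pi) ^ DIM('a)) * (\<integral>z. wconv lborel (cgauss s) f z \<partial>\<mu>)"
proof -
  let ?E = "\<lambda>\<omega> :: 'a. complex_of_real (gauss_ft s \<omega>)"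
  let ?K = "\<integral>x. norm (f x) \<partial>lborel"
  interpret finite_measure \<mu>
    using \<mu> by (simp add: fin_borel_def)
  have sets_\<mu> [measurable_cong]: "sets \<mu> = sets borel"
    using \<mu> by (simp add: fin_borel_def)
  interpret P: pair_sigma_finite lborel \<mu>
    by (intro pair_sigma_finite.intro sigma_finite_lborel) unfold_locales
  have [measurable]: "f \<in> borel_measurable borel"
    using borel_measurable_integrable[OF f] by simp
  have [measurable]: "ft f \<in> borel_measurable borel"
    by (rule borel_measurable_ft) measurable
  have ft_le: "norm (ft f \<omega>) \<le> ?K" for \<omega>
    unfolding ft_def by (rule order_trans[OF integral_norm_bound]) (simp add: norm_mult)
  have "integrable (lborel \<Otimes>\<^sub>M \<mu>) (\<lambda>(\<omega>, z). ft f \<omega> * cis (- (\<omega> \<bullet> z)) * ?E \<omega>)"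
  proof (rule integrable_pair_product_bound[OF P.pair_sigma_finite_axioms])
    show "integrable lborel (\<lambda>\<omega>. complex_of_real ?K * ?E \<omega>)"
      using integrable_gauss_ft[OF s, where 'a='a] by simp
    show "integrable \<mu> (\<lambda>_. 1 :: complex)"
      by simp
    show "norm (case (\<omega>, z) of (\<omega>, z) \<Rightarrow> ft f \<omega> * cis (- (\<omega> \<bullet> z)) * ?E \<omega>) \<le>
        norm (complex_of_real ?K * ?E \<omega>) * norm (1 :: complex)" for \<omega> z
      using ft_le[of \<omega>] by (simp add: norm_mult mult_right_mono)
  qed measurable
  then have "(\<integral>z. (\<integral>\<omega>. ft f \<omega> * cis (- (\<omega> \<bullet> z)) * ?E \<omega> \<partial>lborel) \<partial>\<mu>) =
    (\<integral>\<omega>. (\<integral>z. ft f \<omega> * cis (- (\<omega> \<bullet> z)) * ?E \<omega> \<partial>\<mu>) \<partial>lborel)"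
    by (rule P.Fubini_integral)
  then show ?thesis
    by (simp add: integral_ft_mult_gauss[OF f s])
qed

section \<open>The density as a complex function and its characteristic function\<close>

lemma pds_of_real:
  fixes f :: "'a::euclidean_space \<Rightarrow> real"
  assumes "Ck k f" "set bs \<subseteq> Basis" "length bs \<le> k"
  shows "pds bs (\<lambda>x. complex_of_real (f x)) = (\<lambda>x. complex_of_real (pds bs f x))"
  using assms(2,3)
proof (induction bs)
  case (Cons b bs)
  have "((\<lambda>x. complex_of_real (pds bs f x)) has_derivative
    (\<lambda>h. complex_of_real (frechet_derivative (pds bs f) (at x) h))) (at x)" for x
    using Ck_differentiable[OF assms(1), of bs x] Cons.prems
    by (intro has_derivative_of_real) (simp add: frechet_derivative_works)
  from frechet_derivative_at[OF this, symmetric] show ?case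
    using Cons by simp
qed simp

lemma C0k_of_real:
  fixes f :: "'a::euclidean_space \<Rightarrow> real"
  assumes f: "C0k k f"
  shows "C0k k (\<lambda>x. complex_of_real (f x))"
  unfolding C0k_def Ck_def
proof (intro conjI allI ballI impI, elim conjE)
  have C: "Ck k f"
    using f by (simp add: C0k_def)
  note pds = pds_of_real[OF C]
  {
    fix bs :: "'a list" and x assume bs: "set bs \<subseteq> Basis" "length bs < k"
    have "((\<lambda>x. complex_of_real (pds bs f x)) has_derivative
      (\<lambda>h. complex_of_real (frechet_derivative (pds bs f) (at x) h))) (at x)"
      using Ck_differentiable[OF C bs, of x]
      by (intro has_derivative_of_real) (simp add: frechet_derivative_works)
    then show "pds bs (\<lambda>x. complex_of_real (f x)) differentiable at x"
      using bs by (auto simp: pds differentiable_def)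
  next
    fix bs :: "'a list" assume bs: "bs \<in> multi_idx k"
    then have eq: "pds bs (\<lambda>x. complex_of_real (f x)) = (\<lambda>x. complex_of_real (pds bs f x))"
      by (intro pds) (auto simp: multi_idx_def)
    show "continuous_on UNIV (pds bs (\<lambda>x. complex_of_real (f x)))"
      using Ck_continuous[OF C bs] unfolding eq by (intro continuous_intros)
    have "(pds bs f \<longlongrightarrow> 0) at_infinity"
      using f bs by (simp add: C0k_def)
    then show "(pds bs (\<lambda>x. complex_of_real (f x)) \<longlongrightarrow> 0) at_infinity"
      unfolding eq by (simp add: tendsto_of_real_iff[of _ 0, simplified])
  }
qed

text \<open>\<open>ennreal\<close> cuts off negative values; pointwise nonnegativity lets the law of
  \<open>V\<close> be integrated through the real function \<open>fV\<close> itself.\<close>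

lemma distributed_lborel_density:
  fixes V :: "'s \<Rightarrow> 'a::euclidean_space" and fV :: "'a \<Rightarrow> real"
  assumes "prob_space M" "distributed M lborel V (\<lambda>x. ennreal (fV x))"
    and nonneg: "\<And>x. 0 \<le> fV x" and [measurable]: "fV \<in> borel_measurable borel" "V \<in> borel_measurable M"
  shows "integrable lborel fV"
    and "char_fn M V \<omega> = (\<integral>x. cis (\<omega> \<bullet> x) * complex_of_real (fV x) \<partial>lborel)"
proof -
  interpret prob_space M by fact
  have eq: "distr M lborel V = density lborel (\<lambda>x. ennreal (fV x))"
    using assms(2) by (rule distributed_distr_eq_density)
  have "emeasure (distr M lborel V) UNIV = 1"
    by (subst emeasure_distr) (auto simp: emeasure_space_1)
  then have "(\<integral>\<^sup>+ x. ennreal (fV x) \<partial>lborel) = 1"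
    unfolding eq by (simp add: emeasure_density)
  then show "integrable lborel fV"
    using nonneg by (intro integrableI_nonneg) auto
  have "char_fn M V \<omega> = (\<integral>x. cis (\<omega> \<bullet> x) \<partial>distr M lborel V)"
    unfolding char_fn_def by (subst integral_distr) auto
  also have "\<dots> = (\<integral>x. fV x *\<^sub>R cis (\<omega> \<bullet> x) \<partial>lborel)"
    unfolding eq using nonneg by (subst integral_density) auto
  finally show "char_fn M V \<omega> = (\<integral>x. cis (\<omega> \<bullet> x) * complex_of_real (fV x) \<partial>lborel)"
    by (simp add: scaleR_conv_of_real mult.commute)
qed

text \<open>Lebesgue measure is invariant under reflection. The need arises because \<open>Q\<close>
  divides by the characteristic function at \<open>- \<omega>\<close>, while the null set of its
  zeros is given in terms of \<open>\<omega>\<close>.\<close>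

lemma AE_lborel_uminus:
  assumes "AE x in (lborel :: 'a::euclidean_space measure). P x"
  shows "AE x in (lborel :: 'a measure). P (- x)"
proof -
  have "AE x in distr lborel borel (\<lambda>x :: 'a. 0 - x). P x"
    unfolding distr_lborel_reflect by fact
  then have "AE x in (lborel :: 'a measure). P (0 - x)"
    by (rule AE_distrD[rotated]) measurable
  then show ?thesis
    by simp
qed

section \<open>The Tweedie functional\<close>

text \<open>\<open>L\<close> is a total function on all functions, so linearity, boundedness and
  uniqueness are relative to \<open>Xi k\<close>; its values elsewhere are arbitrary. Independence
  of the pair representing a signed measure is built in, since \<open>L\<close> is applied to the
  convolution and not to the pair.\<close>

theorem theorem2:
  fixes M :: "'s measure"
    and X V :: "'s \<Rightarrow> 'a::euclidean_space"
    and fV :: "'a \<Rightarrow> real"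
    and g :: "'a \<Rightarrow> real"
    and y :: 'a
    and k :: nat
  defines "lam \<equiv> (\<lambda>x. complex_of_real (g x * fV (y - x)))"
  defines "Q \<equiv> (\<lambda>\<omega>. if char_fn M V (- \<omega>) \<noteq> 0 then ft lam \<omega> / char_fn M V (- \<omega>) else 0)"
  assumes "prob_space M"
    and "X \<in> borel_measurable M" and "V \<in> borel_measurable M"
    and "prob_space.indep_var M borel X borel V"
    and "\<forall>x. 0 \<le> fV x"
    and "distributed M lborel V (\<lambda>x. ennreal (fV x))"
    and "C0k k fV"
    and "AE \<omega> in lborel. char_fn M V \<omega> \<noteq> 0"
    and "g \<in> borel_measurable borel"
    and "lam \<in> Xi 0"
    and "integrable lborel (ft lam)"
    and "\<exists>N::nat. (\<integral>\<^sup>+ \<omega>. ennreal (norm (Q \<omega>) / (1 + norm \<omega>) ^ N) \<partial>lborel) < \<infinity>"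
    and "\<exists>C>0. \<forall>\<psi>. schwartz \<psi> \<longrightarrow> norm (inv_ft_reg_distr Q \<psi>) \<le> C * xi_norm k \<psi>"
  shows "(\<exists>L :: ('a \<Rightarrow> complex) \<Rightarrow> complex.
            ((\<forall>\<psi>\<in>Xi k. \<forall>\<phi>\<in>Xi k. \<forall>a b. L (\<lambda>x. a * \<psi> x + b * \<phi> x) = a * L \<psi> + b * L \<phi>) \<and>
             (\<exists>C. \<forall>\<psi>\<in>Xi k. norm (L \<psi>) \<le> C * xi_norm k \<psi>) \<and>
             (\<forall>\<psi>. schwartz \<psi> \<longrightarrow> L \<psi> = inv_ft_reg_distr Q \<psi>)) \<and>
            (\<forall>L'. ((\<forall>\<psi>\<in>Xi k. \<forall>\<phi>\<in>Xi k. \<forall>a b. L' (\<lambda>x. a * \<psi> x + b * \<phi> x) = a * L' \<psi> + b * L' \<phi>) \<and>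
                   (\<exists>C. \<forall>\<psi>\<in>Xi k. norm (L' \<psi>) \<le> C * xi_norm k \<psi>) \<and>
                   (\<forall>\<psi>. schwartz \<psi> \<longrightarrow> L' \<psi> = inv_ft_reg_distr Q \<psi>))
                  \<longrightarrow> (\<forall>\<psi>\<in>Xi k. L' \<psi> = L \<psi>)) \<and>
            (\<forall>\<mu>1 \<mu>2. fin_borel \<mu>1 \<and> fin_borel \<mu>2 \<longrightarrow>
               (\<lambda>x. complex_of_real (conv_meas fV \<mu>1 \<mu>2 x)) \<in> Xi k \<and>
               L (\<lambda>x. complex_of_real (conv_meas fV \<mu>1 \<mu>2 x)) =
                 complex_of_real ((\<integral>x. g x * fV (y - x) \<partial>\<mu>1) - (\<integral>x. g x * fV (y - x) \<partial>\<mu>2))))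
       \<and> (\<forall>\<mu>1 \<mu>2 fs. fin_borel \<mu>1 \<and> fin_borel \<mu>2 \<and> (\<forall>n. schwartz (fs n)) \<and>
            (\<lambda>n. xi_norm k (\<lambda>x. fs n x - complex_of_real (conv_meas fV \<mu>1 \<mu>2 x))) \<longlonglongrightarrow> 0
            \<longrightarrow> (\<lambda>n. inv_ft_reg_distr Q (fs n)) \<longlonglongrightarrow>
                  complex_of_real ((\<integral>x. g x * fV (y - x) \<partial>\<mu>1) - (\<integral>x. g x * fV (y - x) \<partial>\<mu>2)))"
proof -
  interpret M: prob_space M by fact
  define F where "F = (\<lambda>x. complex_of_real (fV x))"
  \<comment> \<open>The functional on one positive measure, complex-valued;
    \<open>tweedie_eq\<close> recovers the real difference of the goal.\<close>
  define tweedie where "tweedie \<mu> = (\<integral>x. lam x \<partial>\<mu>)" for \<mu>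
  have fV_cont: "continuous_on UNIV fV"
    using assms(9) Ck_continuous[of k fV "[]"] by (simp add: C0k_def)
  have fV_meas: "fV \<in> borel_measurable borel"
    using fV_cont by (rule borel_measurable_continuous_onI)
  note density = distributed_lborel_density[OF assms(3,8) assms(7)[rule_format] fV_meas assms(5)]
  have F: "F \<in> Xi k"
    using C0k_of_real[OF assms(9)] density(1) by (simp add: Xi_def F_def)
  have F_int: "integrable lborel F"
    using F by (simp add: Xi_def)
  have lam: "continuous_on UNIV lam" "(lam \<longlongrightarrow> 0) at_infinity" "integrable lborel lam"
    using assms(12) by (auto simp: Xi_def C0k_0)
  have lam_meas [measurable]: "lam \<in> borel_measurable borel"
    using lam(1) by (rule borel_measurable_continuous_onI)
  have [measurable]: "char_fn M V \<in> borel_measurable borel" "ft lam \<in> borel_measurable borel"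
    by (intro borel_measurable_char_fn borel_measurable_ft assms(3,5) lam_meas)+
  have Q_meas: "Q \<in> borel_measurable borel"
    unfolding Q_def by measurable
  obtain N :: nat where N: "(\<integral>\<^sup>+ \<omega>. ennreal (norm (Q \<omega>) / (1 + norm \<omega>) ^ N) \<partial>lborel) < \<infinity>"
    using assms(14) by blast
  have Q_int: "integrable lborel (\<lambda>\<omega>. norm (Q \<omega>) / (1 + norm \<omega>) ^ N)"
    using N Q_meas by (intro integrableI_nonneg) auto
  obtain C where C: "C > 0" "\<And>\<psi>. schwartz \<psi> \<Longrightarrow> norm (inv_ft_reg_distr Q \<psi>) \<le> C * xi_norm k \<psi>"
    using assms(15) by blast

  \<comment> \<open>Existence, continuity and uniqueness of the extension\<close>
  have "\<exists>L. (\<forall>\<psi>\<in>Xi k. \<forall>\<phi>\<in>Xi k. \<forall>a b. L (\<lambda>x. a * \<psi> x + b * \<phi> x) = a * L \<psi> + b * L \<phi>) \<and>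
    (\<forall>\<psi>\<in>Xi k. norm (L \<psi>) \<le> C * xi_norm k \<psi>) \<and> (\<forall>\<psi>\<in>Collect schwartz. L \<psi> = inv_ft_reg_distr Q \<psi>)"
  proof (rule bounded_linear_extension)
    show "\<exists>h\<in>Collect schwartz. xi_norm k (\<lambda>x. h x - f x) < e" if "f \<in> Xi k" "e > 0" for f :: "'a \<Rightarrow> complex" and e
      using schwartz_dense_Xi[OF that] by blast
    show "Collect schwartz \<subseteq> Xi k"
      using schwartz_imp_Xi by blast
    show "inv_ft_reg_distr Q (\<lambda>x. a * f x + b * g x) = a * inv_ft_reg_distr Q f + b * inv_ft_reg_distr Q g"
      if "f \<in> Collect schwartz" "g \<in> Collect schwartz" for f g a b
      using that by (intro inv_ft_reg_distr_lincomb[OF Q_meas Q_int]) auto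
    show "norm (inv_ft_reg_distr Q f) \<le> C * xi_norm k f" if "f \<in> Collect schwartz" for f
      using C(2) that by simp
    show "C \<ge> 0"
      using C(1) by simp
  qed (simp_all add: Xi_lincomb xi_norm_lincomb xi_norm_nonneg schwartz_lincomb)
  then obtain L where L_lin: "\<forall>\<psi>\<in>Xi k. \<forall>\<phi>\<in>Xi k. \<forall>a b. L (\<lambda>x. a * \<psi> x + b * \<phi> x) = a * L \<psi> + b * L \<phi>"
    and L_le: "\<forall>\<psi>\<in>Xi k. norm (L \<psi>) \<le> C * xi_norm k \<psi>"
    and L_ext: "\<forall>\<psi>\<in>Collect schwartz. L \<psi> = inv_ft_reg_distr Q \<psi>"
    by (elim exE conjE)
  have L_bound: "\<exists>C. \<forall>\<psi>\<in>Xi k. norm (L \<psi>) \<le> C * xi_norm k \<psi>"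
    using L_le by blast
  have L_schwartz: "L \<psi> = inv_ft_reg_distr Q \<psi>" if "schwartz \<psi>" for \<psi>
    using L_ext that by simp

  \<comment> \<open>Stated for an arbitrary bounded linear functional, since it gives both the
    continuity of \<open>L\<close> and, for a competitor, uniqueness.\<close>
  have tendsto: "(\<lambda>n. L' (fs n)) \<longlonglongrightarrow> L' f"
    if lin: "\<forall>\<psi>\<in>Xi k. \<forall>\<phi>\<in>Xi k. \<forall>a b. L' (\<lambda>x. a * \<psi> x + b * \<phi> x) = a * L' \<psi> + b * L' \<phi>"
      and bound: "\<exists>C. \<forall>\<psi>\<in>Xi k. norm (L' \<psi>) \<le> C * xi_norm k \<psi>"
      and f: "f \<in> Xi k" "\<And>n. fs n \<in> Xi k" and lim: "(\<lambda>n. xi_norm k (\<lambda>x. fs n x - f x)) \<longlonglongrightarrow> 0"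
    for L' :: "('a \<Rightarrow> complex) \<Rightarrow> complex" and fs f
  proof -
    obtain C' where C': "\<And>\<psi>. \<psi> \<in> Xi k \<Longrightarrow> norm (L' \<psi>) \<le> C' * xi_norm k \<psi>"
      using bound by auto
    have "norm (L' (fs n) - L' f) \<le> C' * xi_norm k (\<lambda>x. fs n x - f x)" for n
    proof -
      have "L' (\<lambda>x. fs n x - f x) = L' (fs n) - L' f"
        using lin[rule_format, OF f(2)[of n] f(1), of 1 "- 1"] by simp
      then show ?thesis
        using C'[OF Xi_diff[OF f(2)[of n] f(1)]] by simp
    qed
    then have le: "\<forall>\<^sub>F n in sequentially. norm (L' (fs n) - L' f) \<le> C' * xi_norm k (\<lambda>x. fs n x - f x)"
      by (intro always_eventually allI)
    have "(\<lambda>n. C' * xi_norm k (\<lambda>x. fs n x - f x)) \<longlonglongrightarrow> 0"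
      using tendsto_mult[OF tendsto_const lim, of C'] by simp
    from Lim_null_comparison[OF le this] have "(\<lambda>n. L' (fs n) - L' f) \<longlonglongrightarrow> 0" .
    then show ?thesis
      by (simp add: LIM_zero_iff)
  qed
  have L_cont: "(\<lambda>n. L (fs n)) \<longlonglongrightarrow> L f"
    if "f \<in> Xi k" "\<And>n. fs n \<in> Xi k" "(\<lambda>n. xi_norm k (\<lambda>x. fs n x - f x)) \<longlonglongrightarrow> 0" for f fs
    by (rule tendsto[OF L_lin L_bound that])

  have unique: "L' \<psi> = L \<psi>"
    if lin: "\<forall>\<psi>\<in>Xi k. \<forall>\<phi>\<in>Xi k. \<forall>a b. L' (\<lambda>x. a * \<psi> x + b * \<phi> x) = a * L' \<psi> + b * L' \<phi>"
      and bound: "\<exists>C. \<forall>\<psi>\<in>Xi k. norm (L' \<psi>) \<le> C * xi_norm k \<psi>"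
      and ext: "\<forall>\<psi>. schwartz \<psi> \<longrightarrow> L' \<psi> = inv_ft_reg_distr Q \<psi>"
      and \<psi>: "\<psi> \<in> Xi k" for L' \<psi>
  proof -
    have "\<exists>h. schwartz h \<and> xi_norm k (\<lambda>x. h x - \<psi> x) < inverse (real (Suc n))" for n
      using schwartz_dense_Xi[OF \<psi>, of "inverse (real (Suc n))"] by auto
    then obtain h where h: "\<And>n. schwartz (h n)" "\<And>n. xi_norm k (\<lambda>x. h n x - \<psi> x) < inverse (real (Suc n))"
      by metis
    have h_Xi: "h n \<in> Xi k" for n
      using h(1) by (rule schwartz_imp_Xi)
    have lim: "(\<lambda>n. xi_norm k (\<lambda>x. h n x - \<psi> x)) \<longlonglongrightarrow> 0"
      using h(2) xi_norm_nonneg[OF Xi_diff[OF h_Xi \<psi>]]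
      by (intro tendsto_sandwich[OF _ _ tendsto_const LIMSEQ_inverse_real_of_nat])
        (auto intro!: always_eventually less_imp_le)
    have "(\<lambda>n. L' (h n)) \<longlonglongrightarrow> L' \<psi>"
      by (rule tendsto[OF lin bound \<psi> h_Xi lim])
    moreover have "(\<lambda>n. L' (h n)) \<longlonglongrightarrow> L \<psi>"
      using L_cont[OF \<psi> h_Xi lim] L_schwartz h(1) ext by simp
    ultimately show ?thesis
      by (rule LIMSEQ_unique)
  qed

  have smooth: "L (wconv lborel (cgauss s) f) = (\<integral>\<omega>. Q \<omega> * (complex_of_real (gauss_ft s \<omega>) * ift f \<omega>) \<partial>lborel)"
    if f: "f \<in> Xi k" and s: "s > 0" for f s
  proof -
    have f_int: "integrable lborel f"
      using f by (simp add: Xi_def)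
    let ?h = "\<lambda>n. wconv lborel (truncate_ball n f) (cgauss s)"
    have h: "schwartz (?h n)" for n
      using f_int s by (rule schwartz_mollified_truncation)
    have "(\<lambda>n. L (?h n)) \<longlonglongrightarrow> L (wconv lborel (cgauss s) f)"
      by (intro L_cont[OF Xi_wconv_gauss[OF f s] schwartz_imp_Xi[OF h]]
          xi_norm_mollified_truncation_tendsto f_int s)
    \<comment> \<open>The same sequence has two limits: this one by continuity in the norm of
      \<open>Xi k\<close>, the other by dominated convergence in frequency.\<close>
    then have "(\<lambda>n. inv_ft_reg_distr Q (?h n)) \<longlonglongrightarrow> L (wconv lborel (cgauss s) f)"
      using L_schwartz h by simp
    with inv_ft_reg_distr_mollified_truncation_tendsto[OF Q_meas Q_int f_int s] show ?thesis
      by (rule LIMSEQ_unique[rotated])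
  qed

  \<comment> \<open>Evaluation on convolutions of the density with a measure\<close>
  have conv_Xi: "wconv \<mu> (\<lambda>_. 1) F \<in> Xi k" if "fin_borel \<mu>" for \<mu>
  proof -
    interpret finite_measure \<mu>
      using that by (simp add: fin_borel_def)
    show ?thesis
      using that F by (intro Xi_wconv) (unfold_locales, auto simp: fin_borel_def)
  qed

  have L_conv: "L (wconv \<mu> (\<lambda>_. 1) F) = tweedie \<mu>" if \<mu>: "fin_borel \<mu>" for \<mu>
  proof -
    interpret finite_measure \<mu>
      using \<mu> by (simp add: fin_borel_def)
    have sets_\<mu> [measurable_cong]: "sets \<mu> = sets borel"
      using \<mu> by (simp add: fin_borel_def)
    let ?f = "wconv \<mu> (\<lambda>_. 1) F"
    let ?d = "complex_of_real (1 / (2 * pi) ^ DIM('a))"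
    \<comment> \<open>The minus sign in \<open>ift\<close> is the reason for the argument
      \<open>- \<omega>\<close>, which matches the denominator of \<open>Q\<close>.\<close>
    have ift_F: "ift F \<omega> = ?d * char_fn M V (- \<omega>)" for \<omega>
      by (simp add: ift_def density(2) F_def inner_commute)
    have ift_f: "ift ?f \<omega> = (\<integral>z. cis (- (\<omega> \<bullet> z)) \<partial>\<mu>) * ift F \<omega>" for \<omega>
      using ift_wconv[OF sigma_finite_measure_axioms sets_\<mu> _ F_int, of "\<lambda>_. 1" \<omega>] by simp
    have "AE \<omega> in lborel. char_fn M V (- \<omega>) \<noteq> 0"
      using assms(10) by (rule AE_lborel_uminus)
    \<comment> \<open>Where the denominator of \<open>Q\<close> vanishes, \<open>Q\<close> has the
      default value 0 and the cancellation may fail, but this happens only on a null set.\<close>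
    then have QF: "AE \<omega> in lborel. Q \<omega> * ift F \<omega> = ?d * ft lam \<omega>"
      by eventually_elim (simp add: Q_def ift_F)
    have moll: "L (wconv lborel (cgauss s) ?f) = (\<integral>z. wconv lborel (cgauss s) lam z \<partial>\<mu>)" if s: "s > 0" for s
    proof -
      have [measurable]: "F \<in> borel_measurable borel"
        using borel_measurable_integrable[OF F_int] by simp
      have [measurable]: "ift F \<in> borel_measurable borel"
        by (rule borel_measurable_ift) measurable
      note [measurable] = Q_meas
      have "L (wconv lborel (cgauss s) ?f) =
        (\<integral>\<omega>. Q \<omega> * (complex_of_real (gauss_ft s \<omega>) * ((\<integral>z. cis (- (\<omega> \<bullet> z)) \<partial>\<mu>) * ift F \<omega>)) \<partial>lborel)"
        by (simp add: smooth[OF conv_Xi[OF \<mu>] s] ift_f)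
      also have "\<dots> = (\<integral>\<omega>. ?d * (ft lam \<omega> * (\<integral>z. cis (- (\<omega> \<bullet> z)) \<partial>\<mu>) * complex_of_real (gauss_ft s \<omega>)) \<partial>lborel)"
      proof (rule integral_cong_AE)
        show "AE \<omega> in lborel. Q \<omega> * (complex_of_real (gauss_ft s \<omega>) * ((\<integral>z. cis (- (\<omega> \<bullet> z)) \<partial>\<mu>) * ift F \<omega>)) =
          ?d * (ft lam \<omega> * (\<integral>z. cis (- (\<omega> \<bullet> z)) \<partial>\<mu>) * complex_of_real (gauss_ft s \<omega>))"
          using QF
        proof eventually_elim
          case (elim \<omega>)
          have "Q \<omega> * (complex_of_real (gauss_ft s \<omega>) * ((\<integral>z. cis (- (\<omega> \<bullet> z)) \<partial>\<mu>) * ift F \<omega>)) =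
            (Q \<omega> * ift F \<omega>) * (complex_of_real (gauss_ft s \<omega>) * (\<integral>z. cis (- (\<omega> \<bullet> z)) \<partial>\<mu>))"
            by (simp only: ac_simps)
          then show ?case
            unfolding elim by (simp only: ac_simps)
        qed
      qed measurable
      \<comment> \<open>The constant \<open>?d\<close> of \<open>ift F\<close> meets its inverse
        from the inversion of the Gaussian.\<close>
      also have "\<dots> = ?d * (complex_of_real ((2 * pi) ^ DIM('a)) * (\<integral>z. wconv lborel (cgauss s) lam z \<partial>\<mu>))"
        by (simp only: integral_mult_right_zero integral_ft_mult_char_gauss[OF \<mu> lam(3) s])
      also have "\<dots> = (\<integral>z. wconv lborel (cgauss s) lam z \<partial>\<mu>)"
        by (simp flip: mult.assoc)
      finally show ?thesis .
    qed
    obtain B where B: "\<And>x. norm (lam x) \<le> B"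
      using C0_bounded[OF lam(1,2)] by (auto simp: bounded_iff)
    \<comment> \<open>Averaging \<open>lam\<close> against a Gaussian of mass 1 does not exceed its
      bound \<open>B\<close>, and constants are integrable for the finite measure \<mu>.\<close>
    have "(\<lambda>n. \<integral>z. wconv lborel (cgauss (inv_Suc n)) lam z \<partial>\<mu>) \<longlonglongrightarrow> tweedie \<mu>"
      unfolding tweedie_def
    proof (rule integral_dominated_convergence[where w="\<lambda>_. B"])
      show "AE z in \<mu>. (\<lambda>n. wconv lborel (cgauss (inv_Suc n)) lam z) \<longlonglongrightarrow> lam z"
        by (intro AE_I2 wconv_gauss_LIMSEQ lam)
      have "norm (wconv lborel (cgauss (inv_Suc n)) lam z) \<le> (\<integral>x. norm (cgauss (inv_Suc n) (x :: 'a)) \<partial>lborel) * B" for n z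
        using B by (intro norm_wconv_le) auto
      then show "AE z in \<mu>. norm (wconv lborel (cgauss (inv_Suc n)) lam z) \<le> B" for n
        by simp
      show "wconv lborel (cgauss (inv_Suc n)) lam \<in> borel_measurable \<mu>" for n
        using Xi_wconv_gauss[OF assms(12) inv_Suc_pos, of n]
        by (simp add: measurable_cong_sets[OF sets_\<mu> refl] Xi_def C0k_0 borel_measurable_continuous_onI)
    qed auto
    moreover have "(\<lambda>n. L (wconv lborel (cgauss (inv_Suc n)) ?f)) \<longlonglongrightarrow> L ?f"
      by (intro L_cont Xi_wconv_gauss conv_Xi \<mu> inv_Suc_pos xi_norm_wconv_gauss_tendsto)
    ultimately show ?thesis
      unfolding moll[OF inv_Suc_pos] by (rule LIMSEQ_unique[rotated])
  qed

  \<comment> \<open>The coefficients 1 and -1 are written out to match the form of linearity in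
    \<open>L_lin\<close>.\<close>
  have conv_eq: "(\<lambda>x. complex_of_real (conv_meas fV \<mu>1 \<mu>2 x)) =
      (\<lambda>x. 1 * wconv \<mu>1 (\<lambda>_. 1) F x + (- 1) * wconv \<mu>2 (\<lambda>_. 1) F x)" for \<mu>1 \<mu>2
    by (simp add: conv_meas_def wconv_def F_def)
  have tweedie_eq: "complex_of_real ((\<integral>x. g x * fV (y - x) \<partial>\<mu>1) - (\<integral>x. g x * fV (y - x) \<partial>\<mu>2)) =
      tweedie \<mu>1 - tweedie \<mu>2" for \<mu>1 \<mu>2
    by (simp only: tweedie_def lam_def integral_complex_of_real of_real_diff)
  have A: "(\<lambda>x. complex_of_real (conv_meas fV \<mu>1 \<mu>2 x)) \<in> Xi k"
    "L (\<lambda>x. complex_of_real (conv_meas fV \<mu>1 \<mu>2 x)) =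
      complex_of_real ((\<integral>x. g x * fV (y - x) \<partial>\<mu>1) - (\<integral>x. g x * fV (y - x) \<partial>\<mu>2))"
    if "fin_borel \<mu>1" "fin_borel \<mu>2" for \<mu>1 \<mu>2
  proof -
    show "(\<lambda>x. complex_of_real (conv_meas fV \<mu>1 \<mu>2 x)) \<in> Xi k"
      unfolding conv_eq using that by (intro Xi_lincomb conv_Xi)
    show "L (\<lambda>x. complex_of_real (conv_meas fV \<mu>1 \<mu>2 x)) =
      complex_of_real ((\<integral>x. g x * fV (y - x) \<partial>\<mu>1) - (\<integral>x. g x * fV (y - x) \<partial>\<mu>2))"
      unfolding conv_eq tweedie_eq L_lin[rule_format, OF conv_Xi[OF that(1)] conv_Xi[OF that(2)]]
      by (simp add: L_conv that)
  qed
  have seq: "(\<lambda>n. inv_ft_reg_distr Q (fs n)) \<longlonglongrightarrow>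
      complex_of_real ((\<integral>x. g x * fV (y - x) \<partial>\<mu>1) - (\<integral>x. g x * fV (y - x) \<partial>\<mu>2))"
    if \<mu>: "fin_borel \<mu>1" "fin_borel \<mu>2" and fs: "\<forall>n. schwartz (fs n)"
      and lim: "(\<lambda>n. xi_norm k (\<lambda>x. fs n x - complex_of_real (conv_meas fV \<mu>1 \<mu>2 x))) \<longlonglongrightarrow> 0" for \<mu>1 \<mu>2 fs
  proof -
    have "fs n \<in> Xi k" for n
      using fs schwartz_imp_Xi by blast
    from L_cont[OF A(1)[OF \<mu>] this lim] show ?thesis
      using fs L_schwartz by (simp only: A(2)[OF \<mu>])
  qed
  show ?thesis
  proof (intro conjI exI[of _ L] allI impI)
    show "\<forall>\<psi>\<in>Xi k. L' \<psi> = L \<psi>"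
      if "(\<forall>\<psi>\<in>Xi k. \<forall>\<phi>\<in>Xi k. \<forall>a b. L' (\<lambda>x. a * \<psi> x + b * \<phi> x) = a * L' \<psi> + b * L' \<phi>) \<and>
        (\<exists>C. \<forall>\<psi>\<in>Xi k. norm (L' \<psi>) \<le> C * xi_norm k \<psi>) \<and>
        (\<forall>\<psi>. schwartz \<psi> \<longrightarrow> L' \<psi> = inv_ft_reg_distr Q \<psi>)" for L'
      by (intro ballI, rule unique) (use that in simp_all)
  qed (use L_lin L_bound L_schwartz A seq in \<open>simp_all only: simp_thms\<close>)
qed

end
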